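(* Let $n\geq 1$ and let $\hat{\Pi}^{2}_n$ be the bounded poset obtained from the poset $\Pi^2_n$ of noncrossing 2-partitions of $\llbracket 1;n\rrbracket$ by adjoining a new maximum $\hat 1$. For each $\phi\in \Pi^2_n$ let $\prec_\phi$ be the total order on the set $\operatorname{Up}(\phi)$ of upper covers of $\phi$ in $\hat{\Pi}^{2}_n$ defined below, and let $<_{\rm lex}$ be the induced lexicographic order on maximal chains of $\hat{\Pi}^{2}_n$. Then $<_{\rm lex}$ is a shelling of $\hat{\Pi}^{2}_n$.
   Context: Notation: $\llbracket i;j\rrbracket=\{i,\dots,j\}$. $\Pi_n$ is the set of set partitions of $\llbracket 1;n\rrbracket$ and $NC_n\subset \Pi_n$ the noncrossing ones (no $i<j<k<l$ with $i,k$ in one block and $j,l$ in another block). Both are ordered so that $\pi\leq\tau$ iff $\tau$ refines $\pi$; the minimum $0_n$ has one block, the maximum $1_n$ has $n$ singleton blocks. A noncrossing 2-partition is a triple $(\pi,\rho,\lambda)$ with $\pi\in NC_n$, $\rho\in\Pi_n$, and $\lambda$ a bijection from the blocks of $\pi$ to the blocks of $\rho$ with $|\lambda(B)|=|B|$ for all $B$. The set of these is $\Pi^2_n$, ordered by $(\pi,\rho,\lambda)\geq(\pi',\rho',\lambda')$ iff $\pi$ refines $\pi'$, $\rho$ refines $\rho'$, and whenever $B'=\biguplus_i B_i$ with $B'\in\pi'$, $B_i\in\pi$, then $\lambda'(B')=\biguplus_i\lambda(B_i)$. It is ranked with rank $|\pi|-1$; its maximal elements have rank $n-1$. Each $(\pi,\rho,\lambda)$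 is identified with the pair $(\pi,\sigma)$ where $\sigma\in\mathfrak S_n$ is the unique permutation with $\sigma(B)=\lambda(B)$ for every block $B$ of $\pi$ and $\sigma$ increasing on each block of $\pi$. Code: for $\sigma\in\mathfrak S_n$, $c_i(\sigma)=\#\{j\in\llbracket1;i-1\rrbracket : \sigma^{-1}(j)>\sigma^{-1}(i)\}$ and $\gamma(\sigma)=c_n(\sigma)c_{n-1}(\sigma)\cdots c_1(\sigma)$; words $\gamma$ are compared lexicographically. Labeling of $NC_n$: to $\pi\in NC_n$ associate the permutation $\bar\pi$ having, for each block $\{b_1<\dots<b_k\}$, the cycle $b_1\mapsto b_2\mapsto\cdots\mapsto b_k\mapsto b_1$. For a cover $x\lessdot y$ in $NC_n$, $\lambda(x,y)=\bar x^{-1}\bar y$ (product of permutations, composed right to left) is a transposition $(i\,j)$, $i<j$; transpositions are ordered lexicographically by $(i,j)$. Orders $\prec_\phi$: if $\phi=(\pi,\sigma)$ has rank $<n-1$, all its upper covers lie in $\Pi^2_n$ and $(\rho,\tau)\prec_\phi(\rho',\tau')$ iff $\gamma(\tau)<\gamma(\tau')$, or $\gamma(\tau)=\gamma(\tau')$ and $\lambda(\pi,\rho)<\lambda(\pi,\rho')$. If $\phi$ has rank $n-1$, $\operatorname{Up}(\phi)=\{\hat 1\}$ with the trivial order. A maximal chain $(p'_i)$ precedes $(p_i)$ in $<_{\rm lex}$ iff $p'_{j+1}\prec_{p_j}p_{j+1}$ where $j$ is the least index with $p'_{j+1}\neq p_{j+1}$. Shelling: a total order $<$ on the maximal chains of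 a ranked bounded poset is a shelling if whenever $\underline p'<\underline p$ there is a maximal chain $\underline p''<\underline p$ which differs from $\underline p$ in exactly one element and satisfies $\underline p'\cap\underline p\subseteq\underline p''$ (chains viewed as sets).
   Formalization: The product x̄⁻¹ȳ defining the label λ(x,y) is composed left to right (first x̄⁻¹, then ȳ) instead of right to left; with the right-to-left product the order <_lex is not a shelling for n = 4. *)

theory Defs
  imports
    "HOL-Library.Disjoint_Sets"
    "HOL-Library.FuncSet"
    "HOL-Combinatorics.Permutations"
begin

section \<open>Shellings of ranked bounded posets\<close>

text \<open>Posets are given by a carrier set and a (non-strict) order relation on it.\<close>

definition strict_of :: "('a \<Rightarrow> 'a \<Rightarrow> bool) \<Rightarrow> 'a \<Rightarrow> 'a \<Rightarrow> bool" where
  "strict_of le x y \<longleftrightarrow> le x y \<and> x \<noteq> y"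

definition poset_on :: "'a set \<Rightarrow> ('a \<Rightarrow> 'a \<Rightarrow> bool) \<Rightarrow> bool" where
  "poset_on A le \<longleftrightarrow> reflp_on A le \<and> antisymp_on A le \<and> transp_on A le"

definition bounded_poset_on :: "'a set \<Rightarrow> ('a \<Rightarrow> 'a \<Rightarrow> bool) \<Rightarrow> bool" where
  "bounded_poset_on A le \<longleftrightarrow>
     poset_on A le \<and> (\<exists>b\<in>A. \<forall>x\<in>A. le b x) \<and> (\<exists>t\<in>A. \<forall>x\<in>A. le x t)"

definition upper_covers :: "'a set \<Rightarrow> ('a \<Rightarrow> 'a \<Rightarrow> bool) \<Rightarrow> 'a \<Rightarrow> 'a set" where
  "upper_covers A le x =
     {y \<in> A. x \<in> A \<and> strict_of le x y \<and> \<not> (\<exists>z\<in>A. strict_of le x z \<and> strict_of le z y)}"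

definition ranked_on :: "'a set \<Rightarrow> ('a \<Rightarrow> 'a \<Rightarrow> bool) \<Rightarrow> bool" where
  "ranked_on A le \<longleftrightarrow>
     (\<exists>rk :: 'a \<Rightarrow> nat.
        (\<forall>x\<in>A. \<forall>y\<in>A. strict_of le x y \<longrightarrow> rk x < rk y) \<and>
        (\<forall>x\<in>A. \<forall>y\<in>upper_covers A le x. rk y = Suc (rk x)))"

definition max_chains :: "'a set \<Rightarrow> ('a \<Rightarrow> 'a \<Rightarrow> bool) \<Rightarrow> 'a set set" where
  "max_chains A le = {C. pred_on.maxchain A (strict_of le) C}"

definition strict_total_order_on :: "'a set \<Rightarrow> ('a \<Rightarrow> 'a \<Rightarrow> bool) \<Rightarrow> bool" where
  "strict_total_order_on A lt \<longleftrightarrow> irreflp_on A lt \<and> transp_on A lt \<and> totalp_on A lt"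

definition is_shelling ::
  "'a set \<Rightarrow> ('a \<Rightarrow> 'a \<Rightarrow> bool) \<Rightarrow> ('a set \<Rightarrow> 'a set \<Rightarrow> bool) \<Rightarrow> bool" where
  "is_shelling A le lt \<longleftrightarrow>
     bounded_poset_on A le \<and> ranked_on A le \<and>
     strict_total_order_on (max_chains A le) lt \<and>
     (\<forall>P'\<in>max_chains A le. \<forall>P\<in>max_chains A le. lt P' P \<longrightarrow>
        (\<exists>P''\<in>max_chains A le.
           lt P'' P \<and> card (P - P'') = 1 \<and> card (P'' - P) = 1 \<and> P' \<inter> P \<subseteq> P''))"

text \<open>The elements of a finite chain listed in increasing order.\<close>

definition chain_seq :: "('a \<Rightarrow> 'a \<Rightarrow> bool) \<Rightarrow> 'a set \<Rightarrow> 'a list" where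
  "chain_seq le C = (THE xs. set xs = C \<and> sorted_wrt (strict_of le) xs)"

text \<open>
  Here \<open>prec x\<close> is a strict order on the upper covers of \<open>x\<close>. Maximal chains of a bounded
  poset share their first element, so \<open>j + 1\<close> below is the first position where the chains differ.
\<close>

definition chain_lex ::
  "('a \<Rightarrow> 'a \<Rightarrow> bool) \<Rightarrow> ('a \<Rightarrow> 'a \<Rightarrow> 'a \<Rightarrow> bool) \<Rightarrow> 'a set \<Rightarrow> 'a set \<Rightarrow> bool" where
  "chain_lex le prec P' P \<longleftrightarrow>
     (let p' = chain_seq le P'; p = chain_seq le P in
        \<exists>j. Suc j < length p' \<and> Suc j < length p \<and>
            (\<forall>i\<le>j. p' ! i = p ! i) \<and> p' ! Suc j \<noteq> p ! Suc j \<and>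
            prec (p ! j) (p' ! Suc j) (p ! Suc j))"


section \<open>Noncrossing 2-partitions\<close>

definition noncrossing :: "nat set set \<Rightarrow> bool" where
  "noncrossing \<pi> \<longleftrightarrow>
     \<not> (\<exists>B\<in>\<pi>. \<exists>B'\<in>\<pi>. B \<noteq> B' \<and>
          (\<exists>i j k l. i < j \<and> j < k \<and> k < l \<and> i \<in> B \<and> k \<in> B \<and> j \<in> B' \<and> l \<in> B'))"

definition NC :: "nat \<Rightarrow> nat set set set" where
  "NC n = {\<pi>. partition_on {1..n} \<pi> \<and> noncrossing \<pi>}"

type_synonym nc2 = "nat set set \<times> nat set set \<times> (nat set \<Rightarrow> nat set)"

text \<open>
  The block bijection is \<^term>\<open>undefined\<close> off the blocks of \<open>\<pi>\<close> (membership in \<open>extensional\<close>), so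
  that equality of triples is equality of bijections.
\<close>

definition NC2 :: "nat \<Rightarrow> nc2 set" where
  "NC2 n = {(\<pi>, \<rho>, l). \<pi> \<in> NC n \<and> partition_on {1..n} \<rho> \<and>
              bij_betw l \<pi> \<rho> \<and> l \<in> extensional \<pi> \<and> (\<forall>B\<in>\<pi>. card (l B) = card B)}"

text \<open>The larger element is the finer one. \<open>refines A P Q\<close> says that \<open>P\<close> is finer than \<open>Q\<close>.\<close>

fun nc2_le :: "nat \<Rightarrow> nc2 \<Rightarrow> nc2 \<Rightarrow> bool" where
  "nc2_le n (\<pi>', \<rho>', l') (\<pi>, \<rho>, l) \<longleftrightarrow>
     refines {1..n} \<pi> \<pi>' \<and> refines {1..n} \<rho> \<rho>' \<and>
     (\<forall>B'\<in>\<pi>'. \<forall>S. S \<subseteq> \<pi> \<and> B' = \<Union>S \<longrightarrow> l' B' = \<Union>(l ` S))"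

definition nc2_rank :: "nc2 \<Rightarrow> nat" where
  "nc2_rank \<phi> = card (fst \<phi>) - 1"

datatype 'a with_top = Elem 'a | Hat_one

definition NC2_hat :: "nat \<Rightarrow> nc2 with_top set" where
  "NC2_hat n = insert Hat_one (Elem ` NC2 n)"

fun hat_le :: "nat \<Rightarrow> nc2 with_top \<Rightarrow> nc2 with_top \<Rightarrow> bool" where
  "hat_le n x Hat_one \<longleftrightarrow> True"
| "hat_le n Hat_one (Elem \<psi>) \<longleftrightarrow> False"
| "hat_le n (Elem \<phi>) (Elem \<psi>) \<longleftrightarrow> nc2_le n \<phi> \<psi>"


section \<open>The orders on upper covers\<close>

definition nc2_perm :: "nat \<Rightarrow> nc2 \<Rightarrow> nat \<Rightarrow> nat" where
  "nc2_perm n \<phi> =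
     (case \<phi> of (\<pi>, \<rho>, l) \<Rightarrow>
        (THE \<sigma>. \<sigma> permutes {1..n} \<and> (\<forall>B\<in>\<pi>. \<sigma> ` B = l B \<and> strict_mono_on B \<sigma>)))"

definition code_entry :: "(nat \<Rightarrow> nat) \<Rightarrow> nat \<Rightarrow> nat" where
  "code_entry \<sigma> i = card {j \<in> {1..<i}. inv \<sigma> j > inv \<sigma> i}"

text \<open>The word \<open>c\<^sub>n c\<^sub>n\<^sub>-\<^sub>1 \<dots> c\<^sub>1\<close>.\<close>

definition code_word :: "nat \<Rightarrow> (nat \<Rightarrow> nat) \<Rightarrow> nat list" where
  "code_word n \<sigma> = map (code_entry \<sigma>) (rev [1..<Suc n])"

definition word_less :: "nat list \<Rightarrow> nat list \<Rightarrow> bool" where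
  "word_less u v \<longleftrightarrow> (u, v) \<in> lexord {(a, b). a < b}"

text \<open>
  The permutation with one cycle \<open>b\<^sub>1 \<mapsto> b\<^sub>2 \<mapsto> \<dots> \<mapsto> b\<^sub>k \<mapsto> b\<^sub>1\<close> for each block
  \<open>b\<^sub>1 < \<dots> < b\<^sub>k\<close>, fixing everything outside \<open>\<Union>\<pi>\<close>.
\<close>

definition nc_cycles :: "nat set set \<Rightarrow> nat \<Rightarrow> nat" where
  "nc_cycles \<pi> i =
     (if i \<in> \<Union>\<pi> then
        (let B = (THE B. B \<in> \<pi> \<and> i \<in> B) in
           if \<exists>j\<in>B. i < j then Min {j \<in> B. i < j} else Min B)
      else i)"

text \<open>
  The label of a cover \<open>x \<lessdot> y\<close> of noncrossing partitions is the transposition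
  \<open>x\<^sup>-\<^sup>1 y\<close>, where the product is read from left to right (first \<open>x\<^sup>-\<^sup>1\<close>, then \<open>y\<close>).
  This reading is essential: with the product read from right to left, a three-element block
  \<open>a < b < c\<close> gives the two increasing label sequences \<open>(a b), (a c)\<close> and \<open>(a c), (b c)\<close>, and for
  \<open>n = 4\<close> the induced lexicographic order is not a shelling. Take the identity permutation
  throughout: the chain \<open>1234, 14|23, 1|23|4, 1|2|3|4\<close> then has the increasing labels
  \<open>(1 3), (1 4), (2 3)\<close>, so that no chain differing from it in one element precedes it, but it is
  preceded by the chain \<open>1234, 134|2, 14|2|3, 1|2|3|4\<close> with labels \<open>(1 2), (1 3), (1 4)\<close>.
  The same label is obtained by composing from right to left with all cycles reversed.
\<close>

definition nc_label :: "nat set set \<Rightarrow> nat set set \<Rightarrow> nat \<Rightarrow> nat" where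
  "nc_label x y = nc_cycles y \<circ> inv (nc_cycles x)"

definition transposition_less :: "(nat \<Rightarrow> nat) \<Rightarrow> (nat \<Rightarrow> nat) \<Rightarrow> bool" where
  "transposition_less s t \<longleftrightarrow>
     (\<exists>i j k l. i < j \<and> k < l \<and> s = transpose i j \<and> t = transpose k l \<and>
        (i < k \<or> i = k \<and> j < l))"

definition nc2_up :: "nat \<Rightarrow> nc2 \<Rightarrow> nc2 with_top set" where
  "nc2_up n \<phi> = upper_covers (NC2_hat n) (hat_le n) (Elem \<phi>)"

text \<open>
  A strict order. In rank \<open>n - 1\<close> the only upper cover is the adjoined top, and the order on it is
  the empty relation.
\<close>

definition up_less :: "nat \<Rightarrow> nc2 \<Rightarrow> nc2 with_top \<Rightarrow> nc2 with_top \<Rightarrow> bool" where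
  "up_less n \<phi> u v \<longleftrightarrow>
     u \<in> nc2_up n \<phi> \<and> v \<in> nc2_up n \<phi> \<and> nc2_rank \<phi> < n - 1 \<and>
     (\<exists>\<psi> \<psi>'. u = Elem \<psi> \<and> v = Elem \<psi>' \<and>
        (let g = code_word n (nc2_perm n \<psi>); g' = code_word n (nc2_perm n \<psi>') in
           word_less g g' \<or>
           g = g' \<and> transposition_less (nc_label (fst \<phi>) (fst \<psi>)) (nc_label (fst \<phi>) (fst \<psi>'))))"

definition hat_up_less :: "nat \<Rightarrow> nc2 with_top \<Rightarrow> nc2 with_top \<Rightarrow> nc2 with_top \<Rightarrow> bool" where
  "hat_up_less n p u v \<longleftrightarrow> (\<exists>\<phi>. p = Elem \<phi> \<and> up_less n \<phi> u v)"

end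

(*
  An upper cover splits one block B of the noncrossing partition into B \<inter> [i, j) and B - [i, j) for
  some i < j in B; its label is then the transposition (i j).  Of two codes, the smaller one is that
  in which the largest value with differing positions stands further to the right.  Splitting a
  block moves large values to the left, so codes increase along chains.

  The lexicographic order is a shelling as soon as a local condition holds: if x < p < p2 are
  consecutive covers, p2 is the first cover of p below z, and p is not the first cover of x below z,
  then p is not the first cover of x below p2.  Let q be a cover of x below z that precedes p.

  If the permutation changes from x to p, let w be the largest value that moves.  Its position in p
  is followed, in its block of x, by a smaller value.  If w does not move again from p to p2, merging
  the two blocks of p2 that contain these adjacent positions gives a noncrossing partition, hence a cover
  of x with smaller code.  If w moves again, one merges the block of its new position instead; when
  that merge has a crossing, an element above p built from the blocks of p2 and q contradicts the
  choice of p2.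

  If the permutation stays the same, some cover of p below z has a smaller label than p, hence so has
  p2, and splitting x by the label of p2 gives the required cover.
*)
theory Submission
  imports Defs "HOL-Library.Infinite_Set"
begin

section \<open>Lexicographic shellings from orders on upper covers\<close>

text \<open>In the local condition \<open>z\<close> stands for the next element common to the two
  chains. An element is treated as a pair: the relation \<open>blk\<close> of lying in one block,
  and the map \<open>pos\<close> from values to places. Below a fixed \<open>z\<close> in
  \<open>NC2 n\<close> the order is determined by \<open>blk\<close> alone, and every noncrossing
  relation coarser than that of \<open>z\<close> occurs (\<open>leq_iff_blk\<close>,
  \<open>leq_below\<close>). Merges, splits and joins are therefore built as relations. Their
  permutations are not chosen but forced, so all that is known about their codes comes from
  sortedness inside blocks, in the form of estimates for the place of one value, the largest that
  moves. Crossings are controlled by chords, see \<open>same_side\<close>. If \<open>z\<close> is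
  \<open>Hat_one\<close>, no permutation is prescribed from above; then \<open>p2\<close> keeps the
  permutation of \<open>p\<close>, and where labels decide, the partition into singletons with this
  permutation takes the place of \<open>z\<close>.\<close>

locale bounded_finite_poset =
  fixes A :: "'a set" and le :: "'a \<Rightarrow> 'a \<Rightarrow> bool" and bot top :: 'a
  assumes finite_carrier: "finite A"
    and poset: "poset_on A le"
    and bot_in: "bot \<in> A" and bot_le: "x \<in> A \<Longrightarrow> le bot x"
    and top_in: "top \<in> A" and le_top: "x \<in> A \<Longrightarrow> le x top"
begin

abbreviation lt (infix \<open>\<sqsubset>\<close> 50) where "x \<sqsubset> y \<equiv> strict_of le x y"
abbreviation Up where "Up \<equiv> upper_covers A le"

lemma le_refl: "x \<in> A \<Longrightarrow> le x x"
  using poset unfolding poset_on_def reflp_on_def by blast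

lemma le_antisym: "x \<in> A \<Longrightarrow> y \<in> A \<Longrightarrow> le x y \<Longrightarrow> le y x \<Longrightarrow> x = y"
  using poset unfolding poset_on_def antisymp_on_def by blast

lemma le_trans: "x \<in> A \<Longrightarrow> y \<in> A \<Longrightarrow> z \<in> A \<Longrightarrow> le x y \<Longrightarrow> le y z \<Longrightarrow> le x z"
  using poset unfolding poset_on_def transp_on_def by blast

lemma lt_trans: "x \<in> A \<Longrightarrow> y \<in> A \<Longrightarrow> z \<in> A \<Longrightarrow> x \<sqsubset> y \<Longrightarrow> y \<sqsubset> z \<Longrightarrow> x \<sqsubset> z"
  unfolding strict_of_def using le_trans le_antisym by metis

lemma lt_asym: "x \<in> A \<Longrightarrow> y \<in> A \<Longrightarrow> x \<sqsubset> y \<Longrightarrow> \<not> y \<sqsubset> x"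
  unfolding strict_of_def using le_antisym by metis

lemma Up_D:
  assumes "y \<in> Up x" shows "x \<in> A" "y \<in> A" "x \<sqsubset> y"
  using assms unfolding upper_covers_def by auto

section \<open>Maximal chains as lists of successive covers\<close>

definition saturated :: "'a list \<Rightarrow> bool" where
  "saturated xs \<longleftrightarrow> xs \<noteq> [] \<and> set xs \<subseteq> A \<and> hd xs = bot \<and> last xs = top \<and>
     (\<forall>i. Suc i < length xs \<longrightarrow> xs ! Suc i \<in> Up (xs ! i))"

lemma saturated_sorted:
  assumes "saturated xs"
  shows "sorted_wrt (\<sqsubset>) xs"
proof -
  have "xs ! i \<sqsubset> xs ! j" if "i < j" "j < length xs" for i j
    using that
  proof (induction j)
    case (Suc j)
    have *: "xs ! j \<sqsubset> xs ! Suc j"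
      using Suc.prems assms Up_D(3) unfolding saturated_def by blast
    show ?case
    proof (cases "i = j")
      case False
      then have "xs ! i \<sqsubset> xs ! j" using Suc by simp
      moreover have "xs ! i \<in> A" "xs ! j \<in> A" "xs ! Suc j \<in> A"
        using Suc.prems assms unfolding saturated_def by (auto simp: subset_iff)
      ultimately show ?thesis using * lt_trans by blast
    qed (use * in simp)
  qed simp
  then show ?thesis by (simp add: sorted_wrt_iff_nth_less)
qed

lemma sorted_unique:
  assumes "sorted_wrt (\<sqsubset>) xs" "sorted_wrt (\<sqsubset>) ys" "set xs = set ys" "set xs \<subseteq> A"
  shows "xs = ys"
  using assms
proof (induction xs arbitrary: ys)
  case (Cons x xs)
  obtain y ys' where ys: "ys = y # ys'" using Cons.prems by (cases ys) auto
  have inA: "x \<in> A" "y \<in> A" using Cons.prems ys by auto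
  have "x = y"
  proof (rule ccontr)
    assume "x \<noteq> y"
    then have "x \<in> set ys'" "y \<in> set xs" using Cons.prems ys by auto
    then have "y \<sqsubset> x" "x \<sqsubset> y" using Cons.prems ys by auto
    then show False using lt_asym inA by blast
  qed
  moreover have "x \<notin> set xs" "y \<notin> set ys'"
    using Cons.prems ys by (auto simp: strict_of_def)
  ultimately have "set xs = set ys'" using Cons.prems ys by auto
  then show ?case using Cons ys \<open>x = y\<close> by simp
qed simp

lemma chain_seq_eq:
  assumes "saturated xs" shows "chain_seq le (set xs) = xs"
  unfolding chain_seq_def
proof (rule the_equality)
  show "set xs = set xs \<and> sorted_wrt (\<sqsubset>) xs" using saturated_sorted assms by blast
  fix ys assume "set ys = set xs \<and> sorted_wrt (\<sqsubset>) ys"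
  then show "ys = xs"
    using sorted_unique[of ys xs] saturated_sorted[OF assms] assms saturated_def by auto
qed

lemma chain_iff:
  "pred_on.chain A (\<sqsubset>) C \<longleftrightarrow> C \<subseteq> A \<and> (\<forall>x\<in>C. \<forall>y\<in>C. x \<noteq> y \<longrightarrow> x \<sqsubset> y \<or> y \<sqsubset> x)"
  unfolding pred_on.chain_def by auto

lemma max_chain_iff:
  "C \<in> max_chains A le \<longleftrightarrow> pred_on.chain A (\<sqsubset>) C \<and>
     (\<forall>z\<in>A. (\<forall>x\<in>C. x \<noteq> z \<longrightarrow> x \<sqsubset> z \<or> z \<sqsubset> x) \<longrightarrow> z \<in> C)"
  (is "?L \<longleftrightarrow> ?R")
proof
  assume L: ?L
  then have c: "pred_on.chain A (\<sqsubset>) C" and m: "\<And>S. pred_on.chain A (\<sqsubset>) S \<Longrightarrow> \<not> C \<subset> S"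
    unfolding max_chains_def pred_on.maxchain_def by auto
  have "z \<in> C" if "z \<in> A" "\<forall>x\<in>C. x \<noteq> z \<longrightarrow> x \<sqsubset> z \<or> z \<sqsubset> x" for z
  proof -
    have "pred_on.chain A (\<sqsubset>) (insert z C)"
      using c that unfolding chain_iff by auto
    then show ?thesis using m by blast
  qed
  then show ?R using c by blast
next
  assume R: ?R
  have "\<not> C \<subset> S" if S: "pred_on.chain A (\<sqsubset>) S" for S
  proof
    assume "C \<subset> S"
    then obtain z where z: "z \<in> S" "z \<notin> C" by auto
    then have "z \<in> C" using R S \<open>C \<subset> S\<close> unfolding chain_iff by blast
    then show False using z by simp
  qed
  then show ?L using R unfolding max_chains_def pred_on.maxchain_def by auto
qed

lemma finite_chain_sorted_list:
  assumes "finite C" "pred_on.chain A (\<sqsubset>) C"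
  shows "\<exists>xs. set xs = C \<and> sorted_wrt (\<sqsubset>) xs"
  using assms
proof (induction "card C" arbitrary: C)
  case 0
  then show ?case by (intro exI[of _ "[]"]) auto
next
  case (Suc k)
  have CA: "C \<subseteq> A" using Suc.prems chain_iff by auto
  have "\<exists>m\<in>C. \<forall>x\<in>C. x \<noteq> m \<longrightarrow> \<not> x \<sqsubset> m"
  proof (rule Finite_Set.bex_min_element)
    show "finite C" "C \<noteq> {}" using Suc by auto
    show "asymp_on C (\<sqsubset>)" using lt_asym CA by (auto simp: asymp_on_def)
    show "transp_on C (\<sqsubset>)" using lt_trans CA unfolding transp_on_def by blast
  qed
  then obtain m where m: "m \<in> C" "\<forall>x\<in>C. x \<noteq> m \<longrightarrow> \<not> x \<sqsubset> m" by blast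
  have "pred_on.chain A (\<sqsubset>) (C - {m})" "finite (C - {m})"
    using Suc.prems unfolding chain_iff by auto
  moreover have "k = card (C - {m})" using Suc.hyps(2) Suc.prems m by simp
  ultimately obtain xs where "set xs = C - {m}" "sorted_wrt (\<sqsubset>) xs" using Suc.hyps(1) by blast
  moreover have "\<forall>x\<in>C - {m}. m \<sqsubset> x" using m Suc.prems unfolding chain_iff by blast
  ultimately have "set (m # xs) = C" "sorted_wrt (\<sqsubset>) (m # xs)" using m by auto
  then show ?case by blast
qed

text \<open>A maximal chain contains \<open>bot\<close> and \<open>top\<close>, and an element
  strictly between two neighbours would be comparable with the whole chain. Conversely, an element
  comparable with all members of a saturated list but not among them is caught between the last
  member below it and the next one, which is a cover.\<close>

lemma max_chains_eq_saturated: "max_chains A le = set ` {xs. saturated xs}"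
proof (intro equalityI subsetI)
  fix C assume C: "C \<in> max_chains A le"
  have ch: "pred_on.chain A (\<sqsubset>) C" and CA: "C \<subseteq> A" using C max_chain_iff chain_iff by auto
  have mx: "z \<in> C" if "z \<in> A" "\<forall>x\<in>C. x \<noteq> z \<longrightarrow> x \<sqsubset> z \<or> z \<sqsubset> x" for z
    using C that max_chain_iff by blast
  obtain xs where xs: "set xs = C" "sorted_wrt (\<sqsubset>) xs"
    using finite_chain_sorted_list ch CA finite_carrier finite_subset by metis
  have b: "bot \<in> C" using mx bot_in bot_le CA by (auto simp: strict_of_def)
  have t: "top \<in> C" using mx top_in le_top CA by (auto simp: strict_of_def)
  have ne: "xs \<noteq> []" using b xs by auto
  have "hd xs = bot"
  proof (rule ccontr)
    assume h: "hd xs \<noteq> bot"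
    have "bot \<in> set (tl xs)" using h ne b xs by (cases xs) auto
    then have "hd xs \<sqsubset> bot" using xs ne by (cases xs) auto
    moreover have "hd xs \<in> A" using xs ne CA by auto
    ultimately show False using bot_le bot_in lt_asym h by (metis strict_of_def)
  qed
  moreover have "last xs = top"
  proof (rule ccontr)
    assume h: "last xs \<noteq> top"
    obtain ys y where ys: "xs = ys @ [y]" using ne by (metis rev_exhaust)
    have "top \<in> set ys" using h t xs ys by auto
    then have "top \<sqsubset> y" using xs ys by (auto simp: sorted_wrt_append)
    moreover have "y \<in> A" using xs ys CA by auto
    ultimately show False using le_top top_in lt_asym h ys by (metis strict_of_def last_snoc)
  qed
  moreover have "xs ! Suc i \<in> Up (xs ! i)" if i: "Suc i < length xs" for i
  proof -
    have inA: "xs ! k \<in> A" if "k < length xs" for k using that xs CA by auto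
    have lt: "xs ! k \<sqsubset> xs ! l" if "k < l" "l < length xs" for k l
      using xs that by (simp add: sorted_wrt_iff_nth_less)
    have "False" if z: "z \<in> A" "xs ! i \<sqsubset> z" "z \<sqsubset> xs ! Suc i" for z
    proof -
      have "\<forall>x\<in>C. x \<noteq> z \<longrightarrow> x \<sqsubset> z \<or> z \<sqsubset> x"
      proof (intro ballI impI)
        fix x assume "x \<in> C" "x \<noteq> z"
        then obtain k where k: "k < length xs" "x = xs ! k" using xs by (metis in_set_conv_nth)
        consider "k = i" | "k < i" | "k = Suc i" | "k > Suc i" by linarith
        then show "x \<sqsubset> z \<or> z \<sqsubset> x"
        proof cases
          case 2 then have "x \<sqsubset> xs ! i" using lt k i by simp
          then show ?thesis using lt_trans[of x "xs ! i" z] inA k i z by auto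
        next
          case 4 then have "xs ! Suc i \<sqsubset> x" using lt k i by simp
          then show ?thesis using lt_trans[of z "xs ! Suc i" x] inA k i z by auto
        qed (use z k in auto)
      qed
      then have "z \<in> C" using mx z by blast
      then obtain k where k: "k < length xs" "z = xs ! k" using xs by (metis in_set_conv_nth)
      have "\<not> k \<le> i" using z k i lt[of k i] lt_asym inA
        by (metis le_neq_implies_less strict_of_def Suc_lessD)
      moreover have "\<not> k \<ge> Suc i" using z k i lt[of "Suc i" k] lt_asym inA
        by (metis le_neq_implies_less strict_of_def)
      ultimately show False by simp
    qed
    then show ?thesis unfolding upper_covers_def using inA i lt[of i "Suc i"] by auto
  qed
  ultimately have "saturated xs" unfolding saturated_def using ne xs CA by auto
  then show "C \<in> set ` {xs. saturated xs}" using xs by auto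
next
  fix C assume "C \<in> set ` {xs. saturated xs}"
  then obtain xs where xs: "C = set xs" "saturated xs" by auto
  have s: "sorted_wrt (\<sqsubset>) xs" using saturated_sorted xs by blast
  have CA: "C \<subseteq> A" using xs saturated_def by auto
  have "pred_on.chain A (\<sqsubset>) C"
    unfolding chain_iff using CA s xs
    by (auto simp: sorted_wrt_iff_nth_less in_set_conv_nth) (metis linorder_neqE_nat)
  moreover have "z \<in> C" if z: "z \<in> A" "\<forall>x\<in>C. x \<noteq> z \<longrightarrow> x \<sqsubset> z \<or> z \<sqsubset> x" for z
  proof (rule ccontr)
    assume nz: "z \<notin> C"
    define I where "I = {i. i < length xs \<and> le (xs ! i) z}"
    have "xs ! 0 = bot" "0 < length xs" using xs unfolding saturated_def by (auto simp: hd_conv_nth)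
    then have I0: "0 \<in> I" unfolding I_def using bot_le z by auto
    have fI: "finite I" unfolding I_def by auto
    define i where "i = Max I"
    have iI: "i \<in> I" using fI I0 i_def Max_in by blast
    then have i: "i < length xs" "le (xs ! i) z" unfolding I_def by auto
    have "xs ! (length xs - 1) = top" using xs unfolding saturated_def by (auto simp: last_conv_nth)
    moreover have "top \<in> C" using xs unfolding saturated_def by auto
    ultimately have "i \<noteq> length xs - 1" using i z nz le_top le_antisym top_in by metis
    then have si: "Suc i < length xs" using i by auto
    then have "Suc i \<notin> I" using fI i_def Max_ge by (metis not_less_eq_eq order_refl)
    then have "\<not> le (xs ! Suc i) z" using si I_def by auto
    then have "z \<sqsubset> xs ! Suc i" using z nz si xs(1) by (metis nth_mem strict_of_def)
    moreover have "xs ! i \<sqsubset> z" using i nz xs(1) by (metis nth_mem strict_of_def)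
    ultimately show False using xs(2) si z(1) unfolding saturated_def upper_covers_def by blast
  qed
  ultimately show "C \<in> max_chains A le" using max_chain_iff by blast
qed

end

section \<open>The lexicographic order and the exchange of one element\<close>

locale cover_orders = bounded_finite_poset +
  fixes prec :: "'a \<Rightarrow> 'a \<Rightarrow> 'a \<Rightarrow> bool"
  assumes prec_order: "x \<in> A \<Longrightarrow> strict_total_order_on (Up x) (prec x)"
begin

lemma prec_irrefl: "y \<in> Up x \<Longrightarrow> \<not> prec x y y"
  using prec_order[of x] Up_D(1) unfolding strict_total_order_on_def irreflp_on_def by blast

lemma prec_trans:
  "u \<in> Up x \<Longrightarrow> v \<in> Up x \<Longrightarrow> w \<in> Up x \<Longrightarrow> prec x u v \<Longrightarrow> prec x v w \<Longrightarrow> prec x u w"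
  using prec_order[of x] Up_D(1) unfolding strict_total_order_on_def transp_on_def by blast

lemma prec_total: "u \<in> Up x \<Longrightarrow> v \<in> Up x \<Longrightarrow> u \<noteq> v \<Longrightarrow> prec x u v \<or> prec x v u"
  using prec_order[of x] Up_D(1) unfolding strict_total_order_on_def totalp_on_def by blast

definition llex :: "'a list \<Rightarrow> 'a list \<Rightarrow> bool" where
  "llex p' p \<longleftrightarrow> (\<exists>j. Suc j < length p' \<and> Suc j < length p \<and>
     (\<forall>i\<le>j. p' ! i = p ! i) \<and> p' ! Suc j \<noteq> p ! Suc j \<and> prec (p ! j) (p' ! Suc j) (p ! Suc j))"

lemma chain_lex_eq_llex:
  "saturated p' \<Longrightarrow> saturated p \<Longrightarrow> chain_lex le prec (set p') (set p) \<longleftrightarrow> llex p' p"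
  by (simp add: chain_lex_def llex_def chain_seq_eq)

lemma saturated_first_difference:
  assumes "saturated p" "saturated q" "p \<noteq> q"
  obtains j where "Suc j < length p" "Suc j < length q" "\<forall>i\<le>j. p ! i = q ! i" "p ! Suc j \<noteq> q ! Suc j"
proof -
  \<comment> \<open>Only the last entry of a saturated list can be \<open>top\<close>, so neither
    list is a proper initial part of the other and the first difference occurs at a common
    index.\<close>
  have no_prefix: False if "saturated p" "saturated q" "length p < length q"
    "\<forall>i<length p. p ! i = q ! i" for p q
  proof -
    define k where "k = length p - 1"
    have k: "Suc k = length p" using that unfolding k_def saturated_def by (cases p) auto
    then have "q ! k = top" using that unfolding saturated_def by (metis last_conv_nth lessI k_def)
    moreover have "q ! Suc k \<in> Up (q ! k)"
    proof -
      have "Suc k < length q" using that k by simp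
      then show ?thesis using that(2) unfolding saturated_def by blast
    qed
    ultimately show False using Up_D le_top lt_asym by (metis strict_of_def)
  qed
  define m where "m = min (length p) (length q)"
  have ex: "\<exists>i. i < m \<and> p ! i \<noteq> q ! i"
  proof (rule ccontr)
    assume "\<nexists>i. i < m \<and> p ! i \<noteq> q ! i"
    then have *: "\<forall>i<m. p ! i = q ! i" by blast
    show False
      using no_prefix[of p q] no_prefix[of q p] * assms unfolding m_def
      by (metis linorder_neqE_nat min.strict_order_iff min.commute min.idem nth_equalityI)
  qed
  define k where "k = (LEAST i. i < m \<and> p ! i \<noteq> q ! i)"
  have k: "k < m" "p ! k \<noteq> q ! k" using LeastI_ex[OF ex] unfolding k_def by auto
  have kl: "p ! i = q ! i" if "i < k" for i
    using not_less_Least[of i "\<lambda>i. i < m \<and> p ! i \<noteq> q ! i"] that k unfolding k_def by auto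
  have "p ! 0 = q ! 0" using assms unfolding saturated_def by (metis hd_conv_nth)
  then obtain j where "k = Suc j" using k by (cases k) auto
  then show thesis using that[of j] k kl unfolding m_def by auto
qed

text \<open>At the first difference both entries cover the same element \<open>x\<close>, so every
  comparison takes place inside one \<open>Up x\<close>, where \<open>prec x\<close> is a strict
  total order.\<close>

lemma llex_strict_total_order: "strict_total_order_on {p. saturated p} llex"
proof -
  have cov: "p ! Suc j \<in> Up (p ! j)" if "saturated p" "Suc j < length p" for p j
    using that unfolding saturated_def by blast
  have "llex p r" if s: "saturated p" "saturated q" "saturated r" and l: "llex p q" "llex q r" for p q r
  proof -
    from l obtain j k where j: "Suc j < length p" "Suc j < length q"
       "\<forall>i\<le>j. p ! i = q ! i" "p ! Suc j \<noteq> q ! Suc j" "prec (q ! j) (p ! Suc j) (q ! Suc j)"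
      and k: "Suc k < length q" "Suc k < length r"
       "\<forall>i\<le>k. q ! i = r ! i" "q ! Suc k \<noteq> r ! Suc k" "prec (r ! k) (q ! Suc k) (r ! Suc k)"
      unfolding llex_def by blast
    consider "j < k" | "k < j" | "j = k" by linarith
    then show ?thesis
    proof cases
      case 1
      then have "Suc j \<le> k" by simp
      then show ?thesis unfolding llex_def using j k 1 by (intro exI[of _ j]) auto
    next
      case 2
      then have "Suc k \<le> j" by simp
      then show ?thesis unfolding llex_def using j k 2 by (intro exI[of _ k]) auto
    next
      case 3
      have e: "p ! j = q ! j" "q ! j = r ! j" using j k 3 by auto
      have U: "p ! Suc j \<in> Up (r ! j)" "q ! Suc j \<in> Up (r ! j)" "r ! Suc j \<in> Up (r ! j)"
        using cov[OF s(1) j(1)] cov[OF s(2) j(2)] cov[OF s(3) k(2)] 3 e by auto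
      have pr: "prec (r ! j) (p ! Suc j) (r ! Suc j)"
        using prec_trans[OF U] j k e 3 by auto
      moreover have "p ! Suc j \<noteq> r ! Suc j" using pr prec_irrefl U by metis
      ultimately show ?thesis unfolding llex_def using j k 3 by (intro exI[of _ j]) auto
    qed
  qed
  moreover have "llex p q \<or> llex q p" if s: "saturated p" "saturated q" and "p \<noteq> q" for p q
  proof -
    obtain j where j: "Suc j < length p" "Suc j < length q" "\<forall>i\<le>j. p ! i = q ! i"
      "p ! Suc j \<noteq> q ! Suc j" using saturated_first_difference[OF s \<open>p \<noteq> q\<close>] by metis
    have "p ! Suc j \<in> Up (p ! j)" "q ! Suc j \<in> Up (p ! j)" using cov s j by force+
    from prec_total[OF this j(4)] show ?thesis
    proof
      assume "prec (p ! j) (p ! Suc j) (q ! Suc j)"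
      then have "llex p q" unfolding llex_def using j by (intro exI[of _ j]) simp
      then show ?thesis ..
    next
      assume "prec (p ! j) (q ! Suc j) (p ! Suc j)"
      then have "llex q p" unfolding llex_def using j by (intro exI[of _ j]) simp
      then show ?thesis ..
    qed
  qed
  moreover have "\<not> llex p p" for p unfolding llex_def by blast
  ultimately show ?thesis
    unfolding strict_total_order_on_def irreflp_on_def transp_on_def totalp_on_def by blast
qed

lemma chain_lex_strict_total_order: "strict_total_order_on (max_chains A le) (chain_lex le prec)"
proof -
  have irr: "\<not> llex p p" if "saturated p" for p
    using llex_strict_total_order that
    unfolding strict_total_order_on_def irreflp_on_def by simp
  have tr: "llex p r" if "saturated p" "saturated q" "saturated r" "llex p q" "llex q r" for p q r
    using llex_strict_total_order that transp_onD[of "{p. saturated p}" llex p q r]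
    unfolding strict_total_order_on_def by simp
  have tot: "llex p q \<or> llex q p" if "saturated p" "saturated q" "p \<noteq> q" for p q
    using llex_strict_total_order that totalp_onD[of "{p. saturated p}" llex p q]
    unfolding strict_total_order_on_def by simp
  show ?thesis
    unfolding strict_total_order_on_def max_chains_eq_saturated
  proof (intro conjI irreflp_onI transp_onI totalp_onI)
    fix C assume "C \<in> set ` {p. saturated p}"
    then show "\<not> chain_lex le prec C C" using irr chain_lex_eq_llex by auto
  next
    fix C D E
    assume "C \<in> set ` {p. saturated p}" "D \<in> set ` {p. saturated p}" "E \<in> set ` {p. saturated p}"
      and lex: "chain_lex le prec C D" "chain_lex le prec D E"
    then obtain p q r where "C = set p" "D = set q" "E = set r"
      and s: "saturated p" "saturated q" "saturated r" by auto
    with lex show "chain_lex le prec C E" using tr[OF s] by (simp add: chain_lex_eq_llex)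
  next
    fix C D
    assume "C \<in> set ` {p. saturated p}" "D \<in> set ` {p. saturated p}" and ne: "C \<noteq> D"
    then obtain p q where "C = set p" "D = set q" and s: "saturated p" "saturated q" by auto
    with ne show "chain_lex le prec C D \<or> chain_lex le prec D C"
      using tot[OF s] by (auto simp: chain_lex_eq_llex)
  qed
qed

text \<open>The ranks around position \<open>i\<close> are consecutive. They keep \<open>r\<close>
  apart from all members of the chain and leave no room between \<open>r\<close> and
  \<open>p ! Suc (Suc i)\<close>.\<close>

lemma saturated_update:
  assumes p: "saturated p" and i: "Suc (Suc i) < length p"
    and r: "r \<in> Up (p ! i)" "le r (p ! Suc (Suc i))" "prec (p ! i) r (p ! Suc i)"
    and rk: "\<And>x y. y \<in> Up x \<Longrightarrow> rk y = Suc (rk x)"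
      "\<And>x y. x \<in> A \<Longrightarrow> y \<in> A \<Longrightarrow> x \<sqsubset> y \<Longrightarrow> (rk x :: nat) < rk y"
  defines "p' \<equiv> p[Suc i := r]"
  shows "saturated p'" "llex p' p" "set p - set p' = {p ! Suc i}" "set p' - set p = {r}"
proof -
  have cov: "p ! Suc j \<in> Up (p ! j)" if "Suc j < length p" for j
    using that p unfolding saturated_def by blast
  have s: "sorted_wrt (\<sqsubset>) p" using saturated_sorted p by blast
  have pA: "p ! j \<in> A" if "j < length p" for j using that p unfolding saturated_def by auto
  have rne: "r \<noteq> p ! Suc i" using r prec_irrefl by metis
  have rA: "r \<in> A" using r Up_D by blast
  have r_rk: "rk r = Suc (rk (p ! i))" using r rk by blast
  have lt: "p ! k \<sqsubset> p ! l" if "k < l" "l < length p" for k l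
    using s that by (simp add: sorted_wrt_iff_nth_less)
  have inj: "p ! k = p ! l \<longleftrightarrow> k = l" if "k < length p" "l < length p" for k l
    using lt[of k l] lt[of l k] that by (metis linorder_neqE_nat strict_of_def)
  have rk_p: "rk (p ! Suc i) = Suc (rk (p ! i))" "rk (p ! Suc (Suc i)) = Suc (Suc (rk (p ! i)))"
    using cov[of i] cov[of "Suc i"] i rk by auto
  have r_notin: "r \<notin> set p"
  proof
    assume "r \<in> set p"
    then obtain k where k: "k < length p" "r = p ! k" by (metis in_set_conv_nth)
    have "k \<noteq> Suc i" using rne k by auto
    then consider "k < Suc i" | "k > Suc i" by linarith
    then show False
    proof cases
      case 1 then have "rk (p ! k) < rk (p ! Suc i)" using lt i rk(2) pA k by auto
      then show False using rk_p r_rk k by simp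
    next
      case 2 then have "rk (p ! Suc i) < rk (p ! k)" using lt i rk(2) pA k by auto
      then show False using rk_p r_rk k by simp
    qed
  qed
  have "r \<sqsubset> p ! Suc (Suc i)" using r r_notin i by (auto simp: strict_of_def)
  moreover have "False" if "z \<in> A" "r \<sqsubset> z" "z \<sqsubset> p ! Suc (Suc i)" for z
    using that rk(2)[of r z] rk(2)[of z "p ! Suc (Suc i)"] rk_p r_rk pA i rA by auto
  ultimately have r_up: "p ! Suc (Suc i) \<in> Up r"
    unfolding upper_covers_def using rA pA i by blast
  have cov': "p' ! Suc j \<in> Up (p' ! j)" if "Suc j < length p" for j
  proof -
    consider "j = i" | "j = Suc i" | "j \<noteq> i" "j \<noteq> Suc i" by blast
    then show ?thesis
      by cases (use that r r_up cov[OF that] in \<open>simp_all add: p'_def\<close>)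
  qed
  show "saturated p'"
    unfolding saturated_def
  proof (intro conjI allI impI)
    show "p' \<noteq> []" using p saturated_def p'_def by auto
    show "set p' \<subseteq> A" using p rA set_update_subset_insert[of p "Suc i" r]
      unfolding saturated_def p'_def by auto
    show "hd p' = bot" using p i unfolding saturated_def p'_def by (cases p) auto
    have "last p' = p ! (length p - 1)"
      unfolding p'_def using p i
      by (subst last_conv_nth) (auto simp: nth_list_update saturated_def)
    then show "last p' = top" using p unfolding saturated_def by (metis last_conv_nth)
    show "p' ! Suc j \<in> Up (p' ! j)" if "Suc j < length p'" for j
      using cov' that p'_def by auto
  qed
  show "llex p' p" unfolding llex_def
    by (intro exI[of _ i]) (use i r rne in \<open>auto simp: p'_def nth_list_update\<close>)
  have dp: "distinct p" using inj by (simp add: distinct_conv_nth)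
  have set': "set p' = insert r (set p - {p ! Suc i})"
    unfolding p'_def using i dp set_update_distinct[of p "Suc i" r] by simp
  show "set p - set p' = {p ! Suc i}" using set' rne i r_notin by auto
  show "set p' - set p = {r}" using set' r_notin by auto
qed

text \<open>The hypothesis \<open>local\<close> is used along the later chain, between the point of
  divergence and the next common element, which serves as \<open>z\<close>. An exchange must occur
  before that element is reached: a cover of the last element before it that lies below it is equal
  to it by rank, hence does not precede it.\<close>

theorem is_shelling_chain_lex:
  fixes rk :: "'a \<Rightarrow> nat"
  assumes rk: "\<And>x y. y \<in> Up x \<Longrightarrow> rk y = Suc (rk x)"
      "\<And>x y. x \<in> A \<Longrightarrow> y \<in> A \<Longrightarrow> x \<sqsubset> y \<Longrightarrow> rk x < rk y"
    and local: "\<And>x p p2 q z. p \<in> Up x \<Longrightarrow> q \<in> Up x \<Longrightarrow> prec x q p \<Longrightarrow> z \<in> A \<Longrightarrow> le q z \<Longrightarrow>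
      p2 \<in> Up p \<Longrightarrow> le p2 z \<Longrightarrow> (\<And>y. y \<in> Up p \<Longrightarrow> le y z \<Longrightarrow> \<not> prec p y p2) \<Longrightarrow>
      \<exists>r\<in>Up x. le r p2 \<and> prec x r p"
  shows "is_shelling A le (chain_lex le prec)"
proof -
  have descent: "\<exists>i r. j \<le> i \<and> Suc i < k \<and> r \<in> Up (p ! i) \<and> le r (p ! Suc (Suc i)) \<and> prec (p ! i) r (p ! Suc i)"
    if "saturated p" "j < k" "k < length p" "q \<in> Up (p ! j)" "prec (p ! j) q (p ! Suc j)" "le q (p ! k)"
    for p j k q
    using that
  proof (induction "k - j" arbitrary: j q)
    case (Suc m)
    have cov: "p ! Suc l \<in> Up (p ! l)" if "Suc l < length p" for l
      using that Suc.prems unfolding saturated_def by blast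
    have pA: "p ! l \<in> A" if "l < length p" for l using that Suc.prems unfolding saturated_def by auto
    have lt: "p ! l \<sqsubset> p ! l'" if "l < l'" "l' < length p" for l l'
      using saturated_sorted[OF Suc.prems(1)] that by (simp add: sorted_wrt_iff_nth_less)
    have "k \<noteq> Suc j"
    proof
      assume k: "k = Suc j"
      have "q \<noteq> p ! Suc j" using prec_irrefl[OF Suc.prems(4)] Suc.prems(5) by auto
      then have "q \<sqsubset> p ! Suc j" using Suc.prems k by (simp add: strict_of_def)
      moreover have "rk q = rk (p ! Suc j)" 
        using rk(1)[OF Suc.prems(4)] rk(1)[OF cov[of j]] k Suc.prems(3) by simp
      moreover have "q \<in> A" using Suc.prems Up_D by blast
      ultimately show False using rk(2)[of q "p ! Suc j"] pA[of "Suc j"] Suc.prems k by simp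
    qed
    then have k: "Suc (Suc j) \<le> k" using Suc.prems by simp
    have lek: "le (p ! Suc (Suc j)) (p ! k)"
      using k lt[of "Suc (Suc j)" k] le_refl pA Suc.prems
      by (cases "k = Suc (Suc j)") (auto simp: strict_of_def)
    \<comment> \<open>If some cover \<open>y\<close> below \<open>p ! k\<close> precedes the next
      element of the chain, then \<open>y\<close> takes the role of \<open>q\<close> one step later;
      otherwise \<open>local\<close> gives the exchange here.\<close>
    show ?case
    proof (cases "\<exists>y \<in> Up (p ! Suc j). le y (p ! k) \<and> prec (p ! Suc j) y (p ! Suc (Suc j))")
      case True
      then obtain y where y: "y \<in> Up (p ! Suc j)" "le y (p ! k)" "prec (p ! Suc j) y (p ! Suc (Suc j))"
        by blast
      have "m = k - Suc j" "Suc j < k" using Suc.hyps(2) k by auto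
      from Suc.hyps(1)[OF this(1) Suc.prems(1) this(2) Suc.prems(3) y(1,3,2)]
      obtain i r where "Suc j \<le> i" "Suc i < k" "r \<in> Up (p ! i)" "le r (p ! Suc (Suc i))"
          "prec (p ! i) r (p ! Suc i)"
        by blast
      then show ?thesis using Suc_leD by blast
    next
      case False
      have "p ! Suc j \<in> Up (p ! j)" "p ! Suc (Suc j) \<in> Up (p ! Suc j)" "p ! k \<in> A"
        using cov k pA Suc.prems by auto
      then have "\<exists>r\<in>Up (p ! j). le r (p ! Suc (Suc j)) \<and> prec (p ! j) r (p ! Suc j)"
        using local[OF _ Suc.prems(4,5) _ Suc.prems(6) _ lek] False by blast
      then show ?thesis using k by (intro exI[of _ j]) auto
    qed
  qed simp
  have shell: "\<exists>P''\<in>max_chains A le. chain_lex le prec P'' (set p) \<and> card (set p - P'') = 1 \<and>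
      card (P'' - set p) = 1 \<and> set p' \<inter> set p \<subseteq> P''"
    if p': "saturated p'" and p: "saturated p" and l: "llex p' p" for p' p
  proof -
    have cov: "p ! Suc l \<in> Up (p ! l)" if "Suc l < length p" for l
      using that p unfolding saturated_def by blast
    have pA: "p ! l \<in> A" if "l < length p" for l using that p unfolding saturated_def by auto
    have pA': "p' ! l \<in> A" if "l < length p'" for l using that p' unfolding saturated_def by auto
    have lt: "p ! l \<sqsubset> p ! l'" if "l < l'" "l' < length p" for l l'
      using saturated_sorted[OF p] that by (simp add: sorted_wrt_iff_nth_less)
    have lt': "p' ! l \<sqsubset> p' ! l'" if "l < l'" "l' < length p'" for l l'
      using saturated_sorted[OF p'] that by (simp add: sorted_wrt_iff_nth_less)
    obtain j where j: "Suc j < length p'" "Suc j < length p" "\<forall>i\<le>j. p' ! i = p ! i"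
      "p' ! Suc j \<noteq> p ! Suc j" "prec (p ! j) (p' ! Suc j) (p ! Suc j)"
      using l unfolding llex_def by blast
    \<comment> \<open>At \<open>k\<close> the chains meet again. The exchanged element will lie
      strictly between \<open>j\<close> and \<open>k\<close>, hence outside \<open>p'\<close>, so no
      common element is lost.\<close>
    define k where "k = (LEAST k. j < k \<and> k < length p \<and> p ! k \<in> set p')"
    have "p \<noteq> []" "last p = top" "p' \<noteq> []" "last p' = top" using p p' unfolding saturated_def by auto
    then have "p ! (length p - 1) = top" "top \<in> set p'"
      using last_conv_nth[of p] last_in_set[of p'] by auto
    then have ex: "\<exists>k. j < k \<and> k < length p \<and> p ! k \<in> set p'"
      using j by (intro exI[of _ "length p - 1"]) auto
    have k: "j < k" "k < length p" "p ! k \<in> set p'"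
      using LeastI_ex[OF ex] unfolding k_def by blast+
    have kmin: "p ! i \<notin> set p'" if "j < i" "i < k" for i
      using not_less_Least[of i "\<lambda>k. j < k \<and> k < length p \<and> p ! k \<in> set p'"] that k
      unfolding k_def by auto
    obtain m where m: "m < length p'" "p' ! m = p ! k" using k by (metis in_set_conv_nth)
    have "j < m"
    proof (rule ccontr)
      assume "\<not> j < m"
      then have "p ! m = p ! k" "m < k" using j m k by auto
      then show False using lt[of m k] k by (simp add: strict_of_def)
    qed
    then have "le (p' ! Suc j) (p ! k)"
      using m lt'[of "Suc j" m] le_refl[OF pA'[OF j(1)]]
      by (cases "m = Suc j") (auto simp: strict_of_def)
    moreover have "p' ! Suc j \<in> Up (p ! j)" 
    proof -
      have "p' ! Suc j \<in> Up (p' ! j)" using p' j(1) unfolding saturated_def by blast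
      then show ?thesis using j(3) by simp
    qed
    ultimately obtain i r where i: "j \<le> i" "Suc i < k" "r \<in> Up (p ! i)" "le r (p ! Suc (Suc i))"
      "prec (p ! i) r (p ! Suc i)"
      using descent[OF p k(1,2) _ j(5)] by blast
    define p'' where "p'' = p[Suc i := r]"
    have U: "saturated p''" "llex p'' p" "set p - set p'' = {p ! Suc i}" "set p'' - set p = {r}"
      unfolding p''_def
      by (rule saturated_update[where rk = rk, OF p _ i(3-5) rk]; use i k in simp)+
    have "p ! Suc i \<notin> set p'" using kmin i by auto
    moreover have "x \<in> set p''" if "x \<in> set p" "x \<noteq> p ! Suc i" for x using U(3) that by blast
    ultimately have "set p' \<inter> set p \<subseteq> set p''" by auto
    moreover have "set p'' \<in> max_chains A le" using U(1) max_chains_eq_saturated by auto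
    moreover have "chain_lex le prec (set p'') (set p)" using U(2) chain_lex_eq_llex[OF U(1) p] by blast
    ultimately show ?thesis using U(3,4) by (intro bexI[of _ "set p''"]) simp_all
  qed
  show ?thesis
    unfolding is_shelling_def
  proof (intro conjI)
    show "bounded_poset_on A le"
      unfolding bounded_poset_on_def using poset bot_in bot_le top_in le_top by blast
    show "ranked_on A le" unfolding ranked_on_def using rk by blast
    show "strict_total_order_on (max_chains A le) (chain_lex le prec)"
      by (rule chain_lex_strict_total_order)
    show "\<forall>P'\<in>max_chains A le. \<forall>P\<in>max_chains A le. chain_lex le prec P' P \<longrightarrow>
       (\<exists>P''\<in>max_chains A le. chain_lex le prec P'' P \<and> card (P - P'') = 1 \<and>
          card (P'' - P) = 1 \<and> P' \<inter> P \<subseteq> P'')"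
    proof (intro ballI impI)
      fix P' P assume "P' \<in> max_chains A le" "P \<in> max_chains A le" and lex: "chain_lex le prec P' P"
      then obtain p' p where "P' = set p'" "P = set p" and s: "saturated p'" "saturated p"
        unfolding max_chains_eq_saturated by auto
      with lex show "\<exists>P''\<in>max_chains A le. chain_lex le prec P'' P \<and> card (P - P'') = 1 \<and>
          card (P'' - P) = 1 \<and> P' \<inter> P \<subseteq> P''"
        using shell[OF s] chain_lex_eq_llex[OF s] by simp
    qed
  qed
qed

end

section \<open>Noncrossing partitions as relations\<close>

text \<open>As relations, refinement is implication, common refinement is conjunction, and splitting
  or merging blocks has an explicit formula.\<close>

definition same_block :: "'a set set \<Rightarrow> 'a \<Rightarrow> 'a \<Rightarrow> bool" where
  "same_block P a b \<longleftrightarrow> (\<exists>B\<in>P. a \<in> B \<and> b \<in> B)"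

lemma same_block_refl: "partition_on A P \<Longrightarrow> same_block P a a \<longleftrightarrow> a \<in> A"
  unfolding same_block_def partition_on_def by auto

lemma same_block_sym: "same_block P a b \<Longrightarrow> same_block P b a"
  unfolding same_block_def by blast

lemma partition_block_unique:
  "partition_on A P \<Longrightarrow> B \<in> P \<Longrightarrow> C \<in> P \<Longrightarrow> a \<in> B \<Longrightarrow> a \<in> C \<Longrightarrow> B = C"
  unfolding partition_on_def disjoint_def by blast

lemma partition_block_exists: "partition_on A P \<Longrightarrow> a \<in> A \<Longrightarrow> \<exists>B\<in>P. a \<in> B"
  unfolding partition_on_def by blast

lemma same_block_trans:
  "partition_on A P \<Longrightarrow> same_block P a b \<Longrightarrow> same_block P b c \<Longrightarrow> same_block P a c"
  unfolding same_block_def using partition_block_unique by metis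

lemma block_eq_Collect:
  assumes "partition_on A P" "B \<in> P" "a \<in> B"
  shows "B = {b. same_block P a b}"
  using assms partition_block_unique[OF assms(1)] unfolding same_block_def by blast

lemma refines_iff_same_block:
  assumes P: "partition_on A P" and Q: "partition_on A Q"
  shows "refines A P Q \<longleftrightarrow> (\<forall>a b. same_block P a b \<longrightarrow> same_block Q a b)"
proof
  assume "refines A P Q"
  then show "\<forall>a b. same_block P a b \<longrightarrow> same_block Q a b"
    unfolding refines_def same_block_def by blast
next
  assume R: "\<forall>a b. same_block P a b \<longrightarrow> same_block Q a b"
  have "\<exists>Y\<in>Q. X \<subseteq> Y" if X: "X \<in> P" for X
  proof -
    obtain a where a: "a \<in> X" using P X unfolding partition_on_def by (metis all_not_in_conv)
    then have "same_block Q a a" using R X unfolding same_block_def by blast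
    then obtain Y where Y: "Y \<in> Q" "a \<in> Y" unfolding same_block_def by blast
    have "X \<subseteq> Y"
      using block_eq_Collect[OF P X a] block_eq_Collect[OF Q Y] R by blast
    then show ?thesis using Y by blast
  qed
  then show "refines A P Q" unfolding refines_def using P Q by blast
qed

lemma partition_eqI:
  assumes "partition_on A P" "partition_on A Q" "same_block P = same_block Q"
  shows "P = Q"
  using assms refines_asym refines_iff_same_block by metis

text \<open>Sending each block of \<open>P\<close> to the block containing it is onto
  \<open>Q\<close>. With equal cardinalities it would be injective, and the two relations would
  coincide.\<close>

lemma refines_card:
  assumes r: "refines A P Q" and A: "finite A" and ne: "P \<noteq> Q"
  shows "card Q < card P"
proof -
  have P: "partition_on A P" and Q: "partition_on A Q" using r unfolding refines_def by auto
  obtain f where f: "\<And>X. X \<in> P \<Longrightarrow> f X \<in> Q \<and> X \<subseteq> f X"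
    using r unfolding refines_def by metis
  have fP: "finite P" using finite_elements A P by blast
  have fI: "Q = f ` P"
  proof (intro equalityI subsetI)
    fix Y assume Y: "Y \<in> Q"
    then obtain a where a: "a \<in> Y" using Q unfolding partition_on_def by (metis all_not_in_conv)
    then have "a \<in> A" using Q Y unfolding partition_on_def by auto
    then obtain X where X: "X \<in> P" "a \<in> X" using P unfolding partition_on_def by auto
    then have "f X = Y" using f partition_block_unique[OF Q] Y a by blast
    then show "Y \<in> f ` P" using X by auto
  qed (use f in auto)
  have "card Q \<noteq> card P"
  proof
    assume "card Q = card P"
    then have inj: "inj_on f P" using fI fP by (metis eq_card_imp_inj_on)
    have "same_block P a b" if "same_block Q a b" for a b
    proof -
      obtain Y where Y: "Y \<in> Q" "a \<in> Y" "b \<in> Y" using \<open>same_block Q a b\<close> unfolding same_block_def by blast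
      then have "a \<in> A" "b \<in> A" using Q unfolding partition_on_def by auto
      then obtain X X' where X: "X \<in> P" "a \<in> X" "X' \<in> P" "b \<in> X'"
        using P unfolding partition_on_def by auto
      then have "f X = Y" "f X' = Y" using f partition_block_unique[OF Q] Y by blast+
      then have "X = X'" using inj X by (auto dest: inj_onD)
      then show ?thesis using X unfolding same_block_def by blast
    qed
    then have "refines A Q P" using refines_iff_same_block[OF Q P] by blast
    then show False using refines_asym r ne by blast
  qed
  then show ?thesis using card_image_le[OF fP, of f] fI by auto
qed

text \<open>The first clause encodes the ground set as the points related to themselves. The last
  clause admits interlaced pairs, but only inside one block.\<close>

definition nc_rel :: "nat \<Rightarrow> (nat \<Rightarrow> nat \<Rightarrow> bool) \<Rightarrow> bool" where
  "nc_rel n R \<longleftrightarrow> (\<forall>a. R a a \<longleftrightarrow> a \<in> {1..n}) \<and> (\<forall>a b. R a b \<longrightarrow> R b a) \<and>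
     (\<forall>a b c. R a b \<longrightarrow> R b c \<longrightarrow> R a c) \<and>
     (\<forall>i j k l. i < j \<longrightarrow> j < k \<longrightarrow> k < l \<longrightarrow> R i k \<longrightarrow> R j l \<longrightarrow> R i j)"

lemma
  assumes "nc_rel n R"
  shows nc_rel_refl: "R a a \<longleftrightarrow> a \<in> {1..n}"
    and nc_rel_sym: "R a b \<Longrightarrow> R b a"
    and nc_rel_trans: "R a b \<Longrightarrow> R b c \<Longrightarrow> R a c"
    and nc_rel_nc: "i < j \<Longrightarrow> j < k \<Longrightarrow> k < l \<Longrightarrow> R i k \<Longrightarrow> R j l \<Longrightarrow> R i j"
  using assms unfolding nc_rel_def by (simp, metis, metis, metis)

lemma nc_rel_range:
  assumes "nc_rel n R" "R a b"
  shows "a \<in> {1..n}" "b \<in> {1..n}"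
  using nc_rel_refl[OF assms(1)] nc_rel_sym[OF assms(1)] nc_rel_trans[OF assms(1)] assms(2) by metis+

lemma NC_partition: "\<pi> \<in> NC n \<Longrightarrow> partition_on {1..n} \<pi>"
  unfolding NC_def by blast

lemma NC_nc_rel:
  assumes "\<pi> \<in> NC n" shows "nc_rel n (same_block \<pi>)"
proof -
  have P: "partition_on {1..n} \<pi>" and nc: "noncrossing \<pi>" using assms unfolding NC_def by auto
  have "same_block \<pi> i j" if "i < j" "j < k" "k < l" "same_block \<pi> i k" "same_block \<pi> j l" for i j k l
  proof -
    obtain B where B: "B \<in> \<pi>" "i \<in> B" "k \<in> B" using \<open>same_block \<pi> i k\<close> unfolding same_block_def by blast
    obtain C where C: "C \<in> \<pi>" "j \<in> C" "l \<in> C" using \<open>same_block \<pi> j l\<close> unfolding same_block_def by blast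
    have "B = C" using nc B C that(1-3) unfolding noncrossing_def by metis
    then show ?thesis using B C unfolding same_block_def by blast
  qed
  then show ?thesis unfolding nc_rel_def
    using same_block_refl[OF P] same_block_sym[of \<pi>] same_block_trans[OF P]
    by (intro conjI allI impI) blast+
qed

lemma NC_of_nc_rel:
  assumes R: "nc_rel n R" obtains \<pi> where "\<pi> \<in> NC n" "same_block \<pi> = R"
proof -
  define \<pi> where "\<pi> = (\<lambda>a. {b. R a b}) ` {1..n}"
  note refl = nc_rel_refl[OF R] and sym = nc_rel_sym[OF R] and trans = nc_rel_trans[OF R]
    and range = nc_rel_range[OF R]
  have cls: "{b. R a b} = {b. R c b}" if "R a c" for a c
    using sym trans that by blast
  have P: "partition_on {1..n} \<pi>"
  proof (rule partition_onI)
    show "\<Union>\<pi> = {1..n}" unfolding \<pi>_def using refl range by auto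
    show "{} \<notin> \<pi>" unfolding \<pi>_def using refl by blast
    fix p q assume "p \<in> \<pi>" "q \<in> \<pi>" "p \<noteq> q"
    then obtain a c where "p = {b. R a b}" "q = {b. R c b}" unfolding \<pi>_def by auto
    then show "disjnt p q" using \<open>p \<noteq> q\<close> cls sym trans unfolding disjnt_iff by (metis mem_Collect_eq)
  qed
  have sb: "same_block \<pi> = R"
  proof (intro ext iffI)
    fix a b assume "same_block \<pi> a b"
    then show "R a b" unfolding same_block_def \<pi>_def using sym trans by blast
  next
    fix a b assume "R a b"
    then show "same_block \<pi> a b" unfolding same_block_def \<pi>_def using refl range(1) by blast
  qed
  have "noncrossing \<pi>"
    unfolding noncrossing_def
  proof safe
    fix B C i j k l
    assume "B \<in> \<pi>" "C \<in> \<pi>" and o: "i < j" "j < k" "k < l" and m: "i \<in> B" "k \<in> B" "j \<in> C" "l \<in> C"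
    then have "R i k" "R j l" using sb unfolding same_block_def by blast+
    then have "same_block \<pi> i j" using nc_rel_nc[OF R] o sb by blast
    then have "B = C"
      using block_eq_Collect[OF P \<open>B \<in> \<pi>\<close> \<open>i \<in> B\<close>] block_eq_Collect[OF P \<open>C \<in> \<pi>\<close> \<open>j \<in> C\<close>] sb cls by simp
    {
      fix x
      show "x \<in> C" if "x \<in> B" using \<open>B = C\<close> that by simp
      show "x \<in> B" if "x \<in> C" using \<open>B = C\<close> that by simp
    }
  qed
  then have "\<pi> \<in> NC n" using P unfolding NC_def by blast
  then show thesis using that sb by blast
qed

section \<open>Splitting a block along an interval\<close>

definition split_rel :: "(nat \<Rightarrow> nat \<Rightarrow> bool) \<Rightarrow> nat \<Rightarrow> nat \<Rightarrow> nat \<Rightarrow> nat \<Rightarrow> bool" where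
  "split_rel R i j a b \<longleftrightarrow> R a b \<and> (R a i \<longrightarrow> ((i \<le> a \<and> a < j) \<longleftrightarrow> (i \<le> b \<and> b < j)))"

text \<open>Interlaced pairs of \<open>R'\<close> are interlaced for \<open>R\<close> as well, so
  their four points lie in one block of \<open>R\<close>; only there must \<open>E\<close> be
  checked.\<close>

lemma nc_rel_refine:
  assumes R: "nc_rel n R" and R': "\<And>a b. R' a b \<longleftrightarrow> R a b \<and> E a b"
    and E: "\<And>a. a \<in> {1..n} \<Longrightarrow> E a a" "\<And>a b. R a b \<Longrightarrow> E a b \<Longrightarrow> E b a"
      "\<And>a b c. R a b \<Longrightarrow> R b c \<Longrightarrow> E a b \<Longrightarrow> E b c \<Longrightarrow> E a c"
      "\<And>i j k l. i < j \<Longrightarrow> j < k \<Longrightarrow> k < l \<Longrightarrow> R i j \<Longrightarrow> R j k \<Longrightarrow> R k l \<Longrightarrow> E i k \<Longrightarrow> E j l \<Longrightarrow> E i j"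
  shows "nc_rel n R'"
  unfolding nc_rel_def
proof (intro conjI allI impI)
  note refl = nc_rel_refl[OF R] and sym = nc_rel_sym[OF R] and trans = nc_rel_trans[OF R]
  show "R' a a \<longleftrightarrow> a \<in> {1..n}" for a using R'[of a a] refl[of a] E(1)[of a] by blast
  show "R' a b \<Longrightarrow> R' b a" for a b using R'[of a b] R'[of b a] sym[of a b] E(2)[of a b] by blast
  show "R' a b \<Longrightarrow> R' b c \<Longrightarrow> R' a c" for a b c
    using R'[of a b] R'[of b c] R'[of a c] trans[of a b c] E(3)[of a b c] by blast
  show "R' i j" if "i < j" "j < k" "k < l" "R' i k" "R' j l" for i j k l
  proof -
    have "R i k" "E i k" "R j l" "E j l" using that R' by auto
    moreover from this have "R i j" using nc_rel_nc[OF R] that(1-3) by metis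
    moreover have "R j k" "R k l" using calculation sym trans by metis+
    ultimately show ?thesis using R'[of i j] E(4)[OF that(1-3)] by metis
  qed
qed

lemma nc_rel_split:
  assumes R: "nc_rel n R" shows "nc_rel n (split_rel R i j)"
proof (rule nc_rel_refine[OF R,
      where E = "\<lambda>a b. R a i \<longrightarrow> (i \<le> a \<and> a < j) = (i \<le> b \<and> b < j)"])
  note sym = nc_rel_sym[OF R] and trans = nc_rel_trans[OF R]
  show "\<And>a b. R a b \<Longrightarrow> R a i \<longrightarrow> (i \<le> a \<and> a < j) = (i \<le> b \<and> b < j) \<Longrightarrow>
        R b i \<longrightarrow> (i \<le> b \<and> b < j) = (i \<le> a \<and> a < j)" using trans by metis
  show "\<And>a b c. R a b \<Longrightarrow> R b c \<Longrightarrow> R a i \<longrightarrow> (i \<le> a \<and> a < j) = (i \<le> b \<and> b < j) \<Longrightarrow>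
       R b i \<longrightarrow> (i \<le> b \<and> b < j) = (i \<le> c \<and> c < j) \<Longrightarrow>
       R a i \<longrightarrow> (i \<le> a \<and> a < j) = (i \<le> c \<and> c < j)" using sym trans by metis
  fix p q k l assume o: "p < q" "q < k" "k < l" and r: "R p q" "R q k" "R k l" and
    e: "R p i \<longrightarrow> (i \<le> p \<and> p < j) = (i \<le> k \<and> k < j)" "R q i \<longrightarrow> (i \<le> q \<and> q < j) = (i \<le> l \<and> l < j)"
  show "R p i \<longrightarrow> (i \<le> p \<and> p < j) = (i \<le> q \<and> q < j)"
  proof
    assume "R p i"
    moreover have "R q i" using \<open>R p i\<close> r sym trans by metis
    ultimately show "(i \<le> p \<and> p < j) = (i \<le> q \<and> q < j)" using o e by linarith
  qed
qed (simp_all add: split_rel_def)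

lemma split_rel_left: "nc_rel n R \<Longrightarrow> R i j \<Longrightarrow> i < j \<Longrightarrow> \<not> split_rel R i j i j"
  unfolding split_rel_def using nc_rel_refl nc_rel_range by auto

text \<open>Let \<open>m\<close> be the minimum of a block of \<open>R\<close> that
  \<open>R'\<close> breaks up and \<open>f\<close> the first element of it cut off from
  \<open>m\<close>. If the block of \<open>m\<close> in \<open>R'\<close> continues beyond
  \<open>f\<close>, with next element \<open>g\<close>, its chord from \<open>m\<close> to
  \<open>g\<close> prevents blocks of \<open>R'\<close> from leaving \<open>[f, g)\<close>, and the
  split is \<open>(f, g)\<close>. Otherwise that block is the part in \<open>[m, f)\<close>, and the
  split is \<open>(m, f)\<close>.\<close>

lemma split_rel_exists:
  assumes R: "nc_rel n R" and R': "nc_rel n R'" and sub: "\<And>a b. R' a b \<Longrightarrow> R a b" and ne: "R' \<noteq> R"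
  obtains i j where "i < j" "R i j" "\<And>a b. R' a b \<Longrightarrow> split_rel R i j a b"
proof -
  note sym = nc_rel_sym[OF R] and trans = nc_rel_trans[OF R]
  note sym' = nc_rel_sym[OF R'] and trans' = nc_rel_trans[OF R']
  obtain a b where ab: "R a b" "\<not> R' a b" using ne sub by blast
  define m where "m = (LEAST c. R a c)"
  have m: "R a m" and mle: "\<And>c. R a c \<Longrightarrow> m \<le> c"
    using LeastI[of "R a" b] ab Least_le[of "R a"] unfolding m_def by auto
  have mle': "m \<le> c" if "R m c" for c using mle trans m that by blast
  have "\<exists>c. R m c \<and> \<not> R' m c"
    using ab m sym trans sym' trans' by metis
  define f where "f = (LEAST c. R m c \<and> \<not> R' m c)"
  have f: "R m f" "\<not> R' m f" using LeastI_ex[OF \<open>\<exists>c. R m c \<and> \<not> R' m c\<close>] unfolding f_def by auto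
  have fle: "R' m c" if "R m c" "c < f" for c
    using not_less_Least[of c "\<lambda>c. R m c \<and> \<not> R' m c"] that unfolding f_def by auto
  have "R' m m" using m nc_rel_range[OF R] nc_rel_refl[OF R'] by blast
  then have mf: "m < f" using f mle' by (metis le_neq_implies_less)
  show thesis
  proof (cases "\<exists>g>f. R' m g")
    case True
    define g where "g = (LEAST g. f < g \<and> R' m g)"
    have g: "f < g" "R' m g" using LeastI_ex[OF True] unfolding g_def by auto
    have gle: "\<not> R' m c" if "f \<le> c" "c < g" for c
      using not_less_Least[of c "\<lambda>c. f < c \<and> R' m c"] that f unfolding g_def
      by (cases "c = f") auto
    have key: "f \<le> d \<and> d < g" if c: "R' c d" "R c f" "f \<le> c" "c < g" for c d
    proof -
      have mc: "\<not> R' m c" using gle c by blast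
      have "R m d" using c sub sym trans f by metis
      have "\<not> d < f" using fle[OF \<open>R m d\<close>] mc c(1) sym' trans' by metis
      moreover have "\<not> d \<ge> g"
      proof
        assume "g \<le> d"
        moreover have "d \<noteq> g" using g(2) mc c(1) sym' trans' by metis
        ultimately show False using nc_rel_nc[OF R', of m c g d] mf c g mc by simp
      qed
      ultimately show ?thesis by simp
    qed
    show thesis
    proof (rule that[of f g])
      show "f < g" by fact
      show "R f g" using g(2) f(1) sub sym trans by metis
      fix c d assume "R' c d"
      moreover from this have "R c d" "R' d c" "R c f \<longleftrightarrow> R d f" using sub sym' sym trans by metis+
      ultimately show "split_rel R f g c d" unfolding split_rel_def
        using key[of c d] key[of d c] by blast
    qed
  next
    case False
    then have F: "\<not> R' m c" if "f \<le> c" for c using f that by (cases "c = f") auto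
    have key: "c < f \<longleftrightarrow> d < f" if c: "R' c d" "R c m" for c d
    proof -
      have "R m c" "R m d" using c sub sym trans by metis+
      moreover have "R' m c \<longleftrightarrow> R' m d" using c(1) sym' trans' by metis
      ultimately show ?thesis using fle[of c] fle[of d] F[of c] F[of d] by linarith
    qed
    show thesis
    proof (rule that[OF mf f(1)])
      fix c d assume cd: "R' c d"
      have "m \<le> c \<and> m \<le> d" if "R c m" using that mle' sub[OF cd] sym trans by metis
      then show "split_rel R m f c d" unfolding split_rel_def
        using key[OF cd] sub[OF cd] by auto
    qed
  qed
qed

lemma split_partition:
  assumes P: "partition_on A \<pi>" and Q: "partition_on A \<pi>'"
    and s: "same_block \<pi>' = split_rel (same_block \<pi>) i j"
    and B: "B \<in> \<pi>" "i \<in> B" "j \<in> B" and ij: "i < j"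
  shows "\<pi>' = insert (B \<inter> {i..<j}) (insert (B - {i..<j}) (\<pi> - {B}))"
    (is "_ = ?Q")
proof (rule partition_eqI[OF Q])
  have dis: "X \<inter> B = {}" if "X \<in> \<pi> - {B}" for X
    using that B partition_block_unique[OF P] by blast
  have ne: "B \<inter> {i..<j} \<noteq> {}" "B - {i..<j} \<noteq> {}" using B ij by auto
  show PQ: "partition_on A ?Q"
  proof (rule partition_onI)
    show "\<Union>?Q = A" using P B unfolding partition_on_def by auto
    show "{} \<notin> ?Q" using ne P unfolding partition_on_def by auto
    fix p q assume "p \<in> ?Q" "q \<in> ?Q" "p \<noteq> q"
    then show "disjnt p q" unfolding disjnt_def using dis partition_block_unique[OF P] by blast
  qed
  show "same_block \<pi>' = same_block ?Q"
    unfolding s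
  proof (intro ext iffI)
    fix a b assume "split_rel (same_block \<pi>) i j a b"
    then have ab: "same_block \<pi> a b"
      "same_block \<pi> a i \<longrightarrow> ((i \<le> a \<and> a < j) \<longleftrightarrow> (i \<le> b \<and> b < j))"
      unfolding split_rel_def by auto
    then obtain X where X: "X \<in> \<pi>" "a \<in> X" "b \<in> X" unfolding same_block_def by blast
    show "same_block ?Q a b"
    proof (cases "X = B")
      case True
      then have "(i \<le> a \<and> a < j) \<longleftrightarrow> (i \<le> b \<and> b < j)" using ab X B unfolding same_block_def by blast
      then show ?thesis unfolding same_block_def using X True by auto
    qed (use X in \<open>auto simp: same_block_def\<close>)
  next
    fix a b assume "same_block ?Q a b"
    then obtain X where X: "X \<in> ?Q" "a \<in> X" "b \<in> X" unfolding same_block_def by blast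
    have i: "same_block \<pi> a i \<longleftrightarrow> a \<in> B"
      using block_eq_Collect[OF P B(1,2)] same_block_sym[of \<pi>] by auto
    show "split_rel (same_block \<pi>) i j a b"
      unfolding split_rel_def i using X dis B unfolding same_block_def by auto
  qed
qed

lemma split_card:
  assumes P: "partition_on A \<pi>" and Q: "partition_on A \<pi>'" and A: "finite A"
    and s: "same_block \<pi>' = split_rel (same_block \<pi>) i j"
    and B: "same_block \<pi> i j" and ij: "i < j"
  shows "card \<pi>' = Suc (card \<pi>)"
proof -
  obtain B where B: "B \<in> \<pi>" "i \<in> B" "j \<in> B" using assms unfolding same_block_def by blast
  have eq: "\<pi>' = insert (B \<inter> {i..<j}) (insert (B - {i..<j}) (\<pi> - {B}))"
    using split_partition assms B by blast
  have fin: "finite \<pi>" using finite_elements A P by blast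
  have notin: "X \<notin> \<pi> - {B}" if "X \<subseteq> B" "X \<noteq> {}" for X
    using that B partition_block_unique[OF P] by blast
  have "B \<inter> {i..<j} \<noteq> {}" "B - {i..<j} \<noteq> {}" using B ij by auto
  then have "B \<inter> {i..<j} \<notin> \<pi> - {B}" "B - {i..<j} \<notin> \<pi> - {B}" "B \<inter> {i..<j} \<noteq> B - {i..<j}"
    using notin[of "B \<inter> {i..<j}"] notin[of "B - {i..<j}"] by blast+
  then show ?thesis unfolding eq using fin B card_Suc_Diff1[OF fin B(1)] by simp
qed

section \<open>Noncrossing 2-partitions as sorted permutations\<close>

text \<open>At the least point of disagreement, the smaller of the two values would have to be
  attained by the other function at an earlier point, where both agree.\<close>

lemma strict_mono_on_image_unique:
  fixes f g :: "nat \<Rightarrow> nat"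
  assumes f: "strict_mono_on B f" and g: "strict_mono_on B g" and im: "f ` B = g ` B" and a: "a \<in> B"
  shows "f a = g a"
  using a
proof (induction a rule: less_induct)
  case (less a)
  have "\<not> h a < k a" if h: "strict_mono_on B h" and k: "strict_mono_on B k" and "h ` B = k ` B"
      and IH: "\<And>c. c \<in> B \<Longrightarrow> c < a \<Longrightarrow> h c = k c" for h k :: "nat \<Rightarrow> nat"
  proof
    assume lt: "h a < k a"
    obtain c where c: "c \<in> B" "h a = k c" using less.prems \<open>h ` B = k ` B\<close> by (metis imageE imageI)
    have "c < a"
      using k c lt less.prems unfolding strict_mono_on_def by (metis linorder_neqE_nat less_asym)
    then have "h c = h a" using IH c by simp
    moreover have "h c < h a" using h \<open>c < a\<close> c less.prems unfolding strict_mono_on_def by blast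
    ultimately show False by simp
  qed
  from this[OF f g im] this[OF g f im[symmetric]] show ?case
    using less.IH by (metis linorder_neqE_nat)
qed

lemma strict_mono_bij_exists:
  fixes B C :: "nat set"
  assumes "finite B" "finite C" "card B = card C"
  obtains f where "f ` B = C" "strict_mono_on B f"
proof -
  obtain g where g: "bij_betw g {..<card B} B" "strict_mono_on {..<card B} g"
    using ex_bij_betw_strict_mono_card assms by blast
  obtain h where h: "bij_betw h {..<card B} C" "strict_mono_on {..<card B} h"
    using ex_bij_betw_strict_mono_card[of C] assms by metis
  define g' where "g' = the_inv_into {..<card B} g"
  have g': "g' ` B = {..<card B}" and gg: "\<And>a. a \<in> B \<Longrightarrow> g (g' a) = a"
    using g bij_betw_the_inv_into[OF g(1)] f_the_inv_into_f_bij_betw[OF g(1)]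
    unfolding g'_def bij_betw_def by auto
  have in': "g' a \<in> {..<card B}" if "a \<in> B" for a using g' that by blast
  have "strict_mono_on B g'"
    unfolding strict_mono_on_def
  proof (intro allI impI)
    fix a b assume ab: "a \<in> B \<and> b \<in> B \<and> a < b"
    have "\<not> g' b \<le> g' a"
    proof
      assume "g' b \<le> g' a"
      then have "g (g' b) \<le> g (g' a)"
        using g(2) in' ab unfolding strict_mono_on_def by (metis le_less)
      then show False using gg ab by auto
    qed
    then show "g' a < g' b" by simp
  qed
  then have "strict_mono_on B (h \<circ> g')"
    using h(2) in' unfolding strict_mono_on_def by auto
  moreover have "(h \<circ> g') ` B = C" using g' h(1) unfolding bij_betw_def by (metis image_comp)
  ultimately show thesis using that by blast
qed

lemma nc2_perm_unique:
  fixes s t :: "nat \<Rightarrow> nat"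
  assumes P: "partition_on {1..n} \<pi>"
    and s: "s permutes {1..n}" "\<forall>B\<in>\<pi>. s ` B = l B \<and> strict_mono_on B s"
    and t: "t permutes {1..n}" "\<forall>B\<in>\<pi>. t ` B = l B \<and> strict_mono_on B t"
  shows "s = t"
proof
  fix a
  show "s a = t a"
  proof (cases "a \<in> {1..n}")
    case True
    then obtain B where B: "B \<in> \<pi>" "a \<in> B" using partition_block_exists[OF P] by blast
    then show ?thesis using strict_mono_on_image_unique[of B s t a] s(2) t(2) by metis
  next
    case False
    then show ?thesis using s(1) t(1) permutes_not_in by metis
  qed
qed

lemma nc2_perm_eq:
  assumes P: "partition_on {1..n} \<pi>"
    and s: "s permutes {1..n}" "\<forall>B\<in>\<pi>. s ` B = l B \<and> strict_mono_on B s"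
  shows "nc2_perm n (\<pi>, \<rho>, l) = s"
  unfolding nc2_perm_def prod.case
proof (rule the_equality)
  show "s permutes {1..n} \<and> (\<forall>B\<in>\<pi>. s ` B = l B \<and> strict_mono_on B s)" using s by blast
  show "t = s" if "t permutes {1..n} \<and> (\<forall>B\<in>\<pi>. t ` B = l B \<and> strict_mono_on B t)" for t
    using nc2_perm_unique[OF P _ _ s] that by blast
qed

lemma NC2_D:
  assumes "(\<pi>, \<rho>, l) \<in> NC2 n"
  shows "\<pi> \<in> NC n" "partition_on {1..n} \<pi>" "partition_on {1..n} \<rho>" "bij_betw l \<pi> \<rho>" "l \<in> extensional \<pi>"
    "\<And>B. B \<in> \<pi> \<Longrightarrow> card (l B) = card B"
  using assms NC_partition unfolding NC2_def by auto

text \<open>Each block has an increasing bijection onto its image block, and these glue to a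
  permutation. Thus the description by \<open>THE\<close> in \<open>nc2_perm\<close> has a solution,
  unique by \<open>nc2_perm_unique\<close>.\<close>

lemma nc2_perm_props:
  assumes \<phi>: "(\<pi>, \<rho>, l) \<in> NC2 n"
  shows "nc2_perm n (\<pi>, \<rho>, l) permutes {1..n}"
    and "B \<in> \<pi> \<Longrightarrow> nc2_perm n (\<pi>, \<rho>, l) ` B = l B"
    and "B \<in> \<pi> \<Longrightarrow> strict_mono_on B (nc2_perm n (\<pi>, \<rho>, l))"
proof -
  note P = NC2_D(2)[OF \<phi>] and Q = NC2_D(3)[OF \<phi>] and bij = NC2_D(4)[OF \<phi>] and cd = NC2_D(6)[OF \<phi>]
  have "\<exists>f. f ` B = l B \<and> strict_mono_on B f" if B: "B \<in> \<pi>" for B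
  proof -
    have "l B \<in> \<rho>" using bij B unfolding bij_betw_def by auto
    then have "finite B" "finite (l B)"
      using P Q B unfolding partition_on_def by (metis Union_upper finite_atLeastAtMost finite_subset)+
    then show ?thesis using strict_mono_bij_exists[of B "l B"] cd[OF B] by metis
  qed
  then obtain f where f: "\<And>B. B \<in> \<pi> \<Longrightarrow> f B ` B = l B \<and> strict_mono_on B (f B)" by metis
  define s where "s a = (if a \<in> {1..n} then f {b. same_block \<pi> a b} a else a)" for a
  have sB: "s a = f B a" if "B \<in> \<pi>" "a \<in> B" for a B
    using that P block_eq_Collect[OF P that] unfolding s_def partition_on_def by auto
  have im: "s ` B = l B" if "B \<in> \<pi>" for B using sB[OF that] f[OF that] by force
  have mono: "strict_mono_on B s" if "B \<in> \<pi>" for B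
    using sB[OF that] f[OF that] unfolding strict_mono_on_def by auto
  have "s ` {1..n} = {1..n}"
  proof -
    have "s ` {1..n} = (\<Union>B\<in>\<pi>. s ` B)" using P unfolding partition_on_def by blast
    also have "\<dots> = (\<Union>B\<in>\<pi>. l B)" using im by auto
    also have "\<dots> = \<Union>\<rho>" using bij unfolding bij_betw_def by blast
    finally show ?thesis using Q unfolding partition_on_def by simp
  qed
  then have "bij_betw s {1..n} {1..n}"
    unfolding bij_betw_def using eq_card_imp_inj_on[of "{1..n}" s] by simp
  then have s: "s permutes {1..n}" by (intro bij_imp_permutes) (auto simp: s_def)
  have "nc2_perm n (\<pi>, \<rho>, l) = s" using nc2_perm_eq[OF P s] im mono by blast
  then show "nc2_perm n (\<pi>, \<rho>, l) permutes {1..n}"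
    "B \<in> \<pi> \<Longrightarrow> nc2_perm n (\<pi>, \<rho>, l) ` B = l B"
    "B \<in> \<pi> \<Longrightarrow> strict_mono_on B (nc2_perm n (\<pi>, \<rho>, l))"
    using s im mono by auto
qed

section \<open>Places of values, and the order in terms of blocks and places\<close>

abbreviation blk :: "nc2 \<Rightarrow> nat \<Rightarrow> nat \<Rightarrow> bool" where "blk \<phi> \<equiv> same_block (fst \<phi>)"

definition pos :: "nat \<Rightarrow> nc2 \<Rightarrow> nat \<Rightarrow> nat" where "pos n \<phi> = inv (nc2_perm n \<phi>)"

lemma NC2_fst: "\<phi> \<in> NC2 n \<Longrightarrow> fst \<phi> \<in> NC n"
  by (cases \<phi>) (auto simp: NC2_def)

lemma blk_nc_rel: "\<phi> \<in> NC2 n \<Longrightarrow> nc_rel n (blk \<phi>)"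
  using NC2_fst NC_nc_rel by blast

lemma nc2_perm_permutes: "\<phi> \<in> NC2 n \<Longrightarrow> nc2_perm n \<phi> permutes {1..n}"
  using nc2_perm_props(1) by (cases \<phi>) auto

lemma pos_permutes: "\<phi> \<in> NC2 n \<Longrightarrow> pos n \<phi> permutes {1..n}"
  unfolding pos_def using nc2_perm_permutes permutes_inv by blast

lemma pos_perm: "\<phi> \<in> NC2 n \<Longrightarrow> pos n \<phi> (nc2_perm n \<phi> a) = a"
  unfolding pos_def using nc2_perm_permutes permutes_inverses(2) by metis

lemma perm_pos: "\<phi> \<in> NC2 n \<Longrightarrow> nc2_perm n \<phi> (pos n \<phi> v) = v"
  unfolding pos_def using nc2_perm_permutes permutes_inverses(1) by metis

lemma pos_inj: "\<phi> \<in> NC2 n \<Longrightarrow> pos n \<phi> u = pos n \<phi> v \<longleftrightarrow> u = v"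
  using perm_pos by metis

lemma pos_onto: "\<phi> \<in> NC2 n \<Longrightarrow> \<exists>v. pos n \<phi> v = a"
  using pos_perm by metis

lemma pos_range: "\<phi> \<in> NC2 n \<Longrightarrow> pos n \<phi> v \<in> {1..n} \<longleftrightarrow> v \<in> {1..n}"
  using pos_permutes permutes_in_image by metis

lemma pos_outside: "\<phi> \<in> NC2 n \<Longrightarrow> v \<notin> {1..n} \<Longrightarrow> pos n \<phi> v = v"
  using pos_permutes permutes_not_in by metis

lemma pos_sorted:
  assumes \<phi>: "\<phi> \<in> NC2 n" and "blk \<phi> (pos n \<phi> u) (pos n \<phi> v)"
  shows "pos n \<phi> u < pos n \<phi> v \<longleftrightarrow> u < v"
proof -
  obtain \<pi> \<rho> l where e: "\<phi> = (\<pi>, \<rho>, l)" by (cases \<phi>) auto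
  obtain B where B: "B \<in> \<pi>" "pos n \<phi> u \<in> B" "pos n \<phi> v \<in> B" using assms(2) e unfolding same_block_def by auto
  have "strict_mono_on B (nc2_perm n \<phi>)" using nc2_perm_props(3) \<phi> e B by blast
  then show ?thesis
    using strict_mono_on_less[OF _ B(2,3)] perm_pos[OF \<phi>] by metis
qed

lemma NC2_eqI:
  assumes \<phi>: "\<phi> \<in> NC2 n" and \<psi>: "\<psi> \<in> NC2 n" and b: "blk \<phi> = blk \<psi>" and p: "pos n \<phi> = pos n \<psi>"
  shows "\<phi> = \<psi>"
proof -
  obtain \<pi> \<rho> l where e: "\<phi> = (\<pi>, \<rho>, l)" by (cases \<phi>) auto
  obtain \<pi>' \<rho>' l' where e': "\<psi> = (\<pi>', \<rho>', l')" by (cases \<psi>) auto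
  have "\<pi> = \<pi>'"
    using partition_eqI[of "{1..n}" \<pi> \<pi>'] NC2_D(2) \<phi> \<psi> e e' b by auto
  have "nc2_perm n \<phi> = nc2_perm n \<psi>" using p perm_pos[OF \<phi>] pos_perm[OF \<psi>] by (metis ext)
  then have "l B = l' B" if "B \<in> \<pi>" for B
    using nc2_perm_props(2)[of \<pi> \<rho> l n B] nc2_perm_props(2)[of \<pi>' \<rho>' l' n B] \<phi> \<psi> e e' that \<open>\<pi> = \<pi>'\<close> by auto
  then have "l = l'" using NC2_D(5)[of \<pi> \<rho> l n] NC2_D(5)[of \<pi>' \<rho>' l' n] \<phi> \<psi> e e' \<open>\<pi> = \<pi>'\<close>
    by (auto intro: extensionalityI)
  moreover have "\<rho> = l ` \<pi>" "\<rho>' = l' ` \<pi>'"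
    using NC2_D(4)[of \<pi> \<rho> l n] NC2_D(4)[of \<pi>' \<rho>' l' n] \<phi> \<psi> e e' unfolding bij_betw_def by auto
  ultimately show ?thesis using e e' \<open>\<pi> = \<pi>'\<close> by simp
qed

text \<open>Since \<open>l B\<close> is the image of \<open>B\<close> under the sorted permutation,
  the condition on the bijections says that each block of \<phi> has the same image under both
  permutations, that is, no value leaves its block of \<phi>. The refinement of the second
  partitions then follows from that of the first.\<close>

lemma nc2_le_iff:
  assumes \<phi>: "\<phi> \<in> NC2 n" and \<psi>: "\<psi> \<in> NC2 n"
  shows "nc2_le n \<phi> \<psi> \<longleftrightarrow> (\<forall>a b. blk \<psi> a b \<longrightarrow> blk \<phi> a b) \<and> (\<forall>v\<in>{1..n}. blk \<phi> (pos n \<phi> v) (pos n \<psi> v))"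
    (is "_ \<longleftrightarrow> ?F \<and> ?G")
proof -
  obtain \<pi> \<rho> l where e: "\<phi> = (\<pi>, \<rho>, l)" by (cases \<phi>) auto
  obtain \<pi>' \<rho>' l' where e': "\<psi> = (\<pi>', \<rho>', l')" by (cases \<psi>) auto
  note D = NC2_D[OF \<phi>[unfolded e]] and D' = NC2_D[OF \<psi>[unfolded e']]
  let ?s = "nc2_perm n \<phi>" and ?t = "nc2_perm n \<psi>"
  have s: "?s ` B = l B" if "B \<in> \<pi>" for B using nc2_perm_props(2) \<phi> that e by blast
  have t: "?t ` B = l' B" if "B \<in> \<pi>'" for B using nc2_perm_props(2) \<psi> that e' by blast
  have F: "refines {1..n} \<pi>' \<pi> \<longleftrightarrow> ?F" using refines_iff_same_block[OF D'(2) D(2)] e e' by simp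
  have tU: "\<Union> (l' ` S) = ?t ` \<Union>S" if "S \<subseteq> \<pi>'" for S using t that by blast
  have G: "(\<forall>B\<in>\<pi>. ?s ` B = ?t ` B) \<longleftrightarrow> ?G"
  proof
    assume eq: "\<forall>B\<in>\<pi>. ?s ` B = ?t ` B"
    show ?G
    proof
      fix v assume "v \<in> {1..n}"
      then have "pos n \<phi> v \<in> {1..n}" using pos_range \<phi> by blast
      then obtain B where B: "B \<in> \<pi>" "pos n \<phi> v \<in> B" using partition_block_exists[OF D(2)] by blast
      then have "v \<in> ?s ` B" using perm_pos[OF \<phi>, of v] by (metis imageI)
      then obtain a where "a \<in> B" "v = ?t a" using eq B by blast
      then have "pos n \<psi> v \<in> B" using pos_perm \<psi> by simp
      then show "blk \<phi> (pos n \<phi> v) (pos n \<psi> v)" using B e unfolding same_block_def by auto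
    qed
  next
    assume G: ?G
    show "\<forall>B\<in>\<pi>. ?s ` B = ?t ` B"
    proof
      fix B assume B: "B \<in> \<pi>"
      have BA: "B \<subseteq> {1..n}" using B D(2) unfolding partition_on_def by auto
      have iff: "pos n \<phi> v \<in> B \<longleftrightarrow> pos n \<psi> v \<in> B" if "v \<in> {1..n}" for v
      proof -
        obtain C where C: "C \<in> \<pi>" "pos n \<phi> v \<in> C" "pos n \<psi> v \<in> C"
          using bspec[OF G \<open>v \<in> {1..n}\<close>] e unfolding same_block_def by auto
        then show ?thesis using partition_block_unique[OF D(2) B C(1)] by blast
      qed
      have "v \<in> ?s ` B \<longleftrightarrow> v \<in> ?t ` B" for v
      proof -
        have "v \<in> ?s ` B \<longleftrightarrow> pos n \<phi> v \<in> B" using perm_pos[OF \<phi>] pos_perm[OF \<phi>] by (metis imageE imageI)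
        moreover have "v \<in> ?t ` B \<longleftrightarrow> pos n \<psi> v \<in> B" using perm_pos[OF \<psi>] pos_perm[OF \<psi>] by (metis imageE imageI)
        moreover have "pos n \<phi> v \<in> B \<longleftrightarrow> pos n \<psi> v \<in> B"
          using iff BA pos_range[OF \<phi>, of v] pos_range[OF \<psi>, of v] by blast
        ultimately show ?thesis by blast
      qed
      then show "?s ` B = ?t ` B" by blast
    qed
  qed
  show ?thesis
  proof
    assume le: "nc2_le n \<phi> \<psi>"
    then have r: "refines {1..n} \<pi>' \<pi>" and L: "\<And>B S. B \<in> \<pi> \<Longrightarrow> S \<subseteq> \<pi>' \<Longrightarrow> B = \<Union>S \<Longrightarrow> l B = \<Union>(l' ` S)"
      using e e' by auto
    have "?s ` B = ?t ` B" if B: "B \<in> \<pi>" for B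
    proof -
      let ?S = "{p \<in> \<pi>'. p \<subseteq> B}"
      have "B = \<Union>?S" using refines_obtains_subset[OF r B] unfolding partition_on_def by simp
      then show ?thesis using L[OF B, of ?S] tU[of ?S] s[OF B] by auto
    qed
    then show "?F \<and> ?G" using F G r by blast
  next
    assume FG: "?F \<and> ?G"
    then have r: "refines {1..n} \<pi>' \<pi>" and st: "\<And>B. B \<in> \<pi> \<Longrightarrow> ?s ` B = ?t ` B" using F G by blast+
    have "\<exists>Y\<in>\<rho>. X \<subseteq> Y" if X: "X \<in> \<rho>'" for X
    proof -
      obtain B where B: "B \<in> \<pi>'" "X = l' B" using X D'(4) unfolding bij_betw_def by auto
      obtain C where C: "C \<in> \<pi>" "B \<subseteq> C" using r B unfolding refines_def by blast
      have "X \<subseteq> l C" using B C t s st by (metis image_mono)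
      moreover have "l C \<in> \<rho>" using C D(4) unfolding bij_betw_def by auto
      ultimately show ?thesis by blast
    qed
    then have "refines {1..n} \<rho>' \<rho>" unfolding refines_def using D(3) D'(3) by blast
    moreover have "l B = \<Union>(l' ` S)" if "B \<in> \<pi>" "S \<subseteq> \<pi>'" "B = \<Union>S" for B S
      using tU[OF that(2)] s[OF that(1)] st[OF that(1)] that(3) by simp
    ultimately show "nc2_le n \<phi> \<psi>" using e e' r by auto
  qed
qed

text \<open>Only the images of the blocks under \<open>s\<close> enter, and sorting inside blocks
  leaves every value in its block. The last conclusion is the case in which \<open>s\<close> is
  already sorted.\<close>

lemma NC2_construct:
  assumes R: "nc_rel n R" and s: "s permutes {1..n}"
  obtains \<phi> where "\<phi> \<in> NC2 n" "blk \<phi> = R" "\<And>v. v \<in> {1..n} \<Longrightarrow> R (pos n \<phi> v) (inv s v)"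
    "(\<And>a b. R a b \<Longrightarrow> a < b \<Longrightarrow> s a < s b) \<Longrightarrow> nc2_perm n \<phi> = s"
proof -
  obtain \<pi> where \<pi>: "\<pi> \<in> NC n" "same_block \<pi> = R" using NC_of_nc_rel R by blast
  have P: "partition_on {1..n} \<pi>" using NC_partition \<pi> by blast
  define l where "l = restrict ((`) s) \<pi>"
  define \<phi> where "\<phi> = (\<pi>, l ` \<pi>, l)"
  have inj: "inj s" using s permutes_inj by blast
  have l\<pi>: "l ` \<pi> = (`) s ` \<pi>" unfolding l_def by auto
  have im: "s ` {1..n} = {1..n}" using s permutes_image by blast
  have "partition_on (s ` {1..n}) ((`) s ` \<pi> - {{}})"
    using partition_on_inj_image[OF P] inj inj_on_subset by blast
  moreover have "{} \<notin> (`) s ` \<pi>" using P unfolding partition_on_def by auto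
  ultimately have "partition_on {1..n} (l ` \<pi>)" using l\<pi> im by simp
  moreover have "inj_on l \<pi>" unfolding l_def inj_on_def using inj by (auto simp: inj_image_eq_iff)
  moreover have "card (l B) = card B" if "B \<in> \<pi>" for B
    using that inj unfolding l_def by (simp add: card_image inj_on_subset)
  ultimately have \<phi>: "\<phi> \<in> NC2 n"
    unfolding NC2_def \<phi>_def using \<pi> unfolding bij_betw_def l_def by auto
  have b: "blk \<phi> = R" using \<pi> \<phi>_def by simp
  show thesis
  proof (rule that[OF \<phi> b])
    fix v assume v: "v \<in> {1..n}"
    have "pos n \<phi> v \<in> {1..n}" using pos_range \<phi> v by blast
    then obtain B where B: "B \<in> \<pi>" "pos n \<phi> v \<in> B" using partition_block_exists[OF P] by blast
    have "nc2_perm n \<phi> ` B = s ` B" using nc2_perm_props(2)[of \<pi> "l ` \<pi>" l n B] \<phi> B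
      unfolding \<phi>_def l_def by simp
    then have "v \<in> s ` B" using perm_pos[OF \<phi>, of v] B by (metis imageI)
    then have "inv s v \<in> B" using inj by (auto simp: inv_f_f)
    then show "R (pos n \<phi> v) (inv s v)" using B \<pi> unfolding same_block_def by auto
  next
    assume m: "\<And>a b. R a b \<Longrightarrow> a < b \<Longrightarrow> s a < s b"
    have "strict_mono_on B s" if "B \<in> \<pi>" for B
      unfolding strict_mono_on_def using that m \<pi>(2) unfolding same_block_def by blast
    then show "nc2_perm n \<phi> = s" unfolding \<phi>_def
      using nc2_perm_eq[OF P s, of l "l ` \<pi>"] unfolding l_def by simp
  qed
qed

section \<open>Comparing codes and labels\<close>

text \<open>
  The order on codes in terms of the inverse permutations: \<open>pos_less P Q\<close> means that \<open>P\<close> belongs to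
  the smaller code, although its values are larger at the deciding place.
\<close>

definition pos_less :: "(nat \<Rightarrow> nat) \<Rightarrow> (nat \<Rightarrow> nat) \<Rightarrow> bool" where
  "pos_less P P' \<longleftrightarrow> (\<exists>v. (\<forall>t>v. P t = P' t) \<and> P' v < P v)"

lemma pos_less_irrefl: "\<not> pos_less P P"
  unfolding pos_less_def by simp

lemma pos_less_trans:
  assumes "pos_less P Q" "pos_less Q R" shows "pos_less P R"
proof -
  obtain v w where v: "\<forall>t>v. P t = Q t" "Q v < P v" and w: "\<forall>t>w. Q t = R t" "R w < Q w"
    using assms unfolding pos_less_def by blast
  have "\<forall>t>max v w. P t = R t" using v w by simp
  moreover have "R (max v w) < P (max v w)"
    using v w by (cases v w rule: linorder_cases) (auto simp: max_def)
  ultimately show ?thesis unfolding pos_less_def by blast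
qed

lemma pos_less_total:
  assumes P: "P permutes {1..n}" and Q: "Q permutes {1..n}" and ne: "P \<noteq> Q"
  shows "pos_less P Q \<or> pos_less Q P"
proof -
  define D where "D = {v. P v \<noteq> Q v}"
  have "D \<subseteq> {1..n}"
  proof
    fix v assume "v \<in> D"
    then have "P v \<noteq> Q v" unfolding D_def by blast
    then show "v \<in> {1..n}"
      using permutes_not_in[OF P, of v] permutes_not_in[OF Q, of v] by (cases "v \<in> {1..n}") simp_all
  qed
  then have fin: "finite D" using finite_subset by blast
  have "D \<noteq> {}" using ne unfolding D_def by auto
  define v where "v = Max D"
  have "v \<in> D" using fin \<open>D \<noteq> {}\<close> v_def Max_in by blast
  then have "P v < Q v \<or> Q v < P v" unfolding D_def by auto
  moreover have "P t = Q t" if "v < t" for t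
  proof -
    have "t \<notin> D" using Max_ge[OF fin, of t] that v_def by auto
    then show ?thesis unfolding D_def by simp
  qed
  ultimately show ?thesis unfolding pos_less_def by (metis)
qed

text \<open>The smaller values to the right of \<open>v\<close> occupy exactly the places there that
  no larger value holds. In this form the entry depends only on the places of \<open>v\<close> and
  of the larger values, which suits a comparison at the largest value that differs.\<close>

lemma code_entry_eq:
  assumes s: "s permutes {1..n}" and v: "v \<in> {1..n}"
  shows "code_entry s v = card ({inv s v<..n} - inv s ` {v<..n})"
proof -
  have P: "inv s permutes {1..n}" using s permutes_inv by blast
  have inj: "inj (inv s)" using P permutes_inj by blast
  have "inv s ` {j \<in> {1..<v}. inv s j > inv s v} = {inv s v<..n} - inv s ` {v<..n}" (is "?L = ?R")
  proof (intro equalityI subsetI)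
    fix a assume "a \<in> ?L"
    then obtain j where j: "a = inv s j" "1 \<le> j" "j < v" "inv s j > inv s v" by auto
    have "inv s j \<in> {1..n}" using P j v by (subst permutes_in_image[OF P]) auto
    then show "a \<in> ?R" using j inj by (auto simp: inj_eq)
  next
    fix a assume a: "a \<in> ?R"
    then have "a \<in> {1..n}" by auto
    then obtain j where j: "a = inv s j" "j \<in> {1..n}" using permutes_image[OF P] by blast
    then have "j < v" using a by (metis Diff_iff atLeastAtMost_iff greaterThanAtMost_iff greaterThanLessThan_iff
          imageI linorder_neqE_nat less_irrefl)
    then show "a \<in> ?L" using j a by auto
  qed
  then show ?thesis unfolding code_entry_def using card_image[OF inj_on_subset[OF inj subset_UNIV]] by metis
qed

text \<open>Equal places of all larger values give equal entries, and these come first because the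
  words run from \<open>n\<close> down to 1. At the deciding value, standing further left leaves
  more places to the right.\<close>

lemma word_less_of_pos_less:
  assumes s: "s permutes {1..n}" and t: "t permutes {1..n}" and less: "pos_less (inv s) (inv t)"
  shows "word_less (code_word n s) (code_word n t)"
proof -
  obtain v where v: "\<And>u. u > v \<Longrightarrow> inv s u = inv t u" "inv t v < inv s v" using less unfolding pos_less_def by blast
  have vn: "v \<in> {1..n}"
  proof (rule ccontr)
    assume "v \<notin> {1..n}"
    then have "inv s v = v" "inv t v = v" using s t permutes_inv permutes_not_in by metis+
    then show False using v by simp
  qed
  have im: "inv s ` {u<..n} = inv t ` {u<..n}" if "u \<ge> v" for u using v(1) that by (auto simp: image_iff)
  have eq: "code_entry s u = code_entry t u" if "u > v" "u \<le> n" for u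
    using code_entry_eq[OF s, of u] code_entry_eq[OF t, of u] im[of u] v(1)[of u] that by auto
  have lt: "code_entry s v < code_entry t v"
  proof -
    have P: "inv s permutes {1..n}" using s permutes_inv by blast
    have "inv s v \<notin> inv s ` {v<..n}"
      using permutes_inj[OF P] by (auto simp: inj_eq)
    moreover have "inv s v \<le> n" using vn permutes_in_image[OF P, of v] by auto
    \<comment> \<open>The inclusion is strict because of the place \<open>inv s v\<close>: it lies
      to the right of \<open>inv t v\<close>, and no value above \<open>v\<close> holds it.\<close>
    ultimately have "{inv s v<..n} - inv s ` {v<..n} \<subset> {inv t v<..n} - inv t ` {v<..n}"
      using v(2) im[of v] by auto
    then show ?thesis using code_entry_eq[OF s vn] code_entry_eq[OF t vn] by (simp add: psubset_card_mono)
  qed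
  have split: "rev [1..<Suc n] = rev [Suc v..<Suc n] @ v # rev [1..<v]"
  proof -
    have "[1..<Suc n] = [1..<v] @ [v..<Suc n]" using vn upt_add_eq_append[of 1 v "Suc n - v"] by auto
    moreover have "[v..<Suc n] = v # [Suc v..<Suc n]" using vn by (simp add: upt_conv_Cons)
    ultimately show ?thesis by simp
  qed
  have pre: "map (code_entry s) (rev [Suc v..<Suc n]) = map (code_entry t) (rev [Suc v..<Suc n])"
    using eq by auto
  show ?thesis
    unfolding word_less_def code_word_def split map_append list.map pre
    by (rule lexord_append_leftI) (simp add: lt)
qed

lemma word_less_irrefl: "\<not> word_less u u"
  unfolding word_less_def by (rule lexord_irreflexive) simp

lemma word_less_asym: "word_less u v \<Longrightarrow> \<not> word_less v u"
  unfolding word_less_def by (rule lexord_asymmetric) (auto intro: asymI)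

text \<open>Any two place maps are comparable or equal, while \<open>word_less\<close> is
  asymmetric; so the implication already proved is an equivalence, and codes determine
  permutations.\<close>

lemma word_less_iff:
  assumes \<phi>: "\<phi> \<in> NC2 n" and \<psi>: "\<psi> \<in> NC2 n"
  shows "word_less (code_word n (nc2_perm n \<phi>)) (code_word n (nc2_perm n \<psi>)) \<longleftrightarrow> pos_less (pos n \<phi>) (pos n \<psi>)"
    and "code_word n (nc2_perm n \<phi>) = code_word n (nc2_perm n \<psi>) \<longleftrightarrow> pos n \<phi> = pos n \<psi>"
proof -
  note s = nc2_perm_permutes[OF \<phi>] and t = nc2_perm_permutes[OF \<psi>]
  note A = word_less_of_pos_less[OF s t] and B = word_less_of_pos_less[OF t s]
  note tot = pos_less_total[OF pos_permutes[OF \<phi>] pos_permutes[OF \<psi>]]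
  have eq: "code_word n (nc2_perm n \<phi>) = code_word n (nc2_perm n \<psi>)" if "pos n \<phi> = pos n \<psi>"
  proof -
    have "nc2_perm n \<phi> = nc2_perm n \<psi>" using that s t unfolding pos_def by (metis permutes_inv_inv)
    then show ?thesis by simp
  qed
  show "word_less (code_word n (nc2_perm n \<phi>)) (code_word n (nc2_perm n \<psi>)) \<longleftrightarrow> pos_less (pos n \<phi>) (pos n \<psi>)"
    using A B tot eq word_less_asym word_less_irrefl unfolding pos_def by metis
  show "code_word n (nc2_perm n \<phi>) = code_word n (nc2_perm n \<psi>) \<longleftrightarrow> pos n \<phi> = pos n \<psi>"
    using A B tot eq word_less_irrefl unfolding pos_def by metis
qed

section \<open>Cycles of blocks and the labels of splits\<close>

definition cyc :: "nat set \<Rightarrow> nat \<Rightarrow> nat" where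
  "cyc B a = (if \<exists>b\<in>B. a < b then Min {b \<in> B. a < b} else Min B)"

lemma nc_cycles_eq_cyc:
  assumes P: "partition_on A \<pi>" and B: "B \<in> \<pi>" "a \<in> B"
  shows "nc_cycles \<pi> a = cyc B a"
proof -
  have "(THE B. B \<in> \<pi> \<and> a \<in> B) = B" using B partition_block_unique[OF P] by (intro the_equality) auto
  moreover have "a \<in> \<Union>\<pi>" using B by blast
  ultimately show ?thesis unfolding nc_cycles_def cyc_def by (simp add: Let_def)
qed

lemma nc_cycles_outside: "partition_on A \<pi> \<Longrightarrow> a \<notin> A \<Longrightarrow> nc_cycles \<pi> a = a"
  unfolding nc_cycles_def partition_on_def by auto

text \<open>The two alternatives are the step to the next element of the block and the return from
  its maximum to its minimum.\<close>

lemma cyc_cases: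
  assumes B: "finite B" "a \<in> B"
  shows "cyc B a \<in> B" "a < cyc B a \<and> (\<forall>d\<in>B. \<not> (a < d \<and> d < cyc B a)) \<or> (\<forall>d\<in>B. d \<le> a \<and> cyc B a \<le> d)"
proof -
  have "cyc B a \<in> B \<and> (a < cyc B a \<and> (\<forall>d\<in>B. \<not> (a < d \<and> d < cyc B a)) \<or> (\<forall>d\<in>B. d \<le> a \<and> cyc B a \<le> d))"
  proof (cases "\<exists>b\<in>B. a < b")
    case True
    let ?M = "{b \<in> B. a < b}"
    have M: "finite ?M" "?M \<noteq> {}" using B True by auto
    have "Min ?M \<in> ?M" using Min_in[OF M] .
    moreover have "\<not> (a < d \<and> d < Min ?M)" if "d \<in> B" for d
      using Min_le[OF M(1), of d] that by auto
    moreover have "cyc B a = Min ?M" using True unfolding cyc_def by simp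
    ultimately show ?thesis by auto
  next
    case False
    then have "cyc B a = Min B" unfolding cyc_def by auto
    moreover have "Min B \<in> B" using B Min_in[of B] by blast
    ultimately show ?thesis using False B(1) Min_le[of B] by auto
  qed
  then show "cyc B a \<in> B" "a < cyc B a \<and> (\<forall>d\<in>B. \<not> (a < d \<and> d < cyc B a)) \<or> (\<forall>d\<in>B. d \<le> a \<and> cyc B a \<le> d)"
    by blast+
qed

lemma cyc_eqI:
  assumes "finite B" "a \<in> B" "c \<in> B"
    and "a < c \<and> (\<forall>d\<in>B. \<not> (a < d \<and> d < c)) \<or> (\<forall>d\<in>B. d \<le> a \<and> c \<le> d)"
  shows "cyc B a = c"
  using cyc_cases[OF assms(1,2)] assms(3,4)
  by (metis leD le_antisym linorder_neqE_nat order_le_less_trans)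

lemma cyc_inj:
  assumes "finite B" "a \<in> B" "b \<in> B" "cyc B a = cyc B b"
  shows "a = b"
  using cyc_cases[OF assms(1,2)] cyc_cases[OF assms(1,3)] assms(2-4)
  by (metis leD le_antisym linorder_neqE_nat order_le_less_trans)

lemma nc_cycles_permutes:
  assumes P: "partition_on A \<pi>" and A: "finite A"
  shows "nc_cycles \<pi> permutes A"
proof -
  have fin: "finite B" if "B \<in> \<pi>" for B
    using that P A finite_subset unfolding partition_on_def by (metis Union_upper)
  have blk: "\<exists>B\<in>\<pi>. a \<in> B \<and> nc_cycles \<pi> a = cyc B a \<and> cyc B a \<in> B" if "a \<in> A" for a
    using partition_block_exists[OF P that] nc_cycles_eq_cyc[OF P] cyc_cases(1) fin by metis
  have "nc_cycles \<pi> ` A \<subseteq> A"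
    using blk P unfolding partition_on_def by fastforce
  moreover have "inj_on (nc_cycles \<pi>) A"
  proof (rule inj_onI)
    fix a b assume "a \<in> A" "b \<in> A" "nc_cycles \<pi> a = nc_cycles \<pi> b"
    moreover from this obtain B C where B: "B \<in> \<pi>" "a \<in> B" "nc_cycles \<pi> a = cyc B a" "cyc B a \<in> B"
      and C: "C \<in> \<pi>" "b \<in> C" "nc_cycles \<pi> b = cyc C b" "cyc C b \<in> C"
      using blk by metis
    moreover have "B = C" using partition_block_unique[OF P B(1) C(1)] B C calculation by metis
    ultimately show "a = b" using cyc_inj fin by metis
  qed
  ultimately have "bij_betw (nc_cycles \<pi>) A A"
    unfolding bij_betw_def using A endo_inj_surj by blast
  then show ?thesis using nc_cycles_outside[OF P] by (intro bij_imp_permutes) auto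
qed

text \<open>Cutting the cycle changes only two images: the predecessor of \<open>j\<close> closes up
  the interval part and goes to \<open>i\<close>, and the predecessor of \<open>i\<close> skips the
  interval and goes to \<open>j\<close>.\<close>

lemma cyc_split:
  assumes B: "finite B" "i \<in> B" "j \<in> B" "a \<in> B" and ij: "i < j"
  shows "cyc (if i \<le> a \<and> a < j then B \<inter> {i..<j} else B - {i..<j}) a = transpose i j (cyc B a)"
proof -
  define e where "e = cyc B a"
  have e: "e \<in> B" "a < e \<and> (\<forall>d\<in>B. \<not> (a < d \<and> d < e)) \<or> (\<forall>d\<in>B. d \<le> a \<and> e \<le> d)"
    using cyc_cases[OF B(1,4)] unfolding e_def by auto
  have fin: "finite (B \<inter> {i..<j})" "finite (B - {i..<j})" using B by auto
  show ?thesis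
  proof (cases "i \<le> a \<and> a < j")
    case True
    then have e': "a < e" "\<forall>d\<in>B. \<not> (a < d \<and> d < e)" using e B by (meson leD)+
    have "e \<le> j" using e' B True by (meson not_le)
    show ?thesis
    proof (cases "e = j")
      case eq: True
      have "cyc (B \<inter> {i..<j}) a = i"
        by (rule cyc_eqI[OF fin(1)]) (use True B e' eq in \<open>auto simp: not_less\<close>)
      then show ?thesis using True eq unfolding e_def by simp
    next
      case ne: False
      have "cyc (B \<inter> {i..<j}) a = e"
        by (rule cyc_eqI[OF fin(1)]) (use True B e e' ne \<open>e \<le> j\<close> in auto)
      moreover have "transpose i j e = e" using ne e' True by (simp add: transpose_def)
      ultimately show ?thesis using True unfolding e_def by simp
    qed
  next
    case False
    have "cyc (B - {i..<j}) a = transpose i j e"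
    proof (rule cyc_eqI[OF fin(2)])
      show "a \<in> B - {i..<j}" using False B by auto
      \<comment> \<open>For \<open>a\<close> outside the interval, \<open>j\<close> cannot follow
        \<open>a\<close>: either \<open>i\<close> would lie between them, or \<open>j\<close> would
        be the minimum although \<open>i\<close> is smaller.\<close>
      have ej: "e \<noteq> j"
      proof
        assume "e = j"
        then show False using e B False ij by (meson leD not_le)
      qed
      consider "a < e" "\<forall>d\<in>B. \<not> (a < d \<and> d < e)" | "\<forall>d\<in>B. d \<le> a \<and> e \<le> d" using e by blast
      then have "e \<notin> {i<..<j}"
      proof cases
        case 1
        then show ?thesis using bspec[OF 1(2) B(2)] False by auto
      next
        case 2
        then show ?thesis using bspec[OF 2 B(2)] by auto
      qed
      then show "transpose i j e \<in> B - {i..<j}" using e ej B by (auto simp: transpose_def)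
      show "a < transpose i j e \<and> (\<forall>d\<in>B - {i..<j}. \<not> (a < d \<and> d < transpose i j e)) \<or>
        (\<forall>d\<in>B - {i..<j}. d \<le> a \<and> transpose i j e \<le> d)"
      proof (cases "e = i")
        case True
        then have "transpose i j e = j" by simp
        then show ?thesis using e B False ij True
          by (auto simp: not_le not_less)
      next
        case False
        then have "transpose i j e = e" using ej by (simp add: transpose_def)
        then show ?thesis using e by auto
      qed
    qed
    then show ?thesis unfolding e_def if_not_P[OF False] .
  qed
qed

text \<open>By \<open>cyc_split\<close> the transposition acts after the old cycles, so cancelling
  \<open>nc_cycles \<pi>\<close> on the right recovers it. This is where the order of composition in
  \<open>nc_label\<close> enters.\<close>

lemma nc_label_split:
  assumes P: "partition_on A \<pi>" and Q: "partition_on A \<pi>'" and A: "finite A"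
    and s: "same_block \<pi>' = split_rel (same_block \<pi>) i j"
    and b: "same_block \<pi> i j" and ij: "i < j"
  shows "nc_label \<pi> \<pi>' = transpose i j"
proof -
  obtain B where B: "B \<in> \<pi>" "i \<in> B" "j \<in> B" using b unfolding same_block_def by blast
  have eq: "\<pi>' = insert (B \<inter> {i..<j}) (insert (B - {i..<j}) (\<pi> - {B}))"
    using split_partition assms B by blast
  have fin: "finite X" if "X \<in> \<pi>" for X
    using that P A finite_subset unfolding partition_on_def by (metis Union_upper)
  have "nc_cycles \<pi>' a = transpose i j (nc_cycles \<pi> a)" for a
  proof (cases "a \<in> A")
    case True
    then obtain X where X: "X \<in> \<pi>" "a \<in> X" using partition_block_exists[OF P] by blast
    show ?thesis
    proof (cases "X = B")
      case True
      have "nc_cycles \<pi>' a = cyc (if i \<le> a \<and> a < j then B \<inter> {i..<j} else B - {i..<j}) a"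
        by (rule nc_cycles_eq_cyc[OF Q]) (use True X eq in auto)
      then show ?thesis using cyc_split[OF fin[OF B(1)] B(2,3) _ ij] X True nc_cycles_eq_cyc[OF P X] by simp
    next
      case False
      have "nc_cycles \<pi>' a = cyc X a" using nc_cycles_eq_cyc[OF Q _ X(2)] X False eq by blast
      moreover have "cyc X a \<in> X" using cyc_cases(1) fin X by blast
      moreover have "i \<notin> X" "j \<notin> X" using partition_block_unique[OF P X(1) B(1)] B False by blast+
      ultimately show ?thesis using nc_cycles_eq_cyc[OF P X] by (metis transpose_apply_other)
    qed
  next
    case False
    have "i \<in> A" "j \<in> A" using B P unfolding partition_on_def by auto
    then show ?thesis using nc_cycles_outside[OF P] nc_cycles_outside[OF Q] False
      by (metis transpose_apply_other)
  qed
  then have "nc_cycles \<pi>' = transpose i j \<circ> nc_cycles \<pi>" by auto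
  then have "nc_label \<pi> \<pi>' = transpose i j \<circ> (nc_cycles \<pi> \<circ> inv (nc_cycles \<pi>))"
    unfolding nc_label_def by (simp add: comp_assoc)
  then show ?thesis using permutes_inv_o(1)[OF nc_cycles_permutes[OF P A]] by simp
qed

lemma transpose_eq_transpose:
  fixes i j k l :: nat
  assumes "i < j" "k < l" "transpose i j = transpose k l"
  shows "i = k" "j = l"
proof -
  have "transpose k l i = j" "transpose k l j = i" using assms(3) by (metis transpose_apply_first, metis transpose_apply_second)
  then show "i = k" "j = l" using assms(1,2) by (auto simp: transpose_def split: if_splits)
qed

lemma transposition_less_transpose:
  assumes "i < j" "k < l"
  shows "transposition_less (transpose i j) (transpose k l) \<longleftrightarrow> i < k \<or> i = k \<and> j < l"
  unfolding transposition_less_def using assms transpose_eq_transpose by metis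

section \<open>The order on noncrossing 2-partitions\<close>

definition leq :: "nat \<Rightarrow> nc2 \<Rightarrow> nc2 \<Rightarrow> bool" where
  "leq n \<phi> \<psi> \<longleftrightarrow> \<phi> \<in> NC2 n \<and> \<psi> \<in> NC2 n \<and> nc2_le n \<phi> \<psi>"

text \<open>The bound is inclusive: \<open>agree (Suc w)\<close> says that all values above
  \<open>w\<close> have equal places, with no condition on \<open>w\<close> itself.\<close>

definition agree :: "nat \<Rightarrow> (nat \<Rightarrow> nat) \<Rightarrow> (nat \<Rightarrow> nat) \<Rightarrow> bool" where
  "agree w P Q \<longleftrightarrow> (\<forall>t\<ge>w. P t = Q t)"

lemma agree_refl: "agree w P P" and agree_sym: "agree w P Q \<Longrightarrow> agree w Q P"
  and agree_trans: "agree w P Q \<Longrightarrow> agree w Q R \<Longrightarrow> agree w P R"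
  unfolding agree_def by auto

lemma agree_step: "agree w P Q \<longleftrightarrow> agree (Suc w) P Q \<and> P w = Q w"
  unfolding agree_def by (metis Suc_le_eq le_eq_less_or_eq)

lemma agree_0: "agree 0 P Q \<longleftrightarrow> P = Q"
  unfolding agree_def by auto

lemma pos_lessI: "agree (Suc w) P Q \<Longrightarrow> Q w < P w \<Longrightarrow> pos_less P Q"
  unfolding agree_def pos_less_def by (intro exI[of _ w]) (auto simp: Suc_le_eq)

lemma
  assumes "leq n \<phi> \<psi>"
  shows leq_NC2: "\<phi> \<in> NC2 n" "\<psi> \<in> NC2 n"
    and leq_blk: "blk \<psi> a b \<Longrightarrow> blk \<phi> a b"
    and leq_pos: "v \<in> {1..n} \<Longrightarrow> blk \<phi> (pos n \<phi> v) (pos n \<psi> v)"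
  using assms nc2_le_iff[of \<phi> n \<psi>] unfolding leq_def by blast+

lemma leqI:
  assumes "\<phi> \<in> NC2 n" "\<psi> \<in> NC2 n" "\<And>a b. blk \<psi> a b \<Longrightarrow> blk \<phi> a b"
    "\<And>v. v \<in> {1..n} \<Longrightarrow> blk \<phi> (pos n \<phi> v) (pos n \<psi> v)"
  shows "leq n \<phi> \<psi>"
  using assms nc2_le_iff[of \<phi> n \<psi>] unfolding leq_def by blast

lemma leq_refl: "\<phi> \<in> NC2 n \<Longrightarrow> leq n \<phi> \<phi>"
  using leqI[of \<phi> n \<phi>] nc_rel_refl[OF blk_nc_rel] pos_range by blast

lemma leq_trans:
  assumes 1: "leq n \<phi> \<psi>" and 2: "leq n \<psi> \<chi>" shows "leq n \<phi> \<chi>"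
proof (rule leqI)
  show "\<phi> \<in> NC2 n" "\<chi> \<in> NC2 n" using leq_NC2 1 2 by blast+
  show "blk \<phi> a b" if "blk \<chi> a b" for a b using that leq_blk[OF 1] leq_blk[OF 2] by blast
  show "blk \<phi> (pos n \<phi> v) (pos n \<chi> v)" if "v \<in> {1..n}" for v
    using leq_pos[OF 1 that] leq_blk[OF 1 leq_pos[OF 2 that]] nc_rel_trans[OF blk_nc_rel[OF leq_NC2(1)[OF 1]]]
    by blast
qed

text \<open>If \<open>v\<close> moved to the right, its new place would hold in \<phi> a larger
  value of the same block; but that value has not moved.\<close>

lemma pos_antimono:
  assumes l: "leq n \<phi> \<psi>" and a: "agree (Suc v) (pos n \<phi>) (pos n \<psi>)"
  shows "pos n \<psi> v \<le> pos n \<phi> v"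
proof (rule ccontr)
  note \<phi> = leq_NC2(1)[OF l] and \<psi> = leq_NC2(2)[OF l]
  assume c: "\<not> pos n \<psi> v \<le> pos n \<phi> v"
  then have v: "v \<in> {1..n}" using pos_outside \<phi> \<psi> by (metis le_refl)
  obtain t where t: "pos n \<phi> t = pos n \<psi> v" using pos_onto[OF \<phi>] by blast
  have "blk \<phi> (pos n \<phi> v) (pos n \<phi> t)" using leq_pos[OF l v] t by simp
  then have "v < t" using pos_sorted[OF \<phi>] c t by (metis not_le)
  then have "pos n \<psi> t = pos n \<psi> v" using a t unfolding agree_def by auto
  then show False using pos_inj[OF \<psi>] \<open>v < t\<close> by auto
qed

lemma greatest_difference:
  assumes \<phi>: "\<phi> \<in> NC2 n" and \<psi>: "\<psi> \<in> NC2 n" and t: "pos n \<phi> t \<noteq> pos n \<psi> t"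
  obtains u where "t \<le> u" "u \<in> {1..n}" "agree (Suc u) (pos n \<phi>) (pos n \<psi>)" "pos n \<phi> u \<noteq> pos n \<psi> u"
proof -
  define D where "D = {u. pos n \<phi> u \<noteq> pos n \<psi> u}"
  have sub: "D \<subseteq> {1..n}"
  proof
    fix u assume "u \<in> D"
    then have "pos n \<phi> u \<noteq> pos n \<psi> u" unfolding D_def by blast
    then show "u \<in> {1..n}" using pos_outside[OF \<phi>, of u] pos_outside[OF \<psi>, of u] by (cases "u \<in> {1..n}") simp_all
  qed
  then have fin: "finite D" using finite_subset by blast
  have tD: "t \<in> D" using t unfolding D_def by blast
  define u where "u = Max D"
  have "u \<in> D" using fin tD Max_in unfolding u_def by blast
  moreover have "t \<le> u" using fin tD unfolding u_def by simp
  moreover have "agree (Suc u) (pos n \<phi>) (pos n \<psi>)"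
    unfolding agree_def
  proof (intro allI impI)
    fix s assume "Suc u \<le> s"
    then have "s \<notin> D" using Max_ge[OF fin, of s] unfolding u_def by auto
    then show "pos n \<phi> s = pos n \<psi> s" unfolding D_def by blast
  qed
  ultimately show thesis using that sub unfolding D_def by blast
qed

lemma not_agree_greatest:
  assumes \<phi>: "\<phi> \<in> NC2 n" and \<psi>: "\<psi> \<in> NC2 n" and "\<not> agree w (pos n \<phi>) (pos n \<psi>)"
  obtains u where "w \<le> u" "u \<in> {1..n}" "agree (Suc u) (pos n \<phi>) (pos n \<psi>)" "pos n \<phi> u \<noteq> pos n \<psi> u"
proof -
  obtain t where t: "w \<le> t" "pos n \<phi> t \<noteq> pos n \<psi> t" using assms unfolding agree_def by blast
  obtain u where "t \<le> u" "u \<in> {1..n}" "agree (Suc u) (pos n \<phi>) (pos n \<psi>)" "pos n \<phi> u \<noteq> pos n \<psi> u"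
    using greatest_difference[OF \<phi> \<psi> t(2)] .
  then show thesis using that[of u] t(1) by simp
qed

lemma leq_pos_less:
  assumes l: "leq n \<phi> \<psi>" and ne: "pos n \<phi> \<noteq> pos n \<psi>"
  shows "pos_less (pos n \<phi>) (pos n \<psi>)"
proof -
  obtain u where u: "agree (Suc u) (pos n \<phi>) (pos n \<psi>)" "pos n \<phi> u \<noteq> pos n \<psi> u"
    using not_agree_greatest[OF leq_NC2[OF l], of 0] ne agree_0 by metis
  then show ?thesis using pos_antimono[OF l u(1)] pos_lessI by (metis le_neq_implies_less)
qed

lemma leq_antisym: assumes "leq n \<phi> \<psi>" "leq n \<psi> \<phi>" shows "\<phi> = \<psi>"
proof (rule NC2_eqI)
  show "\<phi> \<in> NC2 n" "\<psi> \<in> NC2 n" using leq_NC2 assms by blast+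
  show "blk \<phi> = blk \<psi>" using leq_blk[OF assms(1)] leq_blk[OF assms(2)] by blast
  show "pos n \<phi> = pos n \<psi>"
    using leq_pos_less[OF assms(1)] leq_pos_less[OF assms(2)] pos_less_trans pos_less_irrefl by metis
qed

text \<open>In \<phi>, the place of \<open>v\<close> shares a block with its place in
  \<open>z\<close>, and likewise in \<psi>. If \<psi> is finer, both places of \<open>v\<close>
  therefore lie in one block of \<phi>.\<close>

lemma leq_iff_blk:
  assumes 1: "leq n \<phi> z" and 2: "leq n \<psi> z"
  shows "leq n \<phi> \<psi> \<longleftrightarrow> (\<forall>a b. blk \<psi> a b \<longrightarrow> blk \<phi> a b)"
proof
  assume b: "\<forall>a b. blk \<psi> a b \<longrightarrow> blk \<phi> a b"
  note R = blk_nc_rel[OF leq_NC2(1)[OF 1]]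
  show "leq n \<phi> \<psi>"
  proof (rule leqI)
    show "\<phi> \<in> NC2 n" "\<psi> \<in> NC2 n" using leq_NC2 1 2 by blast+
    show "blk \<phi> (pos n \<phi> v) (pos n \<psi> v)" if v: "v \<in> {1..n}" for v
      using leq_pos[OF 1 v] leq_pos[OF 2 v] b nc_rel_sym[OF R] nc_rel_trans[OF R] by metis
  qed (use b in blast)
qed (use leq_blk in blast)

text \<open>The permutation of \<open>z\<close> is sorted inside the blocks of \<open>R\<close>.
  Together with \<open>leq_iff_blk\<close> this identifies the elements below \<open>z\<close> with
  the noncrossing relations coarser than that of \<open>z\<close>.\<close>

lemma leq_below:
  assumes z: "z \<in> NC2 n" and R: "nc_rel n R" and sub: "\<And>a b. blk z a b \<Longrightarrow> R a b"
  obtains \<phi> where "leq n \<phi> z" "blk \<phi> = R"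
proof -
  obtain \<phi> where "\<phi> \<in> NC2 n" "blk \<phi> = R" "\<And>v. v \<in> {1..n} \<Longrightarrow> R (pos n \<phi> v) (inv (nc2_perm n z) v)"
    using NC2_construct[OF R nc2_perm_permutes[OF z]] by metis
  then show thesis using that leqI[of \<phi> n z] z sub unfolding pos_def by blast
qed

lemma leq_card:
  assumes l: "leq n \<phi> \<psi>" and ne: "\<phi> \<noteq> \<psi>"
  shows "card (fst \<phi>) < card (fst \<psi>)"
proof -
  note P = NC_partition[OF NC2_fst[OF leq_NC2(1)[OF l]]] and Q = NC_partition[OF NC2_fst[OF leq_NC2(2)[OF l]]]
  have "fst \<psi> \<noteq> fst \<phi>"
  proof
    assume "fst \<psi> = fst \<phi>"
    then have "leq n \<psi> \<phi>" using leq_iff_blk[OF leq_refl[OF leq_NC2(2)[OF l]] l] by simp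
    then show False using leq_antisym l ne by blast
  qed
  moreover have "refines {1..n} (fst \<psi>) (fst \<phi>)"
    using refines_iff_same_block[OF Q P] leq_blk[OF l] by blast
  ultimately show ?thesis using refines_card by blast
qed

section \<open>Covers as splits of one block\<close>

definition cov :: "nat \<Rightarrow> nc2 \<Rightarrow> nc2 \<Rightarrow> nat \<Rightarrow> nat \<Rightarrow> bool" where
  "cov n \<phi> \<psi> i j \<longleftrightarrow> leq n \<phi> \<psi> \<and> i < j \<and> blk \<phi> i j \<and> blk \<psi> = split_rel (blk \<phi>) i j"

lemma cov_card: "cov n \<phi> \<psi> i j \<Longrightarrow> card (fst \<psi>) = Suc (card (fst \<phi>))"
  using split_card[OF NC_partition[OF NC2_fst] NC_partition[OF NC2_fst]] leq_NC2
  unfolding cov_def by (meson finite_atLeastAtMost)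

text \<open>\<open>split_rel_exists\<close> gives a split that separates only points separated by
  \<psi>; its relation is coarser than that of \<psi>, so \<open>leq_below\<close> supplies the
  permutation.\<close>

lemma cov_exists:
  assumes l: "leq n \<phi> \<psi>" and ne: "\<phi> \<noteq> \<psi>"
  obtains \<chi> i j where "cov n \<phi> \<chi> i j" "leq n \<chi> \<psi>"
proof -
  note R = blk_nc_rel[OF leq_NC2(1)[OF l]] and R' = blk_nc_rel[OF leq_NC2(2)[OF l]]
  have "blk \<psi> \<noteq> blk \<phi>"
  proof
    assume "blk \<psi> = blk \<phi>"
    then have "leq n \<psi> \<phi>" using leq_iff_blk[OF leq_refl[OF leq_NC2(2)[OF l]] l] by simp
    then show False using leq_antisym l ne by blast
  qed
  then obtain i j where ij: "i < j" "blk \<phi> i j" "\<And>a b. blk \<psi> a b \<Longrightarrow> split_rel (blk \<phi>) i j a b"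
    using split_rel_exists[OF R R' leq_blk[OF l]] by metis
  obtain \<chi> where \<chi>: "leq n \<chi> \<psi>" "blk \<chi> = split_rel (blk \<phi>) i j"
    using leq_below[OF leq_NC2(2)[OF l] nc_rel_split[OF R] ij(3)] by metis
  have "leq n \<phi> \<chi>" using leq_iff_blk[OF l \<chi>(1)] \<chi>(2) unfolding split_rel_def by simp
  then show thesis using that \<chi> ij unfolding cov_def by blast
qed

text \<open>Any pair separated by the cover represents the two halves of the split block. This frees
  later arguments from the interval that defines the split.\<close>

lemma cov_two_blocks:
  assumes c: "cov n \<phi> \<psi> i j" and b: "blk \<phi> a b" "\<not> blk \<psi> a b"
  shows "blk \<phi> a c \<Longrightarrow> blk \<psi> c a \<or> blk \<psi> c b" "\<not> blk \<phi> a c \<Longrightarrow> blk \<phi> c d \<Longrightarrow> blk \<psi> c d"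
proof -
  have R: "nc_rel n (blk \<phi>)" using c leq_NC2 blk_nc_rel unfolding cov_def by blast
  note sym = nc_rel_sym[OF R] and trans = nc_rel_trans[OF R]
  have eq: "blk \<psi> = split_rel (blk \<phi>) i j" using c unfolding cov_def by blast
  have ai: "blk \<phi> a i" and d: "(i \<le> a \<and> a < j) \<noteq> (i \<le> b \<and> b < j)" using b unfolding eq split_rel_def by auto
  show "blk \<psi> c a \<or> blk \<psi> c b" if "blk \<phi> a c"
  proof -
    have "blk \<phi> c a" "blk \<phi> c b" using that sym trans b by blast+
    then show ?thesis unfolding eq split_rel_def using d by blast
  qed
  show "blk \<psi> c d" if "\<not> blk \<phi> a c" "blk \<phi> c d"
    using that ai sym trans unfolding eq split_rel_def by metis
qed

lemma agree_meet:
  assumes p: "leq n p N" and q: "leq n q N" and x: "leq n x p" and N: "\<And>a b. blk p a b \<Longrightarrow> blk q a b \<Longrightarrow> blk N a b"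
    and a: "agree w (pos n p) (pos n x)" "agree w (pos n q) (pos n x)"
  shows "agree w (pos n N) (pos n x)"
proof (rule ccontr)
  assume na: "\<not> agree w (pos n N) (pos n x)"
  note Nn = leq_NC2(2)[OF p] and xn = leq_NC2(1)[OF x]
  obtain t where t: "w \<le> t" "t \<in> {1..n}" "agree (Suc t) (pos n N) (pos n x)" "pos n N t \<noteq> pos n x t"
    using not_agree_greatest[OF Nn xn na] by metis
  have e: "pos n p t = pos n x t" "pos n q t = pos n x t" using a t unfolding agree_def by auto
  have "leq n x N" using leq_trans x p by blast
  then have lt: "pos n N t < pos n x t" using pos_antimono t agree_sym by (metis le_neq_implies_less)
  have "blk p (pos n N t) (pos n x t)" "blk q (pos n N t) (pos n x t)"
    using leq_pos[OF p t(2)] leq_pos[OF q t(2)] e same_block_sym by metis+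
  then have b: "blk N (pos n N t) (pos n x t)" using N by blast
  obtain s where s: "pos n N s = pos n x t" using pos_onto[OF Nn] by blast
  then have "t < s" using pos_sorted[OF Nn] b lt by metis
  then have "pos n x s = pos n x t" using t(3) s unfolding agree_def by auto
  then show False using pos_inj[OF xn] \<open>t < s\<close> by auto
qed

text \<open>The greatest value that moves can only go left, from \<phi> to \<psi> and from \<psi> to
  \<chi>; once gone it could not be back in \<chi>.\<close>

lemma agree_between:
  assumes 1: "leq n \<phi> \<psi>" and 2: "leq n \<psi> \<chi>" and a: "agree w (pos n \<chi>) (pos n \<phi>)"
  shows "agree w (pos n \<psi>) (pos n \<phi>)"
proof (rule ccontr)
  assume na: "\<not> agree w (pos n \<psi>) (pos n \<phi>)"
  obtain t where t: "w \<le> t" "agree (Suc t) (pos n \<psi>) (pos n \<phi>)" "pos n \<psi> t \<noteq> pos n \<phi> t"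
    using not_agree_greatest[OF leq_NC2(2,1)[OF 1] na] by metis
  have a': "agree (Suc t) (pos n \<chi>) (pos n \<phi>)" "pos n \<chi> t = pos n \<phi> t" using a t unfolding agree_def by auto
  have "pos n \<psi> t \<le> pos n \<phi> t" using pos_antimono[OF 1] t agree_sym by blast
  moreover have "pos n \<chi> t \<le> pos n \<psi> t"
    using pos_antimono[OF 2] agree_trans[OF t(2) agree_sym[OF a'(1)]] by blast
  ultimately show False using a' t by simp
qed

text \<open>The greatest value above \<open>w\<close> that moves from \<open>b\<close> to
  \<open>c\<close> would move left while \<open>d\<close> keeps it, and then \<open>d\<close> would
  come first. The same comparison at \<open>w\<close> itself gives the bound on its place.\<close>

lemma agree_of_not_pos_less:
  assumes l: "leq n b c" and a: "agree (Suc w) d (pos n b)" and nl: "\<not> pos_less d (pos n c)"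
  shows "agree (Suc w) (pos n c) (pos n b)" "d w \<le> pos n c w"
proof -
  show 1: "agree (Suc w) (pos n c) (pos n b)"
  proof (rule ccontr)
    assume na: "\<not> agree (Suc w) (pos n c) (pos n b)"
    obtain t where t: "Suc w \<le> t" "agree (Suc t) (pos n c) (pos n b)" "pos n c t \<noteq> pos n b t"
      using not_agree_greatest[OF leq_NC2(2,1)[OF l] na] by metis
    have "pos n c t < pos n b t" using pos_antimono[OF l] t agree_sym by (metis le_neq_implies_less)
    moreover have "d t = pos n b t" "agree (Suc t) d (pos n c)" using a t unfolding agree_def by auto
    ultimately show False using nl pos_lessI by metis
  qed
  show "d w \<le> pos n c w"
  proof (rule ccontr)
    assume "\<not> d w \<le> pos n c w"
    moreover have "agree (Suc w) d (pos n c)" using a 1 agree_sym agree_trans by blast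
    ultimately show False using nl pos_lessI by (metis not_le)
  qed
qed

text \<open>If the place of \<open>u\<close> in \<open>p\<close> were to the right of
  \<open>w\<close> in the block of \<open>r\<close>, then \<open>r\<close> would hold a value above
  \<open>w\<close> there, and so would \<open>p\<close>.\<close>

lemma pos_ge_of_blk:
  assumes r: "r \<in> NC2 n" and p: "p \<in> NC2 n" and a: "agree (Suc w) (pos n r) (pos n p)"
    and b: "blk r (pos n r w) (pos n p u)" and u: "u \<le> w"
  shows "pos n p u \<le> pos n r w"
proof (rule ccontr)
  assume c: "\<not> pos n p u \<le> pos n r w"
  obtain s where s: "pos n r s = pos n p u" using pos_onto[OF r] by blast
  then have "w < s" using pos_sorted[OF r] b c by (metis not_le)
  then have "pos n p s = pos n p u" using a s unfolding agree_def by auto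
  then show False using pos_inj[OF p] \<open>w < s\<close> u by auto
qed

section \<open>Chords and merging blocks\<close>

text \<open>The position of \<open>c\<close> and \<open>c'\<close> relative to the chord from
  \<open>a\<close> to \<open>a'\<close>. The ends count as outside, and for
  \<open>a' \<le> a\<close> the condition holds trivially.\<close>

definition same_side :: "nat \<Rightarrow> nat \<Rightarrow> nat \<Rightarrow> nat \<Rightarrow> bool" where
  "same_side a a' c c' \<longleftrightarrow> ((a < c \<and> c < a') \<longleftrightarrow> (a < c' \<and> c' < a'))"

lemma same_side_sym: "same_side a a' c d \<Longrightarrow> same_side a a' d c"
  and same_side_trans: "same_side a a' c d \<Longrightarrow> same_side a a' d e \<Longrightarrow> same_side a a' c e"
  unfolding same_side_def by auto

lemma nc_rel_same_side:
  assumes R: "nc_rel n R" and r: "R a a'" "R c c'" "\<not> R a c"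
  shows "same_side a a' c c'"
proof -
  note sym = nc_rel_sym[OF R] and trans = nc_rel_trans[OF R] and nc = nc_rel_nc[OF R]
  have *: "a < d' \<and> d' < a'" if d: "a < d" "d < a'" "R d d'" "\<not> R a d" for d d'
  proof -
    have "d' \<noteq> a" "d' \<noteq> a'" using d r sym trans by blast+
    moreover have "\<not> d' < a" using nc[of d' a d a'] d r sym trans by blast
    moreover have "\<not> d' > a'" using nc[of a d a' d'] d r by blast
    ultimately show ?thesis by linarith
  qed
  have "R c' c" "\<not> R a c'" using r sym trans by blast+
  then show ?thesis unfolding same_side_def using *[of c c'] *[of c' c] r by blast
qed

definition merge_rel :: "(nat \<Rightarrow> nat \<Rightarrow> bool) \<Rightarrow> nat \<Rightarrow> nat \<Rightarrow> nat \<Rightarrow> nat \<Rightarrow> bool" where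
  "merge_rel R b b' a c \<longleftrightarrow> R a c \<or> (R a b \<or> R a b') \<and> (R c b \<or> R c b')"

text \<open>Only chords of third blocks can cross the merged block. Outside the block of
  \<open>b\<close> in \<open>X\<close> they do not, because \<open>X\<close> is noncrossing; inside
  it, \<open>ss\<close> excludes them.\<close>

lemma nc_rel_merge:
  assumes R: "nc_rel n R" and X: "nc_rel n X" and sub: "\<And>a c. R a c \<Longrightarrow> X a c" and b: "X b b'"
    and ss: "\<And>a a'. X b a \<Longrightarrow> R a a' \<Longrightarrow> \<not> R a b \<Longrightarrow> \<not> R a b' \<Longrightarrow> same_side a a' b b'"
  shows "nc_rel n (merge_rel R b b')"
proof -
  note sym = nc_rel_sym[OF R] and trans = nc_rel_trans[OF R] and range = nc_rel_range[OF R]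
  note symX = nc_rel_sym[OF X] and transX = nc_rel_trans[OF X]
  let ?F = "\<lambda>a. R a b \<or> R a b'"
  have F: "?F c" if "?F a" "R a c" for a c using that sym trans by metis
  have FX: "X b a" if "?F a" for a using that sub b symX transX by metis
  have nss: "same_side a a' c d" if "R a a'" "\<not> ?F a" "?F c" "?F d" for a a' c d
  proof (cases "X b a")
    case True
    have bb: "same_side a a' b b'" using ss True that by blast
    have to_b: "same_side a a' e b" if "?F e" for e
      using that
    proof
      assume "R e b"
      moreover have "\<not> R a e" using \<open>\<not> ?F a\<close> \<open>R e b\<close> trans by blast
      ultimately show ?thesis using nc_rel_same_side[OF R \<open>R a a'\<close>] by blast
    next
      assume "R e b'"
      moreover have "\<not> R a e" using \<open>\<not> ?F a\<close> \<open>R e b'\<close> trans by blast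
      ultimately have "same_side a a' e b'" using nc_rel_same_side[OF R \<open>R a a'\<close>] by blast
      then show ?thesis using same_side_trans same_side_sym bb by blast
    qed
    show ?thesis using to_b[OF that(3)] to_b[OF that(4)] same_side_trans same_side_sym by blast
  next
    case False
    have "X c d" using FX[OF that(3)] FX[OF that(4)] symX transX by blast
    moreover have "\<not> X a c" using False FX[OF that(3)] symX transX by blast
    ultimately show ?thesis using nc_rel_same_side[OF X] sub[OF that(1)] by blast
  qed
  show ?thesis
    unfolding nc_rel_def
  proof (intro conjI allI impI)
    show "merge_rel R b b' a a \<longleftrightarrow> a \<in> {1..n}" for a
      unfolding merge_rel_def using nc_rel_refl[OF R] range by metis
    show "merge_rel R b b' a c \<Longrightarrow> merge_rel R b b' c a" for a c
      unfolding merge_rel_def using sym by blast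
    show "merge_rel R b b' a c \<Longrightarrow> merge_rel R b b' c d \<Longrightarrow> merge_rel R b b' a d" for a c d
      unfolding merge_rel_def using F trans sym by metis
    fix i j k l assume o: "i < j" "j < k" "k < l" and m: "merge_rel R b b' i k" "merge_rel R b b' j l"
    show "merge_rel R b b' i j"
    proof (rule ccontr)
      assume n: "\<not> merge_rel R b b' i j"
      then have nF: "\<not> (?F i \<and> ?F j)" and nR: "\<not> R i j" unfolding merge_rel_def by auto
      consider "R i k" "R j l" | "R i k" "\<not> ?F i" "?F j" "?F l" | "R j l" "\<not> ?F j" "?F i" "?F k"
        using m nF unfolding merge_rel_def by blast
      then show False
      proof cases
        case 1 then show False using nc_rel_nc[OF R] o nR by blast
      next
        case 2 then show False using nss[OF 2] o unfolding same_side_def by auto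
      next
        case 3 then show False using nss[OF 3] o unfolding same_side_def by auto
      qed
    qed
  qed
qed

section \<open>Finding a descent\<close>

text \<open>Since the finer element is the larger one, intersecting the relations produces the join
  of \<open>s\<close> and \<open>q\<close> among the elements below \<open>z\<close>.\<close>

lemma leq_meet:
  assumes s: "leq n s z" and q: "leq n q z"
  obtains N where "leq n N z" "\<And>a c. blk N a c \<longleftrightarrow> blk s a c \<and> blk q a c"
proof -
  note S = blk_nc_rel[OF leq_NC2(1)[OF s]] and Q = blk_nc_rel[OF leq_NC2(1)[OF q]]
  have R: "nc_rel n (\<lambda>a c. blk s a c \<and> blk q a c)"
  proof (rule nc_rel_refine[OF S, where E = "blk q"])
    show "blk q a a" if "a \<in> {1..n}" for a using nc_rel_refl[OF Q] that by blast
    show "blk q a1 a2" if "a1 < a2" "a2 < a3" "a3 < a4" "blk q a1 a3" "blk q a2 a4" for a1 a2 a3 a4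
      using nc_rel_nc[OF Q] that by blast
  qed (use nc_rel_sym[OF Q] nc_rel_trans[OF Q] in blast)+
  from leq_below[OF leq_NC2(2)[OF s] R] obtain N where "leq n N z" "blk N = (\<lambda>a c. blk s a c \<and> blk q a c)"
    using leq_blk[OF s] leq_blk[OF q] by blast
  then show thesis using that[of N] by simp
qed

lemma leq_merge:
  assumes x: "leq n x p2" and b: "blk x b b'"
    and ss: "\<And>a a'. blk x b a \<Longrightarrow> blk p2 a a' \<Longrightarrow> \<not> blk p2 a b \<Longrightarrow> \<not> blk p2 a b' \<Longrightarrow> same_side a a' b b'"
  obtains r where "leq n x r" "leq n r p2" "blk r = merge_rel (blk p2) b b'"
proof -
  note R = blk_nc_rel[OF leq_NC2(2)[OF x]] and X = blk_nc_rel[OF leq_NC2(1)[OF x]]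
  note sym = nc_rel_sym[OF X] and trans = nc_rel_trans[OF X]
  obtain r where r: "leq n r p2" "blk r = merge_rel (blk p2) b b'"
  proof (rule leq_below[OF leq_NC2(2)[OF x] nc_rel_merge[OF R X leq_blk[OF x] b ss]])
    show "blk p2 a c \<Longrightarrow> merge_rel (blk p2) b b' a c" for a c unfolding merge_rel_def by blast
  qed
  have "blk x a c" if "blk r a c" for a c
  proof -
    have in_b: "blk x a' b" if "blk p2 a' b \<or> blk p2 a' b'" for a'
      using that leq_blk[OF x] b sym trans by blast
    show ?thesis using that in_b leq_blk[OF x] sym trans unfolding r(2) merge_rel_def by blast
  qed
  then have "leq n x r" using leq_iff_blk[OF x r(1)] by blast
  then show thesis using that r by blast
qed

text \<open>One merge cannot undo two splits. If it did, \<open>i\<close>, \<open>j\<close> and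
  \<open>k\<close>, \<open>l\<close> would represent the same two blocks of \<open>p2\<close>; as
  \<open>k\<close> and \<open>l\<close> share a block of \<open>p\<close>, so would \<open>i\<close>
  and \<open>j\<close>.\<close>

lemma merge_ne:
  assumes c1: "cov n x p i j" and c2: "cov n p p2 k l" and r: "blk r = merge_rel (blk p2) b b'"
  shows "r \<noteq> x"
proof
  assume "r = x"
  have le: "leq n x p" "leq n p p2" using c1 c2 unfolding cov_def by blast+
  note P = blk_nc_rel[OF leq_NC2(1)[OF le(2)]] and P2 = blk_nc_rel[OF leq_NC2(2)[OF le(2)]]
    and X = blk_nc_rel[OF leq_NC2(1)[OF le(1)]]
  have ij: "blk x i j" "\<not> blk p i j" using c1 split_rel_left[OF X] unfolding cov_def by auto
  have kl: "blk p k l" "\<not> blk p2 k l" using c2 split_rel_left[OF P] unfolding cov_def by auto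
  have "merge_rel (blk p2) b b' i j" "merge_rel (blk p2) b b' k l"
    using ij kl leq_blk[OF le(1)] r \<open>r = x\<close> by auto
  moreover have "\<not> blk p2 i j" using ij leq_blk[OF le(2)] by blast
  ultimately have F: "blk p2 i b \<or> blk p2 i b'" "blk p2 j b \<or> blk p2 j b'" "blk p2 k b \<or> blk p2 k b'"
    "blk p2 l b \<or> blk p2 l b'"
    using kl(2) unfolding merge_rel_def by blast+
  note sym2 = nc_rel_sym[OF P2] and trans2 = nc_rel_trans[OF P2]
  have "blk p2 i k \<and> blk p2 j l \<or> blk p2 i l \<and> blk p2 j k"
    using F \<open>\<not> blk p2 i j\<close> kl(2) sym2 trans2 by metis
  then have "blk p i k \<and> blk p j l \<or> blk p i l \<and> blk p j k" using leq_blk[OF le(2)] by blast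
  then show False using ij(2) kl(1) nc_rel_sym[OF P] nc_rel_trans[OF P] by metis
qed

text \<open>The next place after that of \<open>w\<close> in the block of \<open>x\<close> is at
  most the old place of \<open>w\<close>. A value above \<open>w\<close> at this next place would
  stand there in \<open>x\<close> too, hence to the right of the old place of \<open>w\<close>. So
  the value \<open>u\<close> there is smaller than \<open>w\<close>, and as blocks of
  \<open>p\<close> are sorted, \<open>p\<close> separates the two places.\<close>

lemma adjacent_descent:
  assumes l: "leq n x p" and a: "agree (Suc w) (pos n p) (pos n x)" and ne: "pos n p w \<noteq> pos n x w"
  obtains u where "u < w" "pos n p w < pos n p u" "blk x (pos n p w) (pos n p u)"
    "\<And>c. blk x (pos n p w) c \<Longrightarrow> \<not> (pos n p w < c \<and> c < pos n p u)" "\<not> blk p (pos n p w) (pos n p u)" "w \<in> {1..n}"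
proof -
  note xn = leq_NC2(1)[OF l] and pn = leq_NC2(2)[OF l]
  note X = blk_nc_rel[OF xn]
  have w: "w \<in> {1..n}" using ne pos_outside xn pn by metis
  let ?b = "pos n p w"
  have lt: "?b < pos n x w" using pos_antimono[OF l] a ne agree_sym by (metis le_neq_implies_less)
  have bx: "blk x ?b (pos n x w)" using leq_pos[OF l w] nc_rel_sym[OF X] by blast
  define c where "c = (LEAST c. blk x ?b c \<and> ?b < c)"
  have c: "blk x ?b c" "?b < c" using LeastI[of "\<lambda>c. blk x ?b c \<and> ?b < c"] bx lt unfolding c_def by blast+
  have cle: "c \<le> d" if "blk x ?b d" "?b < d" for d
    using Least_le[of "\<lambda>c. blk x ?b c \<and> ?b < c" d] that unfolding c_def by blast
  obtain u where u: "pos n p u = c" using pos_onto[OF pn] by blast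
  have "u < w"
  proof (rule ccontr)
    assume "\<not> u < w"
    moreover have "u \<noteq> w" using u c by auto
    ultimately have wu: "w < u" by simp
    then have xu: "pos n x u = c" using a u unfolding agree_def by auto
    have "blk x (pos n x w) (pos n x u)" using bx c xu nc_rel_sym[OF X] nc_rel_trans[OF X] by metis
    then have "pos n x w < pos n x u" using pos_sorted[OF xn] wu by blast
    then show False using xu cle[OF bx lt] by simp
  qed
  moreover have "\<not> blk p ?b (pos n p u)" using pos_sorted[OF pn, of w u] u c \<open>u < w\<close> by auto
  moreover have "\<not> (?b < d \<and> d < pos n p u)" if "blk x ?b d" for d using cle[OF that] u by auto
  ultimately show thesis using that[of u] u c w by metis
qed

text \<open>No place of the block of \<open>x\<close> lies between the two neighbours, so no chord
  of a third block separates them. In the merged block the larger value \<open>w\<close> ends up at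
  the place of \<open>u\<close> or further right, which makes the code smaller than that of
  \<open>p\<close>.\<close>

lemma descent_if_unmoved:
  assumes c1: "cov n x p i j" and c2: "cov n p p2 k l"
    and a: "agree (Suc w) (pos n p) (pos n x)" and ne: "pos n p w \<noteq> pos n x w"
    and a2: "agree w (pos n p2) (pos n p)"
  shows "\<exists>r. leq n x r \<and> r \<noteq> x \<and> leq n r p2 \<and> pos_less (pos n r) (pos n p)"
proof -
  have le: "leq n x p" "leq n p p2" using c1 c2 unfolding cov_def by blast+
  have le2: "leq n x p2" using leq_trans le by blast
  note pn = leq_NC2(2)[OF le(1)] and p2n = leq_NC2(2)[OF le(2)] and X = blk_nc_rel[OF leq_NC2(1)[OF le(1)]]
  obtain u where u: "u < w" "pos n p w < pos n p u" "blk x (pos n p w) (pos n p u)"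
    "\<And>c. blk x (pos n p w) c \<Longrightarrow> \<not> (pos n p w < c \<and> c < pos n p u)" "\<not> blk p (pos n p w) (pos n p u)" "w \<in> {1..n}"
    using adjacent_descent[OF le(1) a ne] by metis
  let ?b = "pos n p w" and ?c = "pos n p u"
  obtain r where r: "leq n x r" "leq n r p2" "blk r = merge_rel (blk p2) ?b ?c"
  proof (rule leq_merge[OF le2 u(3)])
    fix d d' assume d: "blk x ?b d" "blk p2 d d'" "\<not> blk p2 d ?b" "\<not> blk p2 d ?c"
    have "blk x ?b d'" using d leq_blk[OF le2] nc_rel_trans[OF X] by blast
    moreover have "blk p2 d d"
      using nc_rel_range(1)[OF blk_nc_rel[OF p2n] d(2)] nc_rel_refl[OF blk_nc_rel[OF p2n]] by blast
    then have "d \<noteq> ?b" "d \<noteq> ?c" "d' \<noteq> ?b" "d' \<noteq> ?c" using d(2-4) by metis+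
    ultimately show "same_side d d' ?b ?c" unfolding same_side_def using u(2) u(4)[OF d(1)] u(4)[of d'] by auto
  qed
  note rn = leq_NC2(1)[OF r(2)]
  have a': "agree (Suc w) (pos n p2) (pos n x)" "pos n p2 w = ?b"
    using a a2 agree_trans agree_step[of w "pos n p2"] by blast+
  have ar: "agree (Suc w) (pos n r) (pos n x)" using agree_between[OF r(1,2) a'(1)] .
  have ar': "agree (Suc w) (pos n r) (pos n p)" using ar a agree_sym agree_trans by blast
  have "blk r (pos n r w) ?c"
  proof -
    have "?b \<in> {1..n}" "?c \<in> {1..n}" using nc_rel_range[OF X u(3)] by blast+
    then have "blk r ?b ?c" unfolding r(3) merge_rel_def using nc_rel_refl[OF blk_nc_rel[OF p2n]] by blast
    then show ?thesis using leq_pos[OF r(2) u(6)] a'(2) nc_rel_trans[OF blk_nc_rel[OF rn]] by metis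
  qed
  then have "?c \<le> pos n r w" using pos_ge_of_blk[OF rn pn ar'] u(1) by simp
  then have "pos_less (pos n r) (pos n p)" using pos_lessI[OF ar'] u(2) by simp
  then show ?thesis using r merge_ne[OF c1 c2 r(3)] by blast
qed

lemma descent_if_permutation_changes:
  assumes cp: "cov n x p i j" and cq: "cov n x q i' j'" and qp: "q \<noteq> p" and cp2: "cov n p p2 k l"
    and p2z: "leq n p2 z" and qz: "leq n q z" and q_first: "\<not> pos_less (pos n p) (pos n q)"
    and p2_min: "\<And>y. leq n p y \<Longrightarrow> y \<noteq> p \<Longrightarrow> leq n y z \<Longrightarrow> \<not> pos_less (pos n y) (pos n p2)"
    and change: "pos n p \<noteq> pos n x"
  shows "\<exists>r. leq n x r \<and> r \<noteq> x \<and> leq n r p2 \<and> pos_less (pos n r) (pos n p)"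
proof -
  have xp: "leq n x p" and xq: "leq n x q" and pp2: "leq n p p2" using cp cq cp2 unfolding cov_def by blast+
  have xp2: "leq n x p2" and pz: "leq n p z" and xz: "leq n x z"
    using xp pp2 p2z leq_trans by blast+
  note xn = leq_NC2(1)[OF xp] and pn = leq_NC2(2)[OF xp] and qn = leq_NC2(2)[OF xq]
    and p2n = leq_NC2(2)[OF pp2] and zn = leq_NC2(2)[OF p2z]
  note X = blk_nc_rel[OF xn] and P = blk_nc_rel[OF pn] and Q = blk_nc_rel[OF qn] and P2 = blk_nc_rel[OF p2n]
  note symX = nc_rel_sym[OF X] and transX = nc_rel_trans[OF X]
  note symP = nc_rel_sym[OF P] and transP = nc_rel_trans[OF P]
  note symQ = nc_rel_sym[OF Q] and transQ = nc_rel_trans[OF Q]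
  note symP2 = nc_rel_sym[OF P2] and transP2 = nc_rel_trans[OF P2]
  obtain w where w: "agree (Suc w) (pos n p) (pos n x)" "pos n p w \<noteq> pos n x w"
    using not_agree_greatest[OF pn xn, of 0] change agree_0 by metis
  obtain u where u: "u < w" "pos n p w < pos n p u" "blk x (pos n p w) (pos n p u)"
    "\<And>c. blk x (pos n p w) c \<Longrightarrow> \<not> (pos n p w < c \<and> c < pos n p u)" "\<not> blk p (pos n p w) (pos n p u)" "w \<in> {1..n}"
    using adjacent_descent[OF xp w] by metis
  define b b' where "b = pos n p w" and "b' = pos n p u"
  note u = u[folded b_def b'_def]
  \<comment> \<open>As \<open>p\<close> does not come before \<open>q\<close>, the values above
    \<open>w\<close> stay fixed in \<open>q\<close> too, and \<open>q\<close> moves \<open>w\<close>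
    no further left than \<open>p\<close> does.\<close>
  have aq: "agree (Suc w) (pos n q) (pos n x)" "b \<le> pos n q w"
    using agree_of_not_pos_less[OF xq w(1) q_first] unfolding b_def by blast+
  have aqp: "agree (Suc w) (pos n q) (pos n p)" using aq(1) w(1) agree_sym agree_trans by blast
  \<comment> \<open>The join \<open>N\<close> competes with \<open>p2\<close>: it lies above
    \<open>p\<close> and below \<open>z\<close>, and it differs from \<open>p\<close> by rank. Hence
    \<open>p2\<close> moves \<open>w\<close> no further left than \<open>N\<close>.\<close>
  obtain N where N: "leq n N z" "\<And>a c. blk N a c \<longleftrightarrow> blk p a c \<and> blk q a c" using leq_meet[OF pz qz] by metis
  have pN: "leq n p N" "leq n q N" using leq_iff_blk[OF pz N(1)] leq_iff_blk[OF qz N(1)] N(2) by auto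
  have Np: "N \<noteq> p"
  proof
    assume "N = p"
    then have "leq n q p" using pN by simp
    then show False using leq_card[OF _ qp] cov_card[OF cp] cov_card[OF cq] by simp
  qed
  have "agree (Suc w) (pos n N) (pos n x)" using agree_meet[OF pN xp _ w(1) aq(1)] N(2) by blast
  then have aN: "agree (Suc w) (pos n N) (pos n p)" using w(1) agree_sym agree_trans by blast
  have a2: "agree (Suc w) (pos n p2) (pos n p)" "pos n N w \<le> pos n p2 w"
    using agree_of_not_pos_less[OF pp2 aN p2_min[OF pN(1) Np N(1)]] by blast+
  show ?thesis
  proof (cases "pos n p2 w = b")
    case True
    then have "agree w (pos n p2) (pos n p)" using a2(1) agree_step b_def by blast
    then show ?thesis using descent_if_unmoved[OF cp cp2 w] by blast
  next
    case False
    \<comment> \<open>From here on \<open>b\<close> and \<open>b'\<close> represent the two parts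
      into which \<open>p\<close> splits a block of \<open>x\<close>, and \<open>b\<close> and
      \<open>c\<close> the two parts into which \<open>p2\<close> splits the first of these.\<close>
    define c where "c = pos n p2 w"
    have cb: "c < b" using False pos_antimono[OF pp2 agree_sym[OF a2(1)]] unfolding b_def c_def by simp
    have ncb: "\<not> blk p2 c b"
      using pos_ge_of_blk[OF p2n pn a2(1), of w] cb unfolding b_def c_def by auto
    have pbc: "blk p b c" using leq_pos[OF pp2 u(6)] unfolding b_def c_def .
    have nbc: "\<not> blk p2 b c" using ncb symP2 by blast
    have bb'2: "\<not> blk p2 b b'" using u(5) leq_blk[OF pp2] by blast
    have D_cases: "blk p2 a b \<or> blk p2 a c" if "blk p b a" for a
      using cov_two_blocks(1)[OF cp2 pbc nbc that] .
    have D_out: "blk p2 a d" if "\<not> blk p b a" "blk p a d" for a d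
      using cov_two_blocks(2)[OF cp2 pbc nbc that] .
    have B_cases: "blk p a b \<or> blk p a b'" if "blk x b a" for a
      using cov_two_blocks(1)[OF cp u(3,5) that] .
    have xbc: "blk x b c" using pbc leq_blk[OF xp] by blast
    have xcb': "blk x c b'" using xbc u(3) symX transX by blast
    \<comment> \<open>If no chord of a third block separates \<open>c\<close> from
      \<open>b'\<close>, merging their blocks brings \<open>w\<close> to \<open>b'\<close> or
      further right, beyond its place \<open>b\<close> in \<open>p\<close>.\<close>
    show ?thesis
    proof (cases "\<forall>a a'. blk x c a \<longrightarrow> blk p2 a a' \<longrightarrow> \<not> blk p2 a c \<longrightarrow> \<not> blk p2 a b' \<longrightarrow> same_side a a' c b'")
      case True
      obtain r where r: "leq n x r" "leq n r p2" "blk r = merge_rel (blk p2) c b'"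
        using leq_merge[OF xp2 xcb'] True by metis
      note rn = leq_NC2(1)[OF r(2)]
      have a2x: "agree (Suc w) (pos n p2) (pos n x)" using a2(1) w(1) agree_trans by blast
      have ar: "agree (Suc w) (pos n r) (pos n p)"
        using agree_between[OF r(1,2) a2x] w(1) agree_sym agree_trans by blast
      have "blk r (pos n r w) b'"
      proof -
        have "c \<in> {1..n}" "b' \<in> {1..n}" using nc_rel_range[OF X xcb'] by blast+
        then have "blk r c b'" unfolding r(3) merge_rel_def using nc_rel_refl[OF P2] by blast
        then show ?thesis using leq_pos[OF r(2) u(6)] nc_rel_trans[OF blk_nc_rel[OF rn]] unfolding c_def by metis
      qed
      then have "b' \<le> pos n r w" using pos_ge_of_blk[OF rn pn ar, of u] u(1) unfolding b'_def by simp
      then have "pos_less (pos n r) (pos n p)" using pos_lessI[OF ar] u(2) unfolding b_def by simp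
      then show ?thesis using r merge_ne[OF cp cp2 r(3)] by blast
    next
      case False
      then obtain a a' where aa: "blk x c a" "blk p2 a a'" "\<not> blk p2 a c" "\<not> blk p2 a b'" "\<not> same_side a a' c b'" by blast
      \<comment> \<open>The part represented by \<open>b'\<close> is left intact by
        \<open>p2\<close>, so a separating chord must come from the half of
        \<open>b\<close>.\<close>
      have a_b: "blk p2 a b"
      proof -
        have "blk x b a" using aa(1) xbc transX by blast
        moreover have "\<not> blk p a b'"
        proof
          assume ab': "blk p a b'"
          then have "\<not> blk p b a" using u(5) transP by blast
          then show False using D_out ab' aa(4) by blast
        qed
        ultimately have "blk p a b" using B_cases by blast
        then show ?thesis using D_cases aa(3) symP by blast
      qed
      \<comment> \<open>For every element below \<open>z\<close>, the place of \<open>w\<close> in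
        \<open>z\<close> marks the block that contains \<open>w\<close>. This reference place links
        \<open>p2\<close>, \<open>q\<close>, \<open>N\<close> and the elements built below.\<close>
      define c0 where "c0 = pos n z w"
      have cc0: "blk p2 c c0" using leq_pos[OF p2z u(6)] unfolding c_def c0_def .
      have pc0b: "blk p c0 b" using leq_blk[OF pp2 cc0] pbc symP transP by blast
      \<comment> \<open>Otherwise \<open>N\<close> would have \<open>w\<close> in the block of
        \<open>b\<close>, hence at \<open>b\<close> or further right, although its place in
        \<open>N\<close> is at most \<open>c\<close>.\<close>
      have nqb: "\<not> blk q c0 b"
      proof
        assume "blk q c0 b"
        then have "blk N c0 b" using N(2) pc0b by blast
        moreover have "blk N (pos n N w) c0" using leq_pos[OF N(1) u(6)] unfolding c0_def .
        ultimately have "blk N (pos n N w) (pos n p w)"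
          using nc_rel_trans[OF blk_nc_rel[OF leq_NC2(1)[OF N(1)]]] unfolding b_def by blast
        then have "b \<le> pos n N w" using pos_ge_of_blk[OF leq_NC2(1)[OF N(1)] pn aN, of w] unfolding b_def by simp
        then show False using a2(2) cb unfolding c_def by simp
      qed
      \<comment> \<open>In the block of \<open>b\<close> in \<open>p\<close>, a place to the right
        of \<open>b\<close> holds a value above \<open>w\<close>, which \<open>q\<close> keeps
        there. So the place \<open>d\<close> of \<open>w\<close> in \<open>q\<close> belongs to the
        part of \<open>b'\<close>.\<close>
      define d where "d = pos n q w"
      have qd: "blk q d c0" using leq_pos[OF qz u(6)] unfolding d_def c0_def .
      have "d \<noteq> b" using qd nqb symQ by blast
      then have bd: "b < d" using aq(2) unfolding d_def by simp
      have ndb: "\<not> blk p b d"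
      proof
        assume pbd: "blk p b d"
        obtain t where t: "pos n p t = d" using pos_onto[OF pn] by blast
        have "w < t" using pos_sorted[OF pn, of w t] pbd t bd unfolding b_def by simp
        then have "pos n q t = d" using aqp t unfolding agree_def by auto
        then show False using pos_inj[OF qn] \<open>w < t\<close> unfolding d_def by auto
      qed
      have xc0b: "blk x c0 b" using leq_blk[OF xp] pc0b by blast
      have "blk x b d" using leq_blk[OF xq] qd xc0b symX transX by blast
      then have "blk p d b'" using B_cases ndb symP by blast
      then have db': "blk p2 d b'" using D_out ndb by blast
      have Q_cases: "blk q e c0 \<or> blk q e b" if "blk p e b" for e
      proof -
        have "blk x c0 e" using that leq_blk[OF xp] xc0b symX transX by blast
        then show ?thesis using cov_two_blocks(1)[OF cq xc0b nqb] by blast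
      qed
      \<comment> \<open>Splits of the block of \<open>p\<close> containing \<open>b\<close> along a set \<open>S\<close> that is coarser than \<open>M\<close>.\<close>
      have refine: "\<exists>y. leq n y M \<and> leq n p y \<and> (\<forall>e f. blk y e f \<longleftrightarrow> blk p e f \<and> (blk p e b \<longrightarrow> (S e \<longleftrightarrow> S f)))"
        if M: "leq n p M" and SM: "\<And>e f. blk M e f \<Longrightarrow> S e \<longleftrightarrow> S f"
          and Snc: "\<And>e e' f f'. blk p e b \<Longrightarrow> blk p e' b \<Longrightarrow> blk p f b \<Longrightarrow> blk p f' b \<Longrightarrow>
            S e \<Longrightarrow> S e' \<Longrightarrow> \<not> S f \<Longrightarrow> \<not> S f' \<Longrightarrow> same_side e e' f f'" for S M
      proof -
        let ?R = "\<lambda>e f. blk p e f \<and> (blk p e b \<longrightarrow> (S e \<longleftrightarrow> S f))"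
        have R: "nc_rel n ?R"
        proof (rule nc_rel_refine[OF P, where E = "\<lambda>e f. blk p e b \<longrightarrow> (S e \<longleftrightarrow> S f)"])
          show "blk p f b \<longrightarrow> S f = S e" if "blk p e f" "blk p e b \<longrightarrow> S e = S f" for e f
            using that transP by blast
          show "blk p e b \<longrightarrow> S e = S g" if "blk p e f" "blk p f g" "blk p e b \<longrightarrow> S e = S f" "blk p f b \<longrightarrow> S f = S g" for e f g
            using that symP transP by blast
          fix e1 e2 e3 e4 assume o: "e1 < e2" "e2 < e3" "e3 < e4" and r: "blk p e1 e2" "blk p e2 e3" "blk p e3 e4"
            and S: "blk p e1 b \<longrightarrow> S e1 = S e3" "blk p e2 b \<longrightarrow> S e2 = S e4"
          show "blk p e1 b \<longrightarrow> S e1 = S e2"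
          proof
            assume e1: "blk p e1 b"
            have e2: "blk p e2 b" using r(1) e1 symP transP by blast
            have e3: "blk p e3 b" using r(2) e2 symP transP by blast
            have e4: "blk p e4 b" using r(3) e3 symP transP by blast
            have "\<not> same_side e1 e3 e2 e4" "\<not> same_side e2 e4 e3 e1" using o unfolding same_side_def by auto
            then show "S e1 = S e2" using Snc[OF e1 e3 e2 e4] Snc[OF e2 e4 e3 e1] S e1 e2 by blast
          qed
        qed auto
        have sub: "?R e f" if "blk M e f" for e f using leq_blk[OF M that] SM[OF that] by blast
        obtain y where y: "leq n y M" "blk y = ?R" using leq_below[OF leq_NC2(2)[OF M] R sub] .
        have "leq n p y" using leq_iff_blk[OF M y(1)] y(2) by simp
        then show ?thesis using y by (intro exI[of _ y]) simp
      qed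
      \<comment> \<open>\<open>y0\<close> splits the block of \<open>b\<close> in \<open>p\<close>
        by the block of \<open>c0\<close> in \<open>q\<close>. As it competes with
        \<open>p2\<close>, it has \<open>w\<close> at \<open>c\<close> or further left; by
        sortedness, the part containing \<open>w\<close> then has no place strictly between
        \<open>c\<close> and \<open>b\<close>.\<close>
      obtain y0 where y0: "leq n y0 N" "leq n p y0"
        "\<And>e f. blk y0 e f \<longleftrightarrow> blk p e f \<and> (blk p e b \<longrightarrow> (blk q e c0 \<longleftrightarrow> blk q f c0))"
      proof -
        have "\<exists>y. leq n y N \<and> leq n p y \<and> (\<forall>e f. blk y e f \<longleftrightarrow> blk p e f \<and> (blk p e b \<longrightarrow> (blk q e c0 \<longleftrightarrow> blk q f c0)))"
        proof (rule refine[OF pN(1)])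
          show "blk q e c0 = blk q f c0" if "blk N e f" for e f
            using that N(2) symQ transQ by blast
          fix e e' f f' assume "blk p e b" "blk p e' b" "blk p f b" "blk p f' b"
            "blk q e c0" "blk q e' c0" "\<not> blk q f c0" "\<not> blk q f' c0"
          then have "blk q e e'" "blk q f f'" "\<not> blk q e f" using Q_cases symQ transQ by blast+
          then show "same_side e e' f f'" using nc_rel_same_side[OF Q] by blast
        qed
        then show thesis using that by blast
      qed
      note y0n = leq_NC2(1)[OF y0(1)] and y0z = leq_trans[OF y0(1) N(1)]
      note Y0 = blk_nc_rel[OF y0n]
      have qc0: "blk q c0 c0" using nc_rel_refl[OF Q] nc_rel_range(1)[OF P pc0b] by blast
      have y0p: "y0 \<noteq> p"
      proof
        assume "y0 = p"
        then have "blk y0 c0 b" using pc0b by simp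
        then show False using y0(3) pc0b qc0 nqb symQ by blast
      qed
      have ay0: "agree (Suc w) (pos n y0) (pos n p)" using agree_between[OF y0(2,1) aN] .
      have y0c: "pos n y0 w \<le> c"
        using agree_of_not_pos_less(2)[OF pp2 ay0 p2_min[OF y0(2) y0p y0z]] unfolding c_def .
      have f_le: "f \<le> c" if f: "blk p f b" "blk q f c0" "f < b" for f
      proof -
        obtain t where t: "pos n p t = f" using pos_onto[OF pn] by blast
        have "t < w" using pos_sorted[OF pn, of t w] f(1,3) t unfolding b_def by simp
        have "blk y0 c0 f" using y0(3) pc0b f qc0 symP transP by blast
        then have "blk y0 (pos n y0 w) (pos n p t)"
          using leq_pos[OF y0z u(6)] nc_rel_trans[OF Y0] t unfolding c0_def by metis
        then have "f \<le> pos n y0 w" using pos_ge_of_blk[OF y0n pn ay0] \<open>t < w\<close> t by auto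
        then show ?thesis using y0c by simp
      qed
      \<comment> \<open>Splitting off \<open>?S\<close> leaves \<open>c0\<close> and \<open>b\<close> together, so \<open>w\<close> stays at \<open>b\<close>, against the choice of \<open>p2\<close>.\<close>
      let ?S = "\<lambda>e. blk p2 e b \<and> blk q e c0"
      \<comment> \<open>The delicate case has \<open>c\<close> and \<open>c0\<close> in one block of
        \<open>q\<close>. By \<open>f_le\<close>, the next place \<open>c'\<close> after
        \<open>c\<close> in the block of \<open>p\<close> then lies with \<open>b\<close> in
        \<open>q\<close>, so no chord of \<open>?S\<close> separates \<open>c'\<close> from
        \<open>b\<close>; and no chord with ends in the block of \<open>p\<close>, away from
        \<open>c\<close> and \<open>c'\<close>, separates these neighbours.\<close>
      have side_cb: "same_side e e' c b" if e: "?S e" "?S e'" for e e'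
      proof -
        have qee: "blk q e e'" "\<not> blk q e b" using e nqb symQ transQ by blast+
        show ?thesis
        proof (cases "blk q c c0")
          case False
          then have "blk q c b" using Q_cases pbc symP by blast
          moreover have "\<not> blk q e c" using calculation qee transQ by blast
          ultimately show ?thesis using nc_rel_same_side[OF Q qee(1)] by blast
        next
          case True
          define c' where "c' = (LEAST f. blk p b f \<and> c < f)"
          have "blk p b b" using nc_rel_refl[OF P] nc_rel_range(1)[OF P pbc] by blast
          then have c': "blk p b c'" "c < c'" and c'b: "c' \<le> b"
            using LeastI[of "\<lambda>f. blk p b f \<and> c < f" b] Least_le[of "\<lambda>f. blk p b f \<and> c < f" b] cb
            unfolding c'_def by blast+
          have c'_le: "c' \<le> f" if "blk p b f" "c < f" for f
            using Least_le[of "\<lambda>f. blk p b f \<and> c < f" f] that unfolding c'_def by blast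
          have "\<not> blk q c' c0"
          proof
            assume q: "blk q c' c0"
            then have "c' \<noteq> b" using nqb symQ by blast
            then show False using f_le[of c'] q c' c'b symP by auto
          qed
          then have qc': "blk q c' b" using Q_cases c'(1) symP by blast
          have s1: "same_side e e' c' b"
            using nc_rel_same_side[OF Q qee(1) qc'] qee qc' transQ by blast
          have pe: "blk p b e" "blk p b e'" using e leq_blk[OF pp2] symP by blast+
          have ne: "e \<noteq> c" "e' \<noteq> c" "e \<noteq> c'" "e' \<noteq> c'" using e ncb \<open>\<not> blk q c' c0\<close> by auto
          have "same_side e e' c c'"
            unfolding same_side_def using c'_le[OF pe(1)] c'_le[OF pe(2)] ne c'(2) by linarith
          then show ?thesis using s1 same_side_trans by blast
        qed
      qed
      have side: "same_side e e' c f" if e: "?S e" "?S e'" and f: "blk p f b" "\<not> ?S f" for e e' f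
      proof -
        have qee: "blk q e e'" "\<not> blk q e b" using e nqb symQ transQ by blast+
        have p2ee: "blk p2 e e'" "\<not> blk p2 e c" using e nbc symP2 transP2 by blast+
        show ?thesis
        proof (cases "blk p2 f b")
          case True
          then have qf: "blk q f b" using Q_cases f by blast
          have "\<not> blk q e f" using qf qee transQ by blast
          then have "same_side e e' f b" using nc_rel_same_side[OF Q qee(1) qf] by blast
          then show ?thesis using side_cb[OF e] same_side_trans same_side_sym by blast
        next
          case False
          then have "blk p2 f c" using D_cases f(1) symP by blast
          then have "blk p2 c f" using symP2 by blast
          then show ?thesis using nc_rel_same_side[OF P2 p2ee(1) _ p2ee(2)] by blast
        qed
      qed
      obtain N2 where N2: "leq n N2 z" "\<And>a c. blk N2 a c \<longleftrightarrow> blk p2 a c \<and> blk q a c" using leq_meet[OF p2z qz] by metis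
      have p2N2: "leq n p2 N2" "leq n q N2"
        using leq_iff_blk[OF p2z N2(1)] leq_iff_blk[OF qz N2(1)] N2(2) by auto
      have pN2: "leq n p N2" using leq_trans pp2 p2N2 by blast
      have "agree (Suc w) (pos n N2) (pos n x)"
        using agree_meet[OF p2N2 xp2 _ agree_trans[OF a2(1) w(1)] aq(1)] N2(2) by blast
      then have aN2: "agree (Suc w) (pos n N2) (pos n p)" using w(1) agree_sym agree_trans by blast
      obtain y1 where y1: "leq n y1 N2" "leq n p y1"
        "\<And>e f. blk y1 e f \<longleftrightarrow> blk p e f \<and> (blk p e b \<longrightarrow> (?S e \<longleftrightarrow> ?S f))"
      proof -
        have "\<exists>y. leq n y N2 \<and> leq n p y \<and> (\<forall>e f. blk y e f \<longleftrightarrow> blk p e f \<and> (blk p e b \<longrightarrow> (?S e \<longleftrightarrow> ?S f)))"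
        proof (rule refine[OF pN2])
          show "?S e = ?S f" if "blk N2 e f" for e f
            using that N2(2) symQ transQ symP2 transP2 by metis
          show "same_side e e' f f'" if "blk p e b" "blk p e' b" "blk p f b" "blk p f' b"
            "?S e" "?S e'" "\<not> ?S f" "\<not> ?S f'" for e e' f f'
            using side[OF that(5,6,3,7)] side[OF that(5,6,4,8)] same_side_trans same_side_sym by blast
        qed
        then show thesis using that by blast
      qed
      note y1n = leq_NC2(1)[OF y1(1)] and y1z = leq_trans[OF y1(1) N2(1)]
      note Y1 = blk_nc_rel[OF y1n]
      \<comment> \<open>If \<open>?S\<close> contained neither end of the chord from
        \<open>a\<close> to \<open>a'\<close>, both would lie in the block of \<open>b\<close> in
        \<open>q\<close>. Then neither the pair \<open>c\<close>, \<open>c0\<close>, nor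
        \<open>c0\<close>, \<open>d\<close>, nor \<open>d\<close>, \<open>b'\<close> would be
        separated by the chord, although \<open>c\<close> and \<open>b'\<close> are.\<close>
      obtain s where s: "?S s"
      proof (cases "?S a \<or> ?S a'")
        case True then show thesis using that by blast
      next
        case False
        have a'_b: "blk p2 a' b" using a_b aa(2) symP2 transP2 by blast
        have q: "blk q a b" "blk q a' b"
          using False a_b a'_b Q_cases leq_blk[OF pp2] by blast+
        have qaa: "blk q a a'" "\<not> blk q a c0" using q nqb symQ transQ by blast+
        have "same_side a a' c0 d" using nc_rel_same_side[OF Q qaa(1) _ qaa(2)] qd symQ by blast
        moreover have "same_side a a' c c0" using nc_rel_same_side[OF P2 aa(2) cc0 aa(3)] .
        moreover have "same_side a a' d b'"
          using nc_rel_same_side[OF P2 aa(2) db'] aa(4) db' transP2 by blast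
        ultimately have "same_side a a' c b'" using same_side_trans by blast
        then show thesis using aa(5) by blast
      qed
      have nSb: "\<not> ?S b" using nqb symQ by blast
      have y1p: "y1 \<noteq> p"
      proof
        assume "y1 = p"
        moreover have "blk p s b" using s leq_blk[OF pp2] by blast
        ultimately have "blk y1 s b" "blk p s b" by simp_all
        then show False using y1(3) s nSb by blast
      qed
      have ay1: "agree (Suc w) (pos n y1) (pos n p)" using agree_between[OF y1(2,1) aN2] .
      have "\<not> ?S c0" using cc0 ncb transP2 by blast
      then have "blk y1 c0 b" using y1(3) pc0b nSb by blast
      then have "blk y1 (pos n y1 w) (pos n p w)"
        using leq_pos[OF y1z u(6)] nc_rel_trans[OF Y1] unfolding c0_def b_def by blast
      then have "b \<le> pos n y1 w" using pos_ge_of_blk[OF y1n pn ay1, of w] unfolding b_def by simp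
      moreover have "pos n y1 w \<le> c"
        using agree_of_not_pos_less(2)[OF pp2 ay1 p2_min[OF y1(2) y1p y1z]] unfolding c_def .
      ultimately show ?thesis using cb by simp
    qed
  qed
qed

text \<open>The join \<open>N\<close> of \<open>p\<close> and \<open>q\<close> has the permutation
  of \<open>x\<close>, hence so has everything between \<open>x\<close> and \<open>N\<close>. Codes
  drop out, and a question about the intervals that define the splits remains.\<close>

lemma descent_if_permutation_constant:
  assumes cp: "cov n x p i j" and cq: "cov n x q i' j'" and q_first: "i' < i \<or> i' = i \<and> j' < j"
    and cp2: "cov n p p2 k l" and p2z: "leq n p2 z" and qz: "leq n q z"
    and pos_p: "pos n p = pos n x" and pos_q: "pos n q = pos n x"
    and p2_min: "\<And>y. leq n p y \<Longrightarrow> y \<noteq> p \<Longrightarrow> leq n y z \<Longrightarrow> \<not> pos_less (pos n y) (pos n p2)"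
    and p2_label: "\<And>y a b. cov n p y a b \<Longrightarrow> leq n y z \<Longrightarrow> pos n y = pos n p2 \<Longrightarrow> \<not> (a < k \<or> a = k \<and> b < l)"
  shows "\<exists>r a b. cov n x r a b \<and> leq n r p2 \<and> pos n r = pos n p \<and> (a < i \<or> a = i \<and> b < j)"
proof -
  have xp: "leq n x p" and xq: "leq n x q" and pp2: "leq n p p2" using cp cq cp2 unfolding cov_def by blast+
  have xp2: "leq n x p2" and pz: "leq n p z" and xz: "leq n x z"
    using xp pp2 p2z leq_trans by blast+
  note X = blk_nc_rel[OF leq_NC2(1)[OF xp]] and P = blk_nc_rel[OF leq_NC2(2)[OF xp]]
  note sym = nc_rel_sym[OF X] and trans = nc_rel_trans[OF X]
  have ij: "i < j" "blk x i j" and bp: "blk p = split_rel (blk x) i j" using cp unfolding cov_def by auto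
  have ij': "i' < j'" "blk x i' j'" and bq: "blk q = split_rel (blk x) i' j'" using cq unfolding cov_def by auto
  have kl: "k < l" "blk p k l" and bp2: "blk p2 = split_rel (blk p) k l" using cp2 unfolding cov_def by auto
  obtain N where N: "leq n N z" "\<And>a c. blk N a c \<longleftrightarrow> blk p a c \<and> blk q a c" using leq_meet[OF pz qz] by metis
  have pN: "leq n p N" "leq n q N" using leq_iff_blk[OF pz N(1)] leq_iff_blk[OF qz N(1)] N(2) by auto
  have "agree 0 (pos n N) (pos n x)" by (rule agree_meet[OF pN xp]) (use N(2) pos_p pos_q agree_0 in auto)
  then have pos_N: "pos n N = pos n p" using agree_0 pos_p by metis
  have blk_iff: "blk x a e \<longleftrightarrow> blk x c e" if "blk x a c" for a c e using that sym trans by metis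
  \<comment> \<open>The pair \<open>(f, g)\<close> labels a split of \<open>p\<close> that separates
    only points separated by \<open>N\<close>. It is \<open>(i', j')\<close> unless \<open>p\<close>
    separates \<open>i'\<close> from \<open>j'\<close>; in that case \<open>[i', j')\<close> either
    cuts \<open>[i, j)\<close> at \<open>j'\<close>, giving \<open>(i, j')\<close>, or ends at
    \<open>i\<close>, giving \<open>(i', j)\<close>.\<close>
  obtain f g where fg: "f < g" "blk p f g" "f < i \<or> f = i \<and> g < j"
    and sub: "\<And>a c. blk N a c \<Longrightarrow> split_rel (blk p) f g a c"
  proof (cases "blk x i i'")
    case False
    have ni: "\<not> blk x i' i" "\<not> blk x j' i" using False ij'(2) sym trans by metis+
    show thesis
    proof (rule that[of i' j'])
      show "i' < j'" "i' < i \<or> i' = i \<and> j' < j" by fact+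
      show "blk p i' j'" unfolding bp split_rel_def using ij' ni by blast
      show "split_rel (blk p) i' j' a c" if "blk N a c" for a c
        using that unfolding N(2) bq by (auto simp: split_rel_def bp)
    qed
  next
    case True
    then have i'i: "blk x i' i" "blk x j' i" "blk x j i" "blk x i i"
      using ij(2) ij'(2) sym trans by metis+
    have N_D: "blk x a c" "blk x a i \<Longrightarrow> (i \<le> a \<and> a < j) = (i \<le> c \<and> c < j)"
      "blk x a i \<Longrightarrow> (i' \<le> a \<and> a < j') = (i' \<le> c \<and> c < j')" if "blk N a c" for a c
    proof -
      have "blk x a i' \<longleftrightarrow> blk x a i" using True sym trans by metis
      then show "blk x a c" "blk x a i \<Longrightarrow> (i \<le> a \<and> a < j) = (i \<le> c \<and> c < j)"
      "blk x a i \<Longrightarrow> (i' \<le> a \<and> a < j') = (i' \<le> c \<and> c < j')"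
        using that unfolding N(2) bp bq split_rel_def by auto
    qed
    have blk_p: "blk p a c" if "blk x a i" "blk x c i" "(i \<le> a \<and> a < j) = (i \<le> c \<and> c < j)" for a c
      unfolding bp split_rel_def using that sym trans by metis
    have sub: "split_rel (blk p) f g a c" if Nac: "blk N a c" and fi: "blk x f i"
      and arith: "\<And>a c. (i \<le> a \<and> a < j) = (i \<le> c \<and> c < j) \<Longrightarrow> (i' \<le> a \<and> a < j') = (i' \<le> c \<and> c < j') \<Longrightarrow>
         (i \<le> a \<and> a < j) = (i \<le> f \<and> f < j) \<Longrightarrow> (f \<le> a \<and> a < g) = (f \<le> c \<and> c < g)" for a c f g
    proof -
      have "(f \<le> a \<and> a < g) = (f \<le> c \<and> c < g)" if paf: "blk p a f"
      proof -
        have "blk x a f" "blk x a i \<longrightarrow> (i \<le> a \<and> a < j) = (i \<le> f \<and> f < j)" using paf unfolding bp split_rel_def by auto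
        moreover have "blk x a i" using calculation(1) fi trans by blast
        ultimately show ?thesis using N_D[OF Nac] arith by blast
      qed
      then show ?thesis unfolding split_rel_def using N(2) Nac by blast
    qed
    consider "i' \<le> i" "i < j'" "j' < j" | "i' < i" "j' = i" | "i' < i" "j' < i \<or> j \<le> j'"
      using q_first ij'(1) ij(1) by linarith
    then show thesis
    proof cases
      case 1
      show thesis
      proof (rule that[of i j'])
        show "i < j'" "i < i \<or> i = i \<and> j' < j" using 1 by auto
        show "blk p i j'" using blk_p i'i 1 ij by auto
        show "split_rel (blk p) i j' a c" if "blk N a c" for a c
          by (rule sub[OF that]) (use i'i 1 in auto)
      qed
    next
      case 2
      show thesis
      proof (rule that[of i' j])
        show "i' < j" "i' < i \<or> i' = i \<and> j < j" using 2 ij by auto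
        show "blk p i' j" using blk_p i'i 2 ij by auto
        show "split_rel (blk p) i' j a c" if "blk N a c" for a c
          by (rule sub[OF that]) (use i'i 2 ij in auto)
      qed
    next
      case 3
      show thesis
      proof (rule that[of i' j'])
        show "i' < j'" "i' < i \<or> i' = i \<and> j' < j" using 3 ij' by auto
        show "blk p i' j'" using blk_p i'i 3 ij by auto
        show "split_rel (blk p) i' j' a c" if "blk N a c" for a c
          by (rule sub[OF that]) (use i'i 3 in auto)
      qed
    qed
  qed
  obtain y where y: "leq n y N" "blk y = split_rel (blk p) f g"
    using leq_below[OF leq_NC2(2)[OF pN(1)] nc_rel_split[OF P] sub] .
  have yz: "leq n y z" using leq_trans y N by blast
  have py: "leq n p y" using leq_iff_blk[OF pN(1) y(1)] y(2) unfolding split_rel_def by simp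
  have cy: "cov n p y f g" unfolding cov_def using py fg y by blast
  have "y \<noteq> p" using cov_card[OF cy] by auto
  have pos_y: "pos n y = pos n p" using agree_between[OF py y(1), of 0] pos_N agree_0 by metis
  \<comment> \<open>A change of permutation would make the code of \<open>p2\<close> larger than
    that of \<open>y\<close>, which keeps the permutation of \<open>p\<close>.\<close>
  have pos_p2: "pos n p2 = pos n p"
    using p2_min[OF py \<open>y \<noteq> p\<close> yz] leq_pos_less[OF pp2] pos_y by metis
  have kl_ij: "k < i \<or> k = i \<and> l < j" using p2_label[OF cy yz] pos_y pos_p2 fg(3) by fastforce
  have xkl: "blk x k l" using leq_blk[OF xp kl(2)] .
  \<comment> \<open>Because \<open>(k, l)\<close> precedes \<open>(i, j)\<close>, a part of the
    split block that does not contain \<open>k\<close> lies entirely inside or entirely outside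
    \<open>[k, l)\<close>. So splitting the larger block of \<open>x\<close> at
    \<open>(k, l)\<close> separates no points that \<open>p2\<close> joins.\<close>
  have sub2: "split_rel (blk x) k l a c" if "blk p2 a c" for a c
  proof -
    have pac: "blk p a c" and s: "blk p a k \<Longrightarrow> (k \<le> a \<and> a < l) = (k \<le> c \<and> c < l)"
      using that unfolding bp2 split_rel_def by auto
    have xac: "blk x a c" and t: "blk x a i \<Longrightarrow> (i \<le> a \<and> a < j) = (i \<le> c \<and> c < j)"
      using pac unfolding bp split_rel_def by auto
    have "(k \<le> a \<and> a < l) = (k \<le> c \<and> c < l)" if ak: "blk x a k"
    proof (cases "blk x k i")
      case False
      then have "blk p a k" unfolding bp split_rel_def using ak sym trans by metis
      then show ?thesis using s by blast
    next
      case True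
      have ai: "blk x a i" using ak True trans by blast
      have kl_side: "(i \<le> k \<and> k < j) = (i \<le> l \<and> l < j)" using kl(2) True unfolding bp split_rel_def by blast
      show ?thesis
      proof (cases "blk p a k")
        case pak: False
        then have "(i \<le> a \<and> a < j) \<noteq> (i \<le> k \<and> k < j)" unfolding bp split_rel_def using ak ai by blast
        then show ?thesis using t[OF ai] kl_side kl_ij kl(1) by linarith
      qed (use s in blast)
    qed
    then show ?thesis unfolding split_rel_def using xac by blast
  qed
  obtain r where r: "leq n r p2" "blk r = split_rel (blk x) k l"
    using leq_below[OF leq_NC2(2)[OF xp2] nc_rel_split[OF X] sub2] .
  have xr: "leq n x r" using leq_iff_blk[OF xp2 r(1)] r(2) unfolding split_rel_def by simp
  have "cov n x r k l" unfolding cov_def using xr kl(1) xkl r(2) by blast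
  moreover have "pos n r = pos n p" using agree_between[OF xr r(1), of 0] pos_p2 pos_p agree_0 by metis
  ultimately show ?thesis using r(1) kl_ij by blast
qed

section \<open>The shelling\<close>

text \<open>A permutation increasing on the blocks of \<phi> is increasing on smaller blocks, so it
  can be kept under any refinement.\<close>

lemma leq_same_pos:
  assumes \<phi>: "\<phi> \<in> NC2 n" and R: "nc_rel n R" and sub: "\<And>a b. R a b \<Longrightarrow> blk \<phi> a b"
  obtains \<psi> where "leq n \<phi> \<psi>" "blk \<psi> = R" "pos n \<psi> = pos n \<phi>"
proof -
  note s = nc2_perm_permutes[OF \<phi>]
  have mono: "nc2_perm n \<phi> a < nc2_perm n \<phi> b" if "R a b" "a < b" for a b
    using pos_sorted[OF \<phi>, of "nc2_perm n \<phi> a" "nc2_perm n \<phi> b"] sub that by (simp add: pos_perm[OF \<phi>])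
  obtain \<psi> where \<psi>: "\<psi> \<in> NC2 n" "blk \<psi> = R" "nc2_perm n \<psi> = nc2_perm n \<phi>"
    using NC2_construct[OF R s] mono by metis
  then have pos: "pos n \<psi> = pos n \<phi>" unfolding pos_def by simp
  have "leq n \<phi> \<psi>"
    by (rule leqI) (use \<phi> \<psi> sub pos pos_range[OF \<phi>] nc_rel_refl[OF blk_nc_rel[OF \<phi>]] in auto)
  then show thesis using that \<psi> pos by blast
qed

lemma nc_rel_discrete: "nc_rel n (\<lambda>a b. a = b \<and> a \<in> {1..n})"
  unfolding nc_rel_def by auto

lemma discrete_above:
  assumes "\<phi> \<in> NC2 n"
  obtains \<psi> where "leq n \<phi> \<psi>" "blk \<psi> = (\<lambda>a b. a = b \<and> a \<in> {1..n})" "pos n \<psi> = pos n \<phi>"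
proof -
  have "blk \<phi> a b" if "a = b \<and> a \<in> {1..n}" for a b
    using that nc_rel_refl[OF blk_nc_rel[OF assms]] by blast
  with leq_same_pos[OF assms nc_rel_discrete] show thesis using that by blast
qed

lemma discrete_card:
  assumes \<phi>: "\<phi> \<in> NC2 n" and b: "blk \<phi> = (\<lambda>a b. a = b \<and> a \<in> {1..n})"
  shows "card (fst \<phi>) = n"
proof -
  have "same_block ((\<lambda>x. {x}) ` {1..n}) = blk \<phi>" unfolding b same_block_def by (intro ext) auto
  then have "fst \<phi> = (\<lambda>x. {x}) ` {1..n}"
    using partition_eqI[OF NC_partition[OF NC2_fst[OF \<phi>]] partition_on_singletons[of "{1..n}"]] by simp
  moreover have "inj_on (\<lambda>x. {x}) {1..n}" by (rule inj_onI) simp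
  ultimately show ?thesis by (simp add: card_image)
qed

lemma NC2_card_le: assumes "\<phi> \<in> NC2 n" shows "card (fst \<phi>) \<le> n"
proof -
  obtain \<psi> where \<psi>: "leq n \<phi> \<psi>" "blk \<psi> = (\<lambda>a b. a = b \<and> a \<in> {1..n})" using discrete_above[OF assms] .
  show ?thesis using leq_card[OF \<psi>(1)] discrete_card[OF leq_NC2(2)[OF \<psi>(1)] \<psi>(2)] by (cases "\<phi> = \<psi>") auto
qed

lemma finite_NC2: "finite (NC2 n)"
proof (rule finite_imageD)
  let ?f = "\<lambda>\<phi>. (fst \<phi>, pos n \<phi>)"
  show "finite (?f ` NC2 n)"
  proof (rule finite_subset)
    show "?f ` NC2 n \<subseteq> Pow (Pow {1..n}) \<times> {p. p permutes {1..n}}"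
      using pos_permutes NC_partition[OF NC2_fst] unfolding partition_on_def by fastforce
    show "finite (Pow (Pow {1..n}) \<times> {p. p permutes {1..n}})" by (simp add: finite_permutations)
  qed
  show "inj_on ?f (NC2 n)" 
  proof (rule inj_onI)
    fix \<phi> \<psi> assume "\<phi> \<in> NC2 n" "\<psi> \<in> NC2 n" "?f \<phi> = ?f \<psi>"
    then show "\<phi> = \<psi>" using NC2_eqI[of \<phi> n \<psi>] by simp
  qed
qed

lemma NC2_bottom: "\<exists>\<beta>\<in>NC2 n. \<forall>\<phi>\<in>NC2 n. leq n \<beta> \<phi>"
proof -
  have R: "nc_rel n (\<lambda>a b. a \<in> {1..n} \<and> b \<in> {1..n})" unfolding nc_rel_def by blast
  obtain \<beta> where \<beta>: "\<beta> \<in> NC2 n" "blk \<beta> = (\<lambda>a b. a \<in> {1..n} \<and> b \<in> {1..n})"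
    using NC2_construct[OF R permutes_id] by metis
  have "leq n \<beta> \<phi>" if \<phi>: "\<phi> \<in> NC2 n" for \<phi>
    by (rule leqI) (use \<beta> \<phi> pos_range nc_rel_range[OF blk_nc_rel[OF \<phi>]] in auto)
  then show ?thesis using \<beta> by blast
qed

section \<open>The poset with adjoined maximum and the order on its covers\<close>

lemma hat_le_Elem:
  "\<phi> \<in> NC2 n \<Longrightarrow> \<psi> \<in> NC2 n \<Longrightarrow> hat_le n (Elem \<phi>) (Elem \<psi>) \<longleftrightarrow> leq n \<phi> \<psi>"
  unfolding leq_def by simp

lemma in_NC2_hat: "x \<in> NC2_hat n \<longleftrightarrow> x = Hat_one \<or> (\<exists>\<phi>\<in>NC2 n. x = Elem \<phi>)"
  unfolding NC2_hat_def by auto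

lemma hat_le_poset: "poset_on (NC2_hat n) (hat_le n)"
  unfolding poset_on_def
proof (intro conjI reflp_onI antisymp_onI transp_onI)
  fix x assume "x \<in> NC2_hat n"
  then show "hat_le n x x" using in_NC2_hat hat_le_Elem leq_refl hat_le.simps(1) by metis
next
  fix x y assume "x \<in> NC2_hat n" "y \<in> NC2_hat n" "hat_le n x y" "hat_le n y x"
  then show "x = y" using hat_le_Elem leq_antisym by (cases x; cases y) (auto simp: in_NC2_hat leq_def)
next
  fix x y z assume "x \<in> NC2_hat n" "y \<in> NC2_hat n" "z \<in> NC2_hat n" "hat_le n x y" "hat_le n y z"
  then show "hat_le n x z" using leq_trans by (cases x; cases y; cases z) (auto simp: in_NC2_hat leq_def)
qed

lemma upper_covers_Elem:
  "Elem \<psi> \<in> upper_covers (NC2_hat n) (hat_le n) (Elem \<phi>) \<longleftrightarrow> (\<exists>i j. cov n \<phi> \<psi> i j)"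
proof
  assume u: "Elem \<psi> \<in> upper_covers (NC2_hat n) (hat_le n) (Elem \<phi>)"
  then have in': "\<phi> \<in> NC2 n" "\<psi> \<in> NC2 n" unfolding upper_covers_def in_NC2_hat by auto
  have le: "leq n \<phi> \<psi>" "\<phi> \<noteq> \<psi>"
    using u hat_le_Elem[OF in'] unfolding upper_covers_def strict_of_def by auto
  obtain \<chi> i j where \<chi>: "cov n \<phi> \<chi> i j" "leq n \<chi> \<psi>" using cov_exists[OF le] by blast
  have \<chi>n: "\<chi> \<in> NC2 n" "leq n \<phi> \<chi>" "\<chi> \<noteq> \<phi>"
    using leq_NC2(1)[OF \<chi>(2)] \<chi>(1) cov_card[OF \<chi>(1)] unfolding cov_def by auto
  have "\<chi> = \<psi>"
  proof (rule ccontr)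
    assume "\<chi> \<noteq> \<psi>"
    then have "strict_of (hat_le n) (Elem \<phi>) (Elem \<chi>)" "strict_of (hat_le n) (Elem \<chi>) (Elem \<psi>)" "Elem \<chi> \<in> NC2_hat n"
      using \<chi>(2) \<chi>n in' unfolding strict_of_def in_NC2_hat leq_def by auto
    then show False using u unfolding upper_covers_def by blast
  qed
  then show "\<exists>i j. cov n \<phi> \<psi> i j" using \<chi> by blast
next
  assume "\<exists>i j. cov n \<phi> \<psi> i j"
  then obtain i j where c: "cov n \<phi> \<psi> i j" by blast
  then have le: "leq n \<phi> \<psi>" and cd: "card (fst \<psi>) = Suc (card (fst \<phi>))" using cov_card unfolding cov_def by blast+
  note in' = leq_NC2[OF le]
  have "\<not> (strict_of (hat_le n) (Elem \<phi>) z \<and> strict_of (hat_le n) z (Elem \<psi>))" if "z \<in> NC2_hat n" for z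
  proof (cases z)
    case (Elem \<chi>)
    then have "\<chi> \<in> NC2 n" using that unfolding in_NC2_hat by auto
    then have "\<not> (leq n \<phi> \<chi> \<and> \<phi> \<noteq> \<chi> \<and> leq n \<chi> \<psi> \<and> \<chi> \<noteq> \<psi>)"
      using leq_card[of n \<phi> \<chi>] leq_card[of n \<chi> \<psi>] cd by linarith
    then show ?thesis using hat_le_Elem in' \<open>\<chi> \<in> NC2 n\<close> unfolding strict_of_def Elem by blast
  qed (simp add: strict_of_def)
  moreover have "strict_of (hat_le n) (Elem \<phi>) (Elem \<psi>)"
    using le cd unfolding strict_of_def leq_def by auto
  ultimately show "Elem \<psi> \<in> upper_covers (NC2_hat n) (hat_le n) (Elem \<phi>)"
    unfolding upper_covers_def using in' in_NC2_hat by blast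
qed

text \<open>An element covered by \<open>Hat_one\<close> is maximal in \<open>NC2 n\<close>, while
  the partition into singletons with the same permutation lies above it.\<close>

lemma upper_covers_Hat_one:
  assumes u: "Hat_one \<in> upper_covers (NC2_hat n) (hat_le n) (Elem \<phi>)"
  shows "\<phi> \<in> NC2 n" "card (fst \<phi>) = n" "\<not> cov n \<phi> \<psi> i j"
proof -
  show \<phi>: "\<phi> \<in> NC2 n" using u unfolding upper_covers_def in_NC2_hat by auto
  have max: "\<psi> = \<phi>" if "leq n \<phi> \<psi>" for \<psi>
  proof (rule ccontr)
    assume "\<psi> \<noteq> \<phi>"
    then have "Elem \<psi> \<in> NC2_hat n" "strict_of (hat_le n) (Elem \<phi>) (Elem \<psi>)" "strict_of (hat_le n) (Elem \<psi>) Hat_one"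
      using that unfolding in_NC2_hat leq_def strict_of_def by auto
    then show False using u unfolding upper_covers_def by blast
  qed
  show "card (fst \<phi>) = n"
  proof -
    obtain \<psi> where "leq n \<phi> \<psi>" "blk \<psi> = (\<lambda>a b. a = b \<and> a \<in> {1..n})" using discrete_above[OF \<phi>] .
    then show ?thesis using discrete_card[OF \<phi>] max by blast
  qed
  show "\<not> cov n \<phi> \<psi> i j" using max[of \<psi>] cov_card[of n \<phi> \<psi> i j] unfolding cov_def by auto
qed

lemma upper_covers_top: "upper_covers (NC2_hat n) (hat_le n) Hat_one = {}"
proof -
  have "\<not> strict_of (hat_le n) Hat_one y" for y by (cases y) (auto simp: strict_of_def)
  then show ?thesis unfolding upper_covers_def by blast
qed

text \<open>Codes become place maps and labels become pairs; this is the form in which the order on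
  covers enters the arguments.\<close>

lemma up_less_iff:
  assumes c: "cov n \<phi> \<psi> i j" and c': "cov n \<phi> \<psi>' i' j'"
  shows "hat_up_less n (Elem \<phi>) (Elem \<psi>) (Elem \<psi>') \<longleftrightarrow>
    pos_less (pos n \<psi>) (pos n \<psi>') \<or> pos n \<psi> = pos n \<psi>' \<and> (i < i' \<or> i = i' \<and> j < j')"
proof -
  have le: "leq n \<phi> \<psi>" "leq n \<phi> \<psi>'" and ij: "i < j" "i' < j'" "blk \<phi> i j" "blk \<phi> i' j'"
    and eq: "blk \<psi> = split_rel (blk \<phi>) i j" "blk \<psi>' = split_rel (blk \<phi>) i' j'"
    using c c' unfolding cov_def by blast+
  note \<phi> = leq_NC2(1)[OF le(1)] and \<psi> = leq_NC2(2)[OF le(1)] and \<psi>' = leq_NC2(2)[OF le(2)]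
  note part = NC_partition[OF NC2_fst]
  \<comment> \<open>Ranks use truncated subtraction; that \<phi> has at least one block makes the
    inequality between ranks strict.\<close>
  have "finite (fst \<phi>)" using finite_elements part[OF \<phi>] by blast
  moreover have "fst \<phi> \<noteq> {}" using ij unfolding same_block_def by blast
  ultimately have "card (fst \<phi>) > 0" by (simp add: card_gt_0_iff)
  then have rank: "nc2_rank \<phi> < n - 1"
    using cov_card[OF c] NC2_card_le[OF \<psi>] unfolding nc2_rank_def by simp
  have up: "Elem \<psi> \<in> nc2_up n \<phi>" "Elem \<psi>' \<in> nc2_up n \<phi>"
    unfolding nc2_up_def using upper_covers_Elem c c' by blast+
  have lab: "nc_label (fst \<phi>) (fst \<psi>) = transpose i j" "nc_label (fst \<phi>) (fst \<psi>') = transpose i' j'"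
    using nc_label_split[OF part[OF \<phi>] part[OF \<psi>] _ eq(1) ij(3,1)]
      nc_label_split[OF part[OF \<phi>] part[OF \<psi>'] _ eq(2) ij(4,2)] by simp_all
  show ?thesis
    unfolding hat_up_less_def up_less_def Let_def
    using rank up lab word_less_iff[OF \<psi> \<psi>'] transposition_less_transpose[OF ij(1,2)] by auto
qed

lemma hat_up_less_D:
  assumes "hat_up_less n x u v"
  obtains \<phi> \<psi> \<psi>' i j i' j' where "x = Elem \<phi>" "u = Elem \<psi>" "v = Elem \<psi>'" "cov n \<phi> \<psi> i j" "cov n \<phi> \<psi>' i' j'"
  using assms unfolding hat_up_less_def up_less_def nc2_up_def using upper_covers_Elem by metis

lemma hat_up_less_strict_total:
  "strict_total_order_on (upper_covers (NC2_hat n) (hat_le n) x) (hat_up_less n x)"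
  unfolding strict_total_order_on_def
proof (intro conjI irreflp_onI transp_onI totalp_onI)
  show "\<not> hat_up_less n x u u" for u
  proof
    assume h: "hat_up_less n x u u"
    then obtain \<phi> \<psi> i j where "x = Elem \<phi>" "u = Elem \<psi>" "cov n \<phi> \<psi> i j"
      using hat_up_less_D by metis
    then show False using h up_less_iff pos_less_irrefl by blast
  qed
  show "hat_up_less n x u w" if uv: "hat_up_less n x u v" and vw: "hat_up_less n x v w" for u v w
  proof -
    obtain \<phi> \<psi>1 \<psi>2 i1 j1 i2 j2 where 1: "x = Elem \<phi>" "u = Elem \<psi>1" "v = Elem \<psi>2" "cov n \<phi> \<psi>1 i1 j1" "cov n \<phi> \<psi>2 i2 j2"
      using hat_up_less_D[OF uv] .
    obtain \<psi>3 i3 j3 where 2: "w = Elem \<psi>3" "cov n \<phi> \<psi>3 i3 j3"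
      using hat_up_less_D[OF vw] 1(1,3) by (metis with_top.inject)
    note iff = up_less_iff[OF 1(4,5)] up_less_iff[OF 1(5) 2(2)] up_less_iff[OF 1(4) 2(2)]
    show ?thesis
      using uv vw unfolding 1(1-3) 2(1) iff by (metis pos_less_trans less_trans)
  qed
  show "hat_up_less n x u v \<or> hat_up_less n x v u"
    if u: "u \<in> upper_covers (NC2_hat n) (hat_le n) x" and v: "v \<in> upper_covers (NC2_hat n) (hat_le n) x" and "u \<noteq> v" for u v
  proof -
    obtain \<phi> where x: "x = Elem \<phi>" using u upper_covers_top by (cases x) auto
    \<comment> \<open>\<open>Hat_one\<close> covers only maximal elements of \<open>NC2 n\<close>,
      so it never competes with another cover.\<close>
    have no_top: "\<not> (Elem \<psi> \<in> upper_covers (NC2_hat n) (hat_le n) x \<and>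
        Hat_one \<in> upper_covers (NC2_hat n) (hat_le n) x)" for \<psi>
      unfolding x upper_covers_Elem using upper_covers_Hat_one(3) by blast
    obtain \<psi> \<psi>' where \<psi>: "u = Elem \<psi>" and \<psi>': "v = Elem \<psi>'"
      using u v \<open>u \<noteq> v\<close> no_top by (cases u; cases v) blast+
    obtain i j i' j' where c: "cov n \<phi> \<psi> i j" "cov n \<phi> \<psi>' i' j'"
      using u v upper_covers_Elem unfolding x \<psi> \<psi>' by blast
    have in': "\<psi> \<in> NC2 n" "\<psi>' \<in> NC2 n" using c leq_NC2 unfolding cov_def by blast+
    show ?thesis
    proof (cases "pos n \<psi> = pos n \<psi>'")
      case True
      have "(i, j) \<noteq> (i', j')"
      proof
        assume "(i, j) = (i', j')"
        then have "blk \<psi> = blk \<psi>'" using c unfolding cov_def by simp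
        then show False using NC2_eqI[OF in' _ True] \<open>u \<noteq> v\<close> \<psi> \<psi>' by blast
      qed
      then show ?thesis unfolding x \<psi> \<psi>' up_less_iff[OF c] up_less_iff[OF c(2,1)] using True by auto
    next
      case False
      then show ?thesis unfolding x \<psi> \<psi>' up_less_iff[OF c] up_less_iff[OF c(2,1)]
        using pos_less_total[OF pos_permutes[OF in'(1)] pos_permutes[OF in'(2)]] by blast
    qed
  qed
qed

text \<open>Codes do not decrease along the order, so any element strictly above \<open>x\<close>
  with a small code yields a cover of \<open>x\<close> with a code at most as large.\<close>

lemma up_less_of_pos_less:
  assumes c: "cov n x p i j" and r: "leq n x r" "r \<noteq> x" "leq n r p2" and less: "pos_less (pos n r) (pos n p)"
  shows "\<exists>\<chi> a b. cov n x \<chi> a b \<and> leq n \<chi> p2 \<and> hat_up_less n (Elem x) (Elem \<chi>) (Elem p)"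
proof -
  obtain \<chi> a b where \<chi>: "cov n x \<chi> a b" "leq n \<chi> r" using cov_exists[OF r(1)] r(2) by metis
  have "pos_less (pos n \<chi>) (pos n p)" using leq_pos_less[OF \<chi>(2)] less pos_less_trans by metis
  then show ?thesis using up_less_iff[OF \<chi>(1) c] \<chi> leq_trans[OF \<chi>(2) r(3)] by blast
qed

text \<open>By monotonicity of codes, \<open>p2\<close>, the first cover below \<open>z\<close>, has
  minimal code among all elements strictly above \<open>p\<close> and below \<open>z\<close>. In
  this form its choice enters the case of a changing and that of a constant permutation.\<close>

lemma descent_below:
  assumes cp: "cov n x p i j" and cq: "cov n x q i' j'" and qp: "hat_up_less n (Elem x) (Elem q) (Elem p)"
    and cp2: "cov n p p2 k l" and qz: "leq n q z" and p2z: "leq n p2 z"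
    and first: "\<And>y a b. cov n p y a b \<Longrightarrow> leq n y z \<Longrightarrow> \<not> hat_up_less n (Elem p) (Elem y) (Elem p2)"
  shows "\<exists>r a b. cov n x r a b \<and> leq n r p2 \<and> hat_up_less n (Elem x) (Elem r) (Elem p)"
proof -
  have qp': "pos_less (pos n q) (pos n p) \<or> pos n q = pos n p \<and> (i' < i \<or> i' = i \<and> j' < j)"
    using qp up_less_iff[OF cq cp] by blast
  then have q_first: "\<not> pos_less (pos n p) (pos n q)" using pos_less_trans pos_less_irrefl by metis
  have p2_min: "\<not> pos_less (pos n y) (pos n p2)" if y: "leq n p y" "y \<noteq> p" "leq n y z" for y
  proof
    assume "pos_less (pos n y) (pos n p2)"
    moreover obtain \<chi> a b where \<chi>: "cov n p \<chi> a b" "leq n \<chi> y" using cov_exists[OF y(1)] y(2) by metis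
    ultimately have "pos_less (pos n \<chi>) (pos n p2)" using leq_pos_less[OF \<chi>(2)] pos_less_trans by metis
    then show False using first[OF \<chi>(1) leq_trans[OF \<chi>(2) y(3)]] up_less_iff[OF \<chi>(1) cp2] by blast
  qed
  show ?thesis
  proof (cases "pos n p = pos n x")
    case False
    have "q \<noteq> p" using qp hat_up_less_strict_total[of n "Elem x"] upper_covers_Elem cp
      unfolding strict_total_order_on_def irreflp_on_def by blast
    then obtain r where "leq n x r" "r \<noteq> x" "leq n r p2" "pos_less (pos n r) (pos n p)"
      using descent_if_permutation_changes[OF cp cq _ cp2 p2z qz q_first p2_min False] by blast
    then show ?thesis using up_less_of_pos_less[OF cp] by blast
  next
    case True
    have xq: "leq n x q" using cq unfolding cov_def by blast
    have pos_q: "pos n q = pos n x" using leq_pos_less[OF xq] q_first True by metis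
    then have label: "i' < i \<or> i' = i \<and> j' < j" using qp' True pos_less_irrefl by metis
    have p2_label: "\<not> (a < k \<or> a = k \<and> b < l)" if "cov n p y a b" "leq n y z" "pos n y = pos n p2" for y a b
      using first[OF that(1,2)] up_less_iff[OF that(1) cp2] that(3) by blast
    have "\<exists>r a b. cov n x r a b \<and> leq n r p2 \<and> pos n r = pos n p \<and> (a < i \<or> a = i \<and> b < j)"
      by (rule descent_if_permutation_constant[OF cp cq label cp2 p2z qz True pos_q])
        (fact p2_min, fact p2_label)
    then obtain r a b where r: "cov n x r a b" "leq n r p2" "pos n r = pos n p" "a < i \<or> a = i \<and> b < j"
      by blast
    then show ?thesis using up_less_iff[OF r(1) cp] by blast
  qed
qed

text \<open>Here \<open>p2\<close> is first among all covers of \<open>p\<close>. If it changed the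
  permutation, the cover with the same blocks and the permutation of \<open>p\<close> would precede
  it. Hence no value moves from \<open>p\<close> to \<open>p2\<close>.\<close>

lemma descent_below_top:
  assumes cp: "cov n x p i j" and cq: "cov n x q i' j'" and qp: "hat_up_less n (Elem x) (Elem q) (Elem p)"
    and cp2: "cov n p p2 k l"
    and first: "\<And>y a b. cov n p y a b \<Longrightarrow> \<not> hat_up_less n (Elem p) (Elem y) (Elem p2)"
  shows "\<exists>r a b. cov n x r a b \<and> leq n r p2 \<and> hat_up_less n (Elem x) (Elem r) (Elem p)"
proof -
  have xp: "leq n x p" and xq: "leq n x q" and pp2: "leq n p p2" and kl: "k < l" "blk p k l"
    and bp2: "blk p2 = split_rel (blk p) k l" using cp cq cp2 unfolding cov_def by blast+
  note pn = leq_NC2(1)[OF pp2] and p2n = leq_NC2(2)[OF pp2] and xn = leq_NC2(1)[OF xp] and qn = leq_NC2(2)[OF xq]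
  obtain p' where p': "leq n p p'" "blk p' = blk p2" "pos n p' = pos n p"
    using leq_same_pos[OF pn blk_nc_rel[OF p2n] leq_blk[OF pp2]] .
  have cp': "cov n p p' k l" unfolding cov_def using p' kl bp2 by simp
  have pos_p2: "pos n p2 = pos n p"
    using first[OF cp'] up_less_iff[OF cp' cp2] leq_pos_less[OF pp2] p'(3) by metis
  show ?thesis
  proof (cases "pos n p = pos n x")
    case False
    obtain w where w: "agree (Suc w) (pos n p) (pos n x)" "pos n p w \<noteq> pos n x w"
      using not_agree_greatest[OF pn xn, of 0] False agree_0 by metis
    obtain r where "leq n x r" "r \<noteq> x" "leq n r p2" "pos_less (pos n r) (pos n p)"
      using descent_if_unmoved[OF cp cp2 w] pos_p2 agree_refl by metis
    then show ?thesis using up_less_of_pos_less[OF cp] by blast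
  next
    case True
    \<comment> \<open>With one permutation throughout, the partition into singletons carrying it
      lies above both \<open>p2\<close> and \<open>q\<close>, and the case of a proper upper bound
      applies.\<close>
    obtain z where z: "leq n p2 z" "blk z = (\<lambda>a b. a = b \<and> a \<in> {1..n})" "pos n z = pos n p2"
      using discrete_above[OF p2n] .
    have "\<not> pos_less (pos n p) (pos n q)"
      using qp up_less_iff[OF cq cp] pos_less_trans pos_less_irrefl by metis
    then have pos_q: "pos n q = pos n x" using leq_pos_less[OF xq] True by metis
    have refl: "blk q a a" if "a \<in> {1..n}" for a using nc_rel_refl[OF blk_nc_rel[OF qn]] that by blast
    have "leq n q z"
    proof (rule leqI[OF qn leq_NC2(2)[OF z(1)]])
      show "blk q a b" if "blk z a b" for a b using that refl unfolding z(2) by blast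
      show "blk q (pos n q v) (pos n z v)" if "v \<in> {1..n}" for v
        using refl pos_range[OF qn, of v] that z(3) pos_p2 True pos_q by simp
    qed
    then show ?thesis using descent_below[OF cp cq qp cp2 _ z(1)] first by blast
  qed
qed

theorem theorem31:
  fixes n :: nat
  assumes "n \<ge> 1"
  shows "is_shelling (NC2_hat n) (hat_le n) (chain_lex (hat_le n) (hat_up_less n))"
proof -
  obtain \<beta> where \<beta>: "\<beta> \<in> NC2 n" "\<And>\<phi>. \<phi> \<in> NC2 n \<Longrightarrow> leq n \<beta> \<phi>" using NC2_bottom by blast
  interpret cover_orders "NC2_hat n" "hat_le n" "Elem \<beta>" Hat_one "hat_up_less n"
  proof unfold_locales
    show "finite (NC2_hat n)" unfolding NC2_hat_def using finite_NC2 by simp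
    show "poset_on (NC2_hat n) (hat_le n)" by (rule hat_le_poset)
    show "Elem \<beta> \<in> NC2_hat n" "Hat_one \<in> NC2_hat n" using \<beta> in_NC2_hat by auto
    show "hat_le n (Elem \<beta>) x" if "x \<in> NC2_hat n" for x
      using that \<beta> unfolding in_NC2_hat leq_def by auto
    show "strict_total_order_on (upper_covers (NC2_hat n) (hat_le n) x) (hat_up_less n x)" for x
      by (rule hat_up_less_strict_total)
  qed simp
  \<comment> \<open>Blocks are counted, one more than the rank. The value \<open>Suc n\<close> fits
    because \<open>Hat_one\<close> covers only partitions into \<open>n\<close> blocks.\<close>
  define rk where "rk x = (case x of Elem \<phi> \<Rightarrow> card (fst \<phi>) | Hat_one \<Rightarrow> Suc n)" for x :: "nc2 with_top"
  show ?thesis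
  proof (rule is_shelling_chain_lex[where rk = rk])
    show "rk y = Suc (rk x)" if u: "y \<in> upper_covers (NC2_hat n) (hat_le n) x" for x y
    proof -
      obtain \<phi> where x: "x = Elem \<phi>" using u upper_covers_top by (cases x) auto
      show ?thesis
      proof (cases y)
        case (Elem \<psi>)
        then obtain i j where "cov n \<phi> \<psi> i j" using u unfolding x Elem upper_covers_Elem by blast
        from cov_card[OF this] show ?thesis unfolding x Elem rk_def by simp
      next
        case Hat_one
        then show ?thesis using u upper_covers_Hat_one(2) unfolding x Hat_one rk_def by auto
      qed
    qed
    show "rk x < rk y" if x: "x \<in> NC2_hat n" and y: "y \<in> NC2_hat n" and lt: "strict_of (hat_le n) x y" for x y
    proof (cases x)
      case xe: (Elem \<phi>)
      then have \<phi>: "\<phi> \<in> NC2 n" using x in_NC2_hat by blast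
      show ?thesis
      proof (cases y)
        case (Elem \<psi>)
        then have "\<psi> \<in> NC2 n" using y in_NC2_hat by blast
        then have "leq n \<phi> \<psi>" "\<phi> \<noteq> \<psi>"
          using lt hat_le_Elem[OF \<phi>] unfolding xe Elem strict_of_def by blast+
        from leq_card[OF this] show ?thesis unfolding xe Elem rk_def by simp
      next
        case Hat_one
        then show ?thesis using NC2_card_le[OF \<phi>] unfolding xe rk_def by simp
      qed
    next
      case Hat_one
      then show ?thesis using lt by (cases y) (simp_all add: strict_of_def)
    qed
    fix x p p2 q z
    assume p: "p \<in> upper_covers (NC2_hat n) (hat_le n) x" and q: "q \<in> upper_covers (NC2_hat n) (hat_le n) x"
      and qp: "hat_up_less n x q p" and z: "z \<in> NC2_hat n" and qz: "hat_le n q z"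
      and p2: "p2 \<in> upper_covers (NC2_hat n) (hat_le n) p" and p2z: "hat_le n p2 z"
      and first: "\<And>y. y \<in> upper_covers (NC2_hat n) (hat_le n) p \<Longrightarrow> hat_le n y z \<Longrightarrow> \<not> hat_up_less n p y p2"
    obtain \<phi> \<psi> \<psi>' i j i' j' where e: "x = Elem \<phi>" "q = Elem \<psi>'" "p = Elem \<psi>" "cov n \<phi> \<psi>' i' j'" "cov n \<phi> \<psi> i j"
      using hat_up_less_D[OF qp] by metis
    show "\<exists>r\<in>upper_covers (NC2_hat n) (hat_le n) x. hat_le n r p2 \<and> hat_up_less n x r p"
    proof (cases p2)
      case Hat_one
      \<comment> \<open>Everything lies below \<open>p2\<close> in this case, so \<open>q\<close>
        itself serves as \<open>r\<close>.\<close>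
      then show ?thesis using q qp by auto
    next
      case (Elem \<psi>2)
      then obtain k l where c2: "cov n \<psi> \<psi>2 k l" using p2 upper_covers_Elem unfolding e by blast
      have "\<exists>r a b. cov n \<phi> r a b \<and> leq n r \<psi>2 \<and> hat_up_less n (Elem \<phi>) (Elem r) (Elem \<psi>)"
      proof (cases z)
        case (Elem \<zeta>)
        have le: "leq n \<psi>' \<zeta>" "leq n \<psi>2 \<zeta>"
          using qz p2z z e c2 \<open>p2 = Elem \<psi>2\<close> Elem leq_NC2 unfolding cov_def leq_def in_NC2_hat by auto
        show ?thesis
        proof (rule descent_below[OF e(5,4) _ c2 le])
          show "hat_up_less n (Elem \<phi>) (Elem \<psi>') (Elem \<psi>)" using qp e by simp
          show "\<not> hat_up_less n (Elem \<psi>) (Elem y) (Elem \<psi>2)" if "cov n \<psi> y a b" "leq n y \<zeta>" for y a b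
            using first[of "Elem y"] that upper_covers_Elem e Elem \<open>p2 = Elem \<psi>2\<close> unfolding leq_def by auto
        qed
      next
        case Hat_one
        show ?thesis
        proof (rule descent_below_top[OF e(5,4) _ c2])
          show "hat_up_less n (Elem \<phi>) (Elem \<psi>') (Elem \<psi>)" using qp e by simp
          show "\<not> hat_up_less n (Elem \<psi>) (Elem y) (Elem \<psi>2)" if "cov n \<psi> y a b" for y a b
            using first[of "Elem y"] that upper_covers_Elem e Hat_one \<open>p2 = Elem \<psi>2\<close> by auto
        qed
      qed
      then obtain r a b where "cov n \<phi> r a b" "leq n r \<psi>2" "hat_up_less n (Elem \<phi>) (Elem r) (Elem \<psi>)" by blast
      then show ?thesis using upper_covers_Elem e Elem unfolding leq_def by (intro bexI[of _ "Elem r"]) auto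
    qed
  qed
qed

end
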